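(* Let $M=\{\theta_2\in J^2\pi : \omega^{(2)}|_{\theta_2}=0\}$, and let $0_2=[\mathbf 0]^2_0\in J^2\pi$ be the 2-jet at the origin $0\in\mathbb{R}^2$ of the zero section $\mathbf 0$ of $\pi$. Then $M=\mathrm{Orb}_{0_2}$, where $\mathrm{Orb}_{0_2}$ is the orbit of $0_2$ under the action of $\Gamma$ on $J^2\pi$, i.e. $\mathrm{Orb}_{0_2}=\{f^{(2)}(0_2): f\in\Gamma,\ 0\in\text{domain of } f\}$.
   Context: All manifolds and maps are smooth. $[h]^k_p$ denotes the $k$-jet of $h$ at $p$. **Bundle and lifts.** $\pi:E=\mathbb{R}^2\times\mathbb{R}^4\to\mathbb{R}^2$ is the product bundle, with base coordinates $(x^1,x^2)=(x,y)$ and fibre coordinates $u^0,u^1,u^2,u^3$. An ODE $y''=u^0(x,y)+u^1(x,y)y'+u^2(x,y)(y')^2+u^3(x,y)(y')^3$ is identified with the section $(x^1,x^2)\mapsto(x^1,x^2,u^0,\dots,u^3)$ of $\pi$. A point transformation is a diffeomorphism $f$ between open subsets of the base $\mathbb{R}^2$; $\Gamma$ is the pseudogroup of all of them. A point transformation $f$ takes each such ODE to an ODE of the same form, and this defines the lift $f^{(0)}$ of $f$ to $\pi$: with $g=(g^1,g^2)=f^{-1}$, $f^{(0)}$ sends $(p,u^0,\dots,u^3)$ to $(f(p),\tilde u^0,\dots,\tilde u^3)$, where $\tilde u^\alpha$ is the coefficient of $q^\alpha$ in the polynomial $J^{-1}\bigl(u^0a^3+u^1a^2b+u^2ab^2+u^3b^3-aB+bA\bigr)$,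 with $a=g^1_1+g^1_2q$, $b=g^2_1+g^2_2q$, $A=g^1_{11}+2g^1_{12}q+g^1_{22}q^2$, $B=g^2_{11}+2g^2_{12}q+g^2_{22}q^2$, $J=g^1_1g^2_2-g^1_2g^2_1$ (lower indices are partial derivatives of $g^i$ at $f(p)$). $J^k\pi$ is the bundle of $k$-jets of sections of $\pi$, $\pi_k:J^k\pi\to\mathbb{R}^2$ and $\pi_{k,r}:J^k\pi\to J^r\pi$ are the projections. The lift $f^{(k)}$ to $J^k\pi$ is $f^{(k)}([S]^k_p)=[f^{(0)}\circ S\circ f^{-1}]^k_{f(p)}$. A vector field $X$ on the base with flow $f_t$ has lift $X^{(k)}$, the vector field on $J^k\pi$ with flow $f_t^{(k)}$; $X^{(k)}_{\theta_k}$ depends only on $[X]^{k+2}_p$. **Formal vector fields.** $W_p$ is the Lie algebra of $\infty$-jets at $p$ of vector fields on the base, $L^k_p=\{[X]^\infty_p: [X]^k_p=0\}$ for $k\ge0$, $V_p=W_p/L^0_p\cong T_p\mathbb{R}^2$. $W_p/L^k_p$ is identified with $k$-jets $[X]^k_p$. For $i>j\ge 0$, $\rho_{i,j}:W_p/L^i_p\to W_p/L^j_p$, $[X]^i_p\mapsto[X]^j_p$, and $\rho_i=\rho_{i,0}$. The bracket induces $[\cdot,\cdot]:W_p/L^k_p\times W_p/L^k_p\to W_p/L^{k-1}_p$. A 2-dimensional subspace $H\subset W_p/L^k_p$ is horizontal if $\rho_k(H)=V_p$. **The space $g$.** $g=g_p\subset L^1_p/L^2_p$ is the 2-dimensional space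 of 2-jets (with zero 1-jet) whose second derivatives $X^i_{jk}$ at $p$ satisfy $X^2_{11}=0$, $X^1_{11}-2X^2_{12}=0$, $2X^1_{12}-X^2_{22}=0$, $X^1_{22}=0$. **Isotropy spaces.** For $\theta_{k+1}=[S]^{k+1}_p$ and $\theta_k=\pi_{k+1,k}(\theta_{k+1})$, $\mathcal H_{\theta_{k+1}}\subset T_{\theta_k}J^k\pi$ is the tangent space at $\theta_k$ to the image of $j_kS:q\mapsto[S]^k_q$. Put $\mathcal A_{\theta_{k+1}}=\{[X]^{2+k}_p\in W_p/L^{2+k}_p : X^{(k)}_{\theta_k}\in\mathcal H_{\theta_{k+1}}\}$. If $[X]^{k+2}_p,[Y]^{k+2}_p\in\mathcal A_{\theta_{k+1}}$ ($k\ge1$), their bracket lies in $\mathcal A_{\theta_k}$. **The form $\omega^{(2)}$.** Let $H_p\subset W_p/L^1_p$ be the horizontal subspace of 1-jets of constant vector fields. Let $\theta_2\in J^2\pi$, $p=\pi_2(\theta_2)$, $\theta_1=\pi_{2,1}(\theta_2)$. There is a unique horizontal subspace $H_{\theta_1}\subset\mathcal A_{\theta_1}$ with $\rho_{2,1}(H_{\theta_1})=H_p$ and $[(\rho_2|_{H_{\theta_1}})^{-1}(v),(\rho_2|_{H_{\theta_1}})^{-1}(w)]=0$ in $W_p/L^1_p$ for all $v,w\in V_p$. There is a unique horizontal subspace $H_{\theta_2}\subset\mathcal A_{\theta_2}$ with $\rho_{3,2}(H_{\theta_2})=H_{\theta_1}$. Define $\omega_{\theta_2}(v,w)=[(\rho_3|_{H_{\theta_2}})^{-1}(v),(\rho_3|_{H_{\theta_2}})^{-1}(w)]\in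 W_p/L^2_p$; it takes values in $g_p$, so $\omega_{\theta_2}\in g_p\otimes\wedge^2V_p^*$. The horizontal $g$-valued 2-form $\omega^{(2)}$ on $J^2\pi$ is $\omega^{(2)}|_{\theta_2}=\pi_2^*(\omega_{\theta_2})$. *)

theory Defs
  imports
    "HOL-Analysis.Analysis"
    "HOL-Computational_Algebra.Polynomial"
    "HOL-Library.Function_Algebras"
begin

text \<open>Jets are stored as arrays of partial derivatives, of type \<open>nat \<Rightarrow> nat \<Rightarrow> 'b\<close>. The pointwise
  scalar multiplication (addition comes from the imported \<open>Function_Algebras\<close>) makes the library
  notions \<open>subspace\<close> and \<open>dim\<close> available for spaces of jets.\<close>

instantiation "fun" :: (type, real_vector) real_vector
begin

definition scaleR_fun :: "real \<Rightarrow> ('a \<Rightarrow> 'b) \<Rightarrow> 'a \<Rightarrow> 'b"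
  where "scaleR_fun c f = (\<lambda>x. c *\<^sub>R f x)"

instance
  by standard (auto simp: scaleR_fun_def fun_eq_iff scaleR_add_right scaleR_add_left)

end


section \<open>Smooth maps and jets\<close>

definition dird :: "'a::euclidean_space \<Rightarrow> ('a \<Rightarrow> 'b::real_normed_vector) \<Rightarrow> 'a \<Rightarrow> 'b"
  where "dird v h = (\<lambda>x. frechet_derivative h (at x) v)"

text \<open>All iterated directional derivatives exist and are (Frechet) differentiable, hence continuous:
  this is \<open>C\<^sup>\<infinity>\<close> on an open set.\<close>

definition smooth_on :: "'a::euclidean_space set \<Rightarrow> ('a \<Rightarrow> 'b::real_normed_vector) \<Rightarrow> bool"
  where "smooth_on U h \<longleftrightarrow> open U \<and> (\<forall>vs. \<forall>x\<in>U. (foldr dird vs h) differentiable (at x))"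

definition smooth_near :: "'a::euclidean_space \<Rightarrow> ('a \<Rightarrow> 'b::real_normed_vector) \<Rightarrow> bool"
  where "smooth_near p h \<longleftrightarrow> (\<exists>N. p \<in> N \<and> smooth_on N h)"

type_synonym point = "real^2"

abbreviation partial :: "2 \<Rightarrow> (point \<Rightarrow> 'b::real_normed_vector) \<Rightarrow> point \<Rightarrow> 'b"
  where "partial i \<equiv> dird (axis i 1)"

text \<open>The fibre part of the \<open>k\<close>-jet of \<open>h\<close> at \<open>p\<close>: entry \<open>i j\<close> is
  \<open>\<partial>\<^sup>i\<^sup>+\<^sup>jh / \<partial>x\<^sup>i\<partial>y\<^sup>j\<close> at \<open>p\<close> for \<open>i + j \<le> k\<close>, and all other entries are \<open>0\<close>.\<close>

definition jet :: "nat \<Rightarrow> (point \<Rightarrow> 'b::real_normed_vector) \<Rightarrow> point \<Rightarrow> nat \<Rightarrow> nat \<Rightarrow> 'b"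
  where "jet k h p = (\<lambda>i j. if i + j \<le> k then (partial 1 ^^ i) ((partial 2 ^^ j) h) p else 0)"

definition trunc :: "nat \<Rightarrow> (nat \<Rightarrow> nat \<Rightarrow> 'b::zero) \<Rightarrow> nat \<Rightarrow> nat \<Rightarrow> 'b"
  where "trunc r c = (\<lambda>i j. if i + j \<le> r then c i j else 0)"


section \<open>The bundle and its jet bundles\<close>

text \<open>The fibre coordinates \<open>u\<^sup>0, \<dots>, u\<^sup>3\<close> are \<open>u $ 0, \<dots>, u $ 3\<close>, the index type \<open>4\<close> being the
  integers modulo 4.\<close>

type_synonym total = "point \<times> (real^4)"
type_synonym jet_point = "point \<times> (nat \<Rightarrow> nat \<Rightarrow> real^4)"

definition section_near :: "point \<Rightarrow> (point \<Rightarrow> total) \<Rightarrow> bool"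
  where "section_near p S \<longleftrightarrow> (\<exists>N. p \<in> N \<and> smooth_on N S \<and> (\<forall>x\<in>N. fst (S x) = x))"

definition sjet :: "nat \<Rightarrow> (point \<Rightarrow> total) \<Rightarrow> point \<Rightarrow> jet_point"
  where "sjet k S p = (p, jet k (snd \<circ> S) p)"

definition jet_bundle :: "nat \<Rightarrow> jet_point set"
  where "jet_bundle k = {sjet k S p | S p. section_near p S}"

text \<open>The projection \<open>\<pi>\<^sub>k\<close> is \<open>fst\<close>; the following is \<open>\<pi>\<^sub>k\<^sub>,\<^sub>r\<close>.\<close>

definition jproj :: "nat \<Rightarrow> jet_point \<Rightarrow> jet_point"
  where "jproj r \<theta> = (fst \<theta>, trunc r (snd \<theta>))"

definition section_rep :: "nat \<Rightarrow> jet_point \<Rightarrow> point \<Rightarrow> total"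
  where "section_rep k \<theta> = (SOME S. section_near (fst \<theta>) S \<and> sjet k S (fst \<theta>) = \<theta>)"

text \<open>The jet bundle of order \<open>k\<close> is an affine space, so all its tangent spaces are given by:\<close>

definition tangent_space :: "nat \<Rightarrow> jet_point set"
  where "tangent_space k = {\<xi>. trunc k (snd \<xi>) = snd \<xi>}"

definition velocity :: "(real \<Rightarrow> jet_point) \<Rightarrow> jet_point \<Rightarrow> bool"
  where "velocity \<gamma> \<xi> \<longleftrightarrow>
    ((\<lambda>t. fst (\<gamma> t)) has_vector_derivative fst \<xi>) (at 0) \<and>
    (\<forall>i j. ((\<lambda>t. snd (\<gamma> t) i j) has_vector_derivative snd \<xi> i j) (at 0))"


section \<open>Point transformations and their lifts\<close>

definition point_transformation :: "point set \<Rightarrow> (point \<Rightarrow> point) \<Rightarrow> bool"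
  where "point_transformation U f \<longleftrightarrow>
    smooth_on U f \<and> inj_on f U \<and> smooth_on (f ` U) (inv_into U f)"

text \<open>The coefficients of \<open>P\<close>, a polynomial in \<open>q = y'\<close>, are those of the transformed equation.\<close>

definition lift0 :: "point set \<Rightarrow> (point \<Rightarrow> point) \<Rightarrow> total \<Rightarrow> total"
  where "lift0 U f = (\<lambda>(p, u).
    let z = f p;
        g1 = (\<lambda>x. inv_into U f x $ 1);
        g2 = (\<lambda>x. inv_into U f x $ 2);
        a = [:partial 1 g1 z, partial 2 g1 z:];
        b = [:partial 1 g2 z, partial 2 g2 z:];
        A = [:partial 1 (partial 1 g1) z, 2 * partial 1 (partial 2 g1) z, partial 2 (partial 2 g1) z:];
        B = [:partial 1 (partial 1 g2) z, 2 * partial 1 (partial 2 g2) z, partial 2 (partial 2 g2) z:];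
        J = partial 1 g1 z * partial 2 g2 z - partial 2 g1 z * partial 1 g2 z;
        P = smult (inverse J)
              (smult (u $ 0) (a ^ 3) + smult (u $ 1) (a ^ 2 * b) + smult (u $ 2) (a * b ^ 2)
               + smult (u $ 3) (b ^ 3) - a * B + b * A)
    in (z, \<Sum>\<alpha><4. coeff P \<alpha> *\<^sub>R axis (of_nat \<alpha>) 1))"

definition lift :: "nat \<Rightarrow> point set \<Rightarrow> (point \<Rightarrow> point) \<Rightarrow> jet_point \<Rightarrow> jet_point"
  where "lift k U f \<theta> =
    sjet k (lift0 U f \<circ> section_rep k \<theta> \<circ> inv_into U f) (f (fst \<theta>))"

definition orbit :: "nat \<Rightarrow> jet_point \<Rightarrow> jet_point set"
  where "orbit k \<theta> = {lift k U f \<theta> | U f. point_transformation U f \<and> fst \<theta> \<in> U}"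

text \<open>\<open>\<phi>\<close> is a local flow on \<open>U\<close>, for times in an interval about \<open>0\<close>, of the vector field \<open>X\<close>.\<close>

definition local_flow :: "(point \<Rightarrow> point) \<Rightarrow> point set \<Rightarrow> (real \<Rightarrow> point \<Rightarrow> point) \<Rightarrow> bool"
  where "local_flow X U \<phi> \<longleftrightarrow> (\<exists>\<epsilon>>0. \<exists>N. smooth_on N X \<and>
    smooth_on ({-\<epsilon><..<\<epsilon>} \<times> U) (\<lambda>(t, x). \<phi> t x) \<and>
    (\<forall>x\<in>U. \<phi> 0 x = x) \<and>
    (\<forall>t\<in>{-\<epsilon><..<\<epsilon>}. point_transformation U (\<phi> t) \<and>
      (\<forall>x\<in>U. \<phi> t x \<in> N \<and> ((\<lambda>s. \<phi> s x) has_vector_derivative X (\<phi> t x)) (at t))))"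

text \<open>\<open>\<xi>\<close> is the value at \<open>\<theta>\<close> of the lift \<open>X\<^sup>(\<^sup>k\<^sup>)\<close> of \<open>X\<close> to the \<open>k\<close>-th jet bundle, that
  is, the initial velocity of the lifted flow. It does not depend on the choice of the local flow.\<close>

definition has_lifted_value ::
    "nat \<Rightarrow> (point \<Rightarrow> point) \<Rightarrow> jet_point \<Rightarrow> jet_point \<Rightarrow> bool"
  where "has_lifted_value k X \<theta> \<xi> \<longleftrightarrow>
    (\<exists>U \<phi>. fst \<theta> \<in> U \<and> local_flow X U \<phi> \<and> velocity (\<lambda>t. lift k U (\<phi> t) \<theta>) \<xi>)"


section \<open>Formal vector fields\<close>

text \<open>The quotient \<open>W\<^sub>p / L\<^sup>k\<^sub>p\<close>, identified with \<open>k\<close>-jets. The projection \<open>\<rho>\<^sub>i\<^sub>,\<^sub>j\<close> is \<open>trunc j\<close>, and \<open>\<rho>\<^sub>k\<close>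
  followed by the identification of \<open>V\<^sub>p\<close> with the tangent space of the plane is \<open>rho\<close>.\<close>

type_synonym vjet = "nat \<Rightarrow> nat \<Rightarrow> point"

definition W :: "nat \<Rightarrow> point \<Rightarrow> vjet set"
  where "W k p = {jet k X p | X. smooth_near p X}"

definition rho :: "vjet \<Rightarrow> point"
  where "rho a = a 0 0"

definition lie_bracket :: "(point \<Rightarrow> point) \<Rightarrow> (point \<Rightarrow> point) \<Rightarrow> point \<Rightarrow> point"
  where "lie_bracket X Y = (\<lambda>x. dird (X x) Y x - dird (Y x) X x)"

definition field_rep :: "nat \<Rightarrow> point \<Rightarrow> vjet \<Rightarrow> point \<Rightarrow> point"
  where "field_rep k p a = (SOME X. smooth_near p X \<and> jet k X p = a)"

text \<open>The induced bracket from \<open>W\<^sub>p / L\<^sup>k\<^sub>p\<close> to \<open>W\<^sub>p / L\<^sup>k\<^sup>-\<^sup>1\<^sub>p\<close>, for \<open>k \<ge> 1\<close>.\<close>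

definition jet_bracket :: "nat \<Rightarrow> point \<Rightarrow> vjet \<Rightarrow> vjet \<Rightarrow> vjet"
  where "jet_bracket k p a b = jet (k - 1) (lie_bracket (field_rep k p a) (field_rep k p b)) p"

definition horizontal :: "nat \<Rightarrow> point \<Rightarrow> vjet set \<Rightarrow> bool"
  where "horizontal k p H \<longleftrightarrow> H \<subseteq> W k p \<and> subspace H \<and> dim H = 2 \<and> rho ` H = UNIV"


section \<open>Isotropy spaces\<close>

text \<open>For \<open>\<theta>\<close> in the jet bundle of order \<open>k + 1\<close>: the tangent space at \<open>jproj k \<theta>\<close> to the image of
  \<open>q \<mapsto> [S]\<^sup>k\<^sub>q\<close>, that is, the image of the differential of this immersion.\<close>

definition jet_plane :: "nat \<Rightarrow> jet_point \<Rightarrow> jet_point set"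
  where "jet_plane k \<theta> =
    {\<xi>. \<exists>w. velocity (\<lambda>t. sjet k (section_rep (k + 1) \<theta>) (fst \<theta> + t *\<^sub>R w)) \<xi>}"

definition isotropy :: "nat \<Rightarrow> jet_point \<Rightarrow> vjet set"
  where "isotropy k \<theta> = {jet (k + 2) X (fst \<theta>) | X. smooth_near (fst \<theta>) X \<and>
    (\<exists>\<xi>\<in>jet_plane k \<theta>. has_lifted_value k X (jproj k \<theta>) \<xi>)}"


section \<open>The form \<open>\<omega>\<^sup>(\<^sup>2\<^sup>)\<close>\<close>

definition H_const :: "point \<Rightarrow> vjet set"
  where "H_const p = {jet 1 (\<lambda>_. c) p | c. True}"

definition H1 :: "jet_point \<Rightarrow> vjet set"
  where "H1 \<theta>1 = (THE H. horizontal 2 (fst \<theta>1) H \<and> H \<subseteq> isotropy 0 \<theta>1 \<and>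
    trunc 1 ` H = H_const (fst \<theta>1) \<and>
    (\<forall>v w. jet_bracket 2 (fst \<theta>1) (inv_into H rho v) (inv_into H rho w) = 0))"

definition H2 :: "jet_point \<Rightarrow> vjet set"
  where "H2 \<theta>2 = (THE H. horizontal 3 (fst \<theta>2) H \<and> H \<subseteq> isotropy 1 \<theta>2 \<and>
    trunc 2 ` H = H1 (jproj 1 \<theta>2))"

definition omega :: "jet_point \<Rightarrow> point \<Rightarrow> point \<Rightarrow> vjet"
  where "omega \<theta>2 v w =
    jet_bracket 3 (fst \<theta>2) (inv_into (H2 \<theta>2) rho v) (inv_into (H2 \<theta>2) rho w)"

text \<open>The pull-back by \<open>\<pi>\<^sub>2\<close>, whose differential is \<open>fst\<close>.\<close>

definition omega2 :: "jet_point \<Rightarrow> jet_point \<Rightarrow> jet_point \<Rightarrow> vjet"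
  where "omega2 \<theta>2 \<xi> \<eta> = omega \<theta>2 (fst \<xi>) (fst \<eta>)"

definition M :: "jet_point set"
  where "M = {\<theta>2 \<in> jet_bundle 2. \<forall>\<xi>\<in>tangent_space 2. \<forall>\<eta>\<in>tangent_space 2. omega2 \<theta>2 \<xi> \<eta> = 0}"

definition zero_section :: "point \<Rightarrow> total"
  where "zero_section = (\<lambda>x. (x, 0))"

end

theory Submission
  imports Defs
begin

text \<open>Both sides of the theorem turn out to be given by polynomial conditions on the array \<open>c\<close> of partial
  derivatives of a two-jet, and the two conditions express the compatibility of one and the same
  linear system.

  \<^bold>\<open>The set \<open>M\<close>.\<close> Differentiating the transformation law of the coefficients along a flow gives the
  infinitesimal law \<open>inf_law\<close> (\<open>flow_velocity\<close>). For fields whose first derivatives vanish at the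
  point, membership in an isotropy space then says that \<open>thomas\<close>, the map which forms from the second
  derivatives their trace-free part, takes prescribed values on the second derivatives and on their
  derivatives (\<open>isotropy_equations\<close>). The map \<open>thomas\<close> has a two-dimensional kernel, but two
  equations \<open>thomas T\<^sub>3\<^sub>0 T\<^sub>2\<^sub>1 T\<^sub>1\<^sub>2 = K\<close> and \<open>thomas T\<^sub>2\<^sub>1 T\<^sub>1\<^sub>2 T\<^sub>0\<^sub>3 = L\<close> for the components of a symmetric
  tensor have exactly one solution (\<open>thomas_system\<close>). For the plane at the one-jet, vanishing of the
  brackets is such a symmetry; for the plane at the two-jet, the equation and its two derivatives are
  such a pair. So both planes are explicit (\<open>H1_eq\<close>, \<open>H2_eq\<close>), and \<open>\<omega>\<close> measures to what extent the
  third derivatives along the plane fail to be symmetric (\<open>omega_eq_0_iff\<close>). That the explicit planes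
  do consist of isotropic jets requires fields with given jet and known flow: they are obtained by
  conjugating translations with a diffeomorphism (\<open>local_flow_with_jet\<close>).

  \<^bold>\<open>The orbit.\<close> It consists of the two-jets of transforms of the zero section (\<open>orbit_zero_section\<close>).
  These transforms are invariant under linear changes of the target of the inverse transformation \<open>g\<close>,
  so the derivative of \<open>g\<close> at the point may be taken to be the identity. Then the derivatives of \<open>g\<close>
  of order three satisfy a system as in \<open>thomas_system\<close>, and those of order four satisfy two such
  systems that overlap in three of the five unknowns (\<open>transform_equations\<close>). The overlap imposes
  a compatibility condition on \<open>c\<close>, and this condition is \<open>\<omega> = 0\<close> (\<open>fourth_order_compatibility\<close>). Hence
  \<open>\<omega>\<close> vanishes along the orbit, and conversely a jet with \<open>\<omega> = 0\<close> determines a polynomial \<open>g\<close> of degree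
  four which transforms the zero section to a section with that two-jet.\<close>

section \<open>Calculus of smooth maps\<close>

lemma dird_eq:
  assumes "(h has_derivative h') (at x)"
  shows "dird v h x = h' v"
  using frechet_derivative_at[OF assms] by (simp add: dird_def)

lemma dird_cong:
  assumes "open U" "x \<in> U" "\<And>y. y \<in> U \<Longrightarrow> f y = g y"
  shows "dird v f x = dird v g x"
proof -
  have "(f has_derivative f') (at x) \<longleftrightarrow> (g has_derivative f') (at x)" for f'
    using assms has_derivative_transform_within_open[of f f' x UNIV U g]
      has_derivative_transform_within_open[of g f' x UNIV U f] by auto
  then show ?thesis by (simp add: dird_def frechet_derivative_def)
qed

lemma has_dird:
  assumes "h differentiable (at x)"
  shows "(h has_derivative (\<lambda>v. dird v h x)) (at x)"
  using assms by (simp add: dird_def frechet_derivative_works)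

lemma smooth_on_open: "smooth_on U h \<Longrightarrow> open U"
  by (simp add: smooth_on_def)

lemma smooth_on_differentiable:
  assumes "smooth_on U h" "x \<in> U"
  shows "h differentiable (at x)"
  using assms unfolding smooth_on_def by (metis foldr.simps(1) id_apply)

lemma smooth_on_dird:
  assumes "smooth_on U h"
  shows "smooth_on U (dird v h)"
  unfolding smooth_on_def
proof (intro conjI allI ballI)
  fix vs x assume "x \<in> U"
  then have "foldr dird (vs @ [v]) h differentiable (at x)"
    using assms unfolding smooth_on_def by blast
  then show "foldr dird vs (dird v h) differentiable (at x)" by simp
qed (use assms smooth_on_open in auto)

lemma smooth_on_has_derivative:
  assumes "smooth_on U h" "x \<in> U"
  shows "(h has_derivative (\<lambda>v. dird v h x)) (at x)"
  by (rule has_dird[OF smooth_on_differentiable[OF assms]])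

text \<open>Smoothness is the largest property of functions that implies differentiability and is
  inherited by all directional derivatives. So a function is smooth as soon as it belongs to some class
  of differentiable functions that is closed under differentiation; products, reciprocals, composites
  and inverses are handled by exhibiting such a class.\<close>

lemma smooth_on_coinduct:
  assumes "open U" and "P h"
    and diff: "\<And>h x. P h \<Longrightarrow> x \<in> U \<Longrightarrow> h differentiable (at x)"
    and step: "\<And>h v. P h \<Longrightarrow> \<exists>h'. P h' \<and> (\<forall>x\<in>U. dird v h x = h' x)"
  shows "smooth_on U h"
proof -
  have "foldr dird vs h0 differentiable (at x)"
    if "P h" "\<forall>x\<in>U. h0 x = h x" "x \<in> U" for vs h0 h x
    using that
  proof (induction vs arbitrary: h0 h rule: rev_induct)
    case Nil
    then obtain D where "(h has_derivative D) (at x)"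
      using diff differentiable_def by blast
    then have "(h0 has_derivative D) (at x)"
      by (rule has_derivative_transform_within_open[OF _ assms(1)]) (use Nil in auto)
    then show ?case by (auto simp: differentiable_def)
  next
    case (snoc v vs)
    obtain h' where h': "P h'" "\<forall>x\<in>U. dird v h x = h' x" using step snoc.prems by blast
    have "\<forall>x\<in>U. dird v h0 x = h' x"
      using dird_cong[OF assms(1), of _ h0 h v] h' snoc.prems by simp
    then show ?case using snoc.IH[OF h'(1)] snoc.prems by simp
  qed
  then show ?thesis using assms(1,2) unfolding smooth_on_def by blast
qed

lemma smooth_on_cong:
  assumes "smooth_on U f" "\<And>x. x \<in> U \<Longrightarrow> g x = f x"
  shows "smooth_on U g"
proof (rule smooth_on_coinduct[where P = "\<lambda>g. \<exists>f. smooth_on U f \<and> (\<forall>x\<in>U. g x = f x)"])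
  show op: "open U" using assms smooth_on_open by auto
  show "\<exists>f. smooth_on U f \<and> (\<forall>x\<in>U. g x = f x)" using assms by auto
next
  fix h x assume "\<exists>f. smooth_on U f \<and> (\<forall>x\<in>U. h x = f x)" "x \<in> U"
  then obtain f where f: "smooth_on U f" "\<forall>x\<in>U. h x = f x" by auto
  have "(h has_derivative (\<lambda>v. dird v f x)) (at x)"
    by (rule has_derivative_transform_within_open
        [OF smooth_on_has_derivative[OF f(1) \<open>x \<in> U\<close>], of U])
      (use f smooth_on_open \<open>x \<in> U\<close> in auto)
  then show "h differentiable (at x)" by (auto simp: differentiable_def)
next
  fix h v assume "\<exists>f. smooth_on U f \<and> (\<forall>x\<in>U. h x = f x)"
  then obtain f where f: "smooth_on U f" "\<forall>x\<in>U. h x = f x" by auto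
  then have "\<forall>x\<in>U. dird v h x = dird v f x"
    using dird_cong[OF smooth_on_open[OF f(1)], of _ h f v] by simp
  with f show "\<exists>h'. (\<exists>f. smooth_on U f \<and> (\<forall>x\<in>U. h' x = f x)) \<and> (\<forall>x\<in>U. dird v h x = h' x)"
    using smooth_on_dird by metis
qed

lemma smooth_on_subset: "smooth_on U h \<Longrightarrow> open T \<Longrightarrow> T \<subseteq> U \<Longrightarrow> smooth_on T h"
  unfolding smooth_on_def by blast

named_theorems smooth_intros

lemma smooth_on_const [smooth_intros]:
  "open U \<Longrightarrow> smooth_on U (\<lambda>_. c)"
  by (rule smooth_on_coinduct[where P = "\<lambda>h. \<exists>c. h = (\<lambda>_. c)"]) (auto simp: dird_def)

lemma smooth_on_linear:
  assumes "open U" "bounded_linear L"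
  shows "smooth_on U L"
proof (rule smooth_on_coinduct[where P = "\<lambda>h. h = L \<or> (\<exists>c. h = (\<lambda>_. c))"])
  fix h v assume "h = L \<or> (\<exists>c. h = (\<lambda>_. c))"
  then show "\<exists>h'. (h' = L \<or> (\<exists>c. h' = (\<lambda>_. c))) \<and> (\<forall>x\<in>U. dird v h x = h' x)"
    using dird_eq[OF bounded_linear_imp_has_derivative[OF assms(2)]]
    by (intro exI[of _ "\<lambda>x. dird v h 0"]) (auto simp: dird_def)
qed (use assms bounded_linear_imp_differentiable in \<open>auto\<close>)

lemma dird_linear_comp:
  assumes "bounded_linear L" "f differentiable (at x)"
  shows "dird v (\<lambda>x. L (f x)) x = L (dird v f x)"
  by (rule dird_eq[OF bounded_linear.has_derivative[OF assms(1) has_dird[OF assms(2)]]])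

lemma smooth_on_linear_comp:
  assumes "smooth_on U f" "bounded_linear L"
  shows "smooth_on U (\<lambda>x. L (f x))"
proof (rule smooth_on_coinduct[where P = "\<lambda>h. \<exists>f. smooth_on U f \<and> h = (\<lambda>x. L (f x))"])
  fix h x assume "\<exists>f. smooth_on U f \<and> h = (\<lambda>x. L (f x))" "x \<in> U"
  then show "h differentiable (at x)"
    using bounded_linear.has_derivative[OF assms(2) smooth_on_has_derivative] differentiable_def
    by blast
next
  fix h v assume "\<exists>f. smooth_on U f \<and> h = (\<lambda>x. L (f x))"
  then show "\<exists>h'. (\<exists>f. smooth_on U f \<and> h' = (\<lambda>x. L (f x))) \<and> (\<forall>x\<in>U. dird v h x = h' x)"
    using dird_linear_comp[OF assms(2)] smooth_on_differentiable smooth_on_dird by metis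
qed (use assms smooth_on_open in auto)

lemma dird_add:
  assumes "f differentiable (at x)" "g differentiable (at x)"
  shows "dird v (\<lambda>x. f x + g x) x = dird v f x + dird v g x"
  by (rule dird_eq[OF has_derivative_add[OF has_dird[OF assms(1)] has_dird[OF assms(2)]]])

lemma dird_scaleR:
  fixes f :: "'a::euclidean_space \<Rightarrow> real"
  assumes "f differentiable (at x)" "g differentiable (at x)"
  shows "dird v (\<lambda>x. f x *\<^sub>R g x) x = f x *\<^sub>R dird v g x + dird v f x *\<^sub>R g x"
  by (rule dird_eq[OF has_derivative_scaleR[OF has_dird[OF assms(1)] has_dird[OF assms(2)]]])

lemma smooth_on_add [smooth_intros]:
  assumes "smooth_on U f" "smooth_on U g"
  shows "smooth_on U (\<lambda>x. f x + g x)"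
proof (rule smooth_on_coinduct
    [where P = "\<lambda>h. \<exists>f g. smooth_on U f \<and> smooth_on U g \<and> h = (\<lambda>x. f x + g x)"])
  fix h v assume "\<exists>f g. smooth_on U f \<and> smooth_on U g \<and> h = (\<lambda>x. f x + g x)"
  then obtain f g where "smooth_on U f" "smooth_on U g" "h = (\<lambda>x. f x + g x)" by auto
  then show "\<exists>h'. (\<exists>f g. smooth_on U f \<and> smooth_on U g \<and> h' = (\<lambda>x. f x + g x)) \<and>
      (\<forall>x\<in>U. dird v h x = h' x)"
    by (intro exI[of _ "\<lambda>x. dird v f x + dird v g x"] conjI exI[of _ "dird v f"] exI[of _ "dird v g"])
      (auto simp: dird_add smooth_on_differentiable intro: smooth_on_dird)
qed (use assms smooth_on_open smooth_on_differentiable in \<open>auto intro!: differentiable_add\<close>)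

text \<open>By linearity, the class in the coinduction need not contain the derivatives themselves, only
  functions of which they are finite sums.\<close>

lemma smooth_on_coinduct_sums:
  assumes "open U" and "Q h"
    and diff: "\<And>h x. Q h \<Longrightarrow> x \<in> U \<Longrightarrow> h differentiable (at x)"
    and step: "\<And>h v. Q h \<Longrightarrow> \<exists>hs. (\<forall>k\<in>set hs. Q k) \<and> (\<forall>x\<in>U. dird v h x = (\<Sum>k\<leftarrow>hs. k x))"
  shows "smooth_on U h"
proof -
  have main: "(\<lambda>x. \<Sum>k\<leftarrow>hs. k x) differentiable (at x) \<and>
      dird v (\<lambda>x. \<Sum>k\<leftarrow>hs. k x) x = (\<Sum>k\<leftarrow>hs. dird v k x)"
    if "\<forall>k\<in>set hs. Q k" "x \<in> U" for hs v x
    using that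
  proof (induction hs)
    case Nil
    then show ?case by (simp add: dird_def)
  next
    case (Cons k hs)
    then show ?case using diff[of k x] by (simp add: dird_add)
  qed
  show ?thesis
  proof (rule smooth_on_coinduct[where P = "\<lambda>h. \<exists>hs. (\<forall>k\<in>set hs. Q k) \<and> h = (\<lambda>x. \<Sum>k\<leftarrow>hs. k x)"])
    show "\<exists>hs. (\<forall>k\<in>set hs. Q k) \<and> h = (\<lambda>x. \<Sum>k\<leftarrow>hs. k x)"
      by (rule exI[of _ "[h]"]) (use assms in auto)
  next
    fix h v assume "\<exists>hs. (\<forall>k\<in>set hs. Q k) \<and> h = (\<lambda>x. \<Sum>k\<leftarrow>hs. k x)"
    then obtain hs where hs: "\<forall>k\<in>set hs. Q k" "h = (\<lambda>x. \<Sum>k\<leftarrow>hs. k x)" by blast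
    have "\<exists>ks. (\<forall>k\<in>set ks. Q k) \<and> (\<forall>x\<in>U. (\<Sum>k\<leftarrow>hs. dird v k x) = (\<Sum>k\<leftarrow>ks. k x))"
      using hs(1)
    proof (induction hs)
      case Nil
      show ?case by (rule exI[of _ "[]"]) simp
    next
      case (Cons k hs)
      obtain ks where ks: "\<forall>k\<in>set ks. Q k" "\<forall>x\<in>U. (\<Sum>k\<leftarrow>hs. dird v k x) = (\<Sum>k\<leftarrow>ks. k x)"
        using Cons by auto
      obtain js where js: "\<forall>k\<in>set js. Q k" "\<forall>x\<in>U. dird v k x = (\<Sum>k\<leftarrow>js. k x)"
        using step[of k v] Cons.prems by auto
      show ?case by (rule exI[of _ "js @ ks"]) (use ks js in auto)
    qed
    then show "\<exists>h'. (\<exists>hs. (\<forall>k\<in>set hs. Q k) \<and> h' = (\<lambda>x. \<Sum>k\<leftarrow>hs. k x)) \<and> (\<forall>x\<in>U. dird v h x = h' x)"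
      using main[OF hs(1)] hs(2) by metis
  qed (use assms(1) main in blast)+
qed

lemma smooth_on_scaleR [smooth_intros]:
  fixes f :: "'a::euclidean_space \<Rightarrow> real" and g :: "'a \<Rightarrow> 'b::real_normed_vector"
  assumes "smooth_on U f" "smooth_on U g"
  shows "smooth_on U (\<lambda>x. f x *\<^sub>R g x)"
proof (rule smooth_on_coinduct_sums
    [where Q = "\<lambda>h. \<exists>f g. smooth_on U f \<and> smooth_on U g \<and> h = (\<lambda>x. f x *\<^sub>R g x)"])
  fix h :: "'a \<Rightarrow> 'b" and v
  assume "\<exists>f g. smooth_on U f \<and> smooth_on U g \<and> h = (\<lambda>x. f x *\<^sub>R g x)"
  then obtain f g where fg: "smooth_on U f" "smooth_on U g" "h = (\<lambda>x. f x *\<^sub>R g x)" by blast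
  then show "\<exists>hs. (\<forall>k\<in>set hs. \<exists>f g. smooth_on U f \<and> smooth_on U g \<and> k = (\<lambda>x. f x *\<^sub>R g x)) \<and>
      (\<forall>x\<in>U. dird v h x = (\<Sum>k\<leftarrow>hs. k x))"
    using smooth_on_dird[OF fg(1), of v] smooth_on_dird[OF fg(2), of v]
    by (intro exI[of _ "[\<lambda>x. f x *\<^sub>R dird v g x, \<lambda>x. dird v f x *\<^sub>R g x]"])
      (auto simp: dird_scaleR smooth_on_differentiable)
next
  fix h :: "'a \<Rightarrow> 'b" and x
  assume "\<exists>f g. smooth_on U f \<and> smooth_on U g \<and> h = (\<lambda>x. f x *\<^sub>R g x)" "x \<in> U"
  then show "h differentiable (at x)"
    using differentiable_scaleR[OF smooth_on_differentiable smooth_on_differentiable] by blast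
next
  show "\<exists>f' g'. smooth_on U f' \<and> smooth_on U g' \<and> (\<lambda>x. f x *\<^sub>R g x) = (\<lambda>x. f' x *\<^sub>R g' x)"
    by (rule exI[of _ f], rule exI[of _ g]) (use assms in simp)
qed (use assms smooth_on_open in auto)

lemma smooth_on_mult [smooth_intros]:
  fixes f g :: "'a::euclidean_space \<Rightarrow> real"
  assumes "smooth_on U f" "smooth_on U g"
  shows "smooth_on U (\<lambda>x. f x * g x)"
  using smooth_on_scaleR[OF assms] by simp

lemma smooth_on_minus [smooth_intros]:
  "smooth_on U f \<Longrightarrow> smooth_on U (\<lambda>x. - f x)"
  by (rule smooth_on_linear_comp) (simp_all add: bounded_linear_minus bounded_linear_ident)

lemma smooth_on_diff [smooth_intros]:
  assumes "smooth_on U f" "smooth_on U g"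
  shows "smooth_on U (\<lambda>x. f x - g x)"
  using smooth_on_add[OF assms(1) smooth_on_minus[OF assms(2)]] by simp

lemma smooth_on_power [smooth_intros]:
  fixes f :: "'a::euclidean_space \<Rightarrow> real"
  assumes "smooth_on U f"
  shows "smooth_on U (\<lambda>x. f x ^ n)"
  by (induction n) (auto intro!: smooth_intros assms smooth_on_open[OF assms])

lemma smooth_on_sum [smooth_intros]:
  assumes "open U" "\<And>i. i \<in> I \<Longrightarrow> smooth_on U (f i)"
  shows "smooth_on U (\<lambda>x. \<Sum>i\<in>I. f i x)"
  using assms by (induction I rule: infinite_finite_induct) (auto intro!: smooth_on_const smooth_on_add)

lemma dird_inverse:
  fixes f :: "'a::euclidean_space \<Rightarrow> real"
  assumes "f differentiable (at x)" "f x \<noteq> 0"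
  shows "dird v (\<lambda>x. inverse (f x)) x = - (dird v f x * (inverse (f x))\<^sup>2)"
  using dird_eq[OF Deriv.has_derivative_inverse[OF assms(2) has_dird[OF assms(1)]], of v]
  by (simp add: power2_eq_square)

lemma smooth_on_inverse [smooth_intros]:
  fixes f :: "'a::euclidean_space \<Rightarrow> real"
  assumes "smooth_on U f" "\<And>x. x \<in> U \<Longrightarrow> f x \<noteq> 0"
  shows "smooth_on U (\<lambda>x. inverse (f x))"
proof -
  let ?Q = "\<lambda>h. \<exists>g n. smooth_on U g \<and> h = (\<lambda>x. g x * inverse (f x) ^ n)"
  note d = smooth_on_differentiable
  have di: "(\<lambda>x. inverse (f x)) differentiable (at x)" if "x \<in> U" for x
    using differentiable_inverse d[OF assms(1) that] assms(2)[OF that] by auto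
  show ?thesis
  proof (rule smooth_on_coinduct_sums[where Q = ?Q])
    show "?Q (\<lambda>x. inverse (f x))"
      by (rule exI[of _ "\<lambda>_. 1"], rule exI[of _ 1])
        (simp add: smooth_on_const smooth_on_open[OF assms(1)])
  next
    fix h x assume "?Q h" "x \<in> U"
    then show "h differentiable (at x)"
      using differentiable_mult[OF d differentiable_power[OF di]] by blast
  next
    fix h v assume "?Q h"
    then obtain g n where g: "smooth_on U g" "h = (\<lambda>x. g x * inverse (f x) ^ n)" by blast
    define g' where "g' = (\<lambda>x. - (of_nat n * g x * dird v f x))"
    have deriv: "dird v h x = dird v g x * inverse (f x) ^ n + g' x * inverse (f x) ^ Suc n"
      if x: "x \<in> U" for x
    proof -
      have "(h has_derivative (\<lambda>v. g x * (of_nat n * dird v (\<lambda>x. inverse (f x)) x * inverse (f x) ^ (n - 1)) +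
          dird v g x * inverse (f x) ^ n)) (at x)"
        unfolding g(2)
        by (rule has_derivative_mult[OF has_dird[OF d[OF g(1) x]]
              has_derivative_power[OF has_dird[OF di[OF x]]]])
      then show ?thesis
        using dird_inverse[OF d[OF assms(1) x] assms(2)[OF x], of v]
        by (cases n) (auto simp: dird_eq g'_def power2_eq_square algebra_simps)
    qed
    have "smooth_on U g'" unfolding g'_def
      by (intro smooth_on_minus smooth_on_mult smooth_on_const smooth_on_dird assms g(1) smooth_on_open[OF g(1)])
    then have "?Q (\<lambda>x. g' x * inverse (f x) ^ Suc n)" by blast
    moreover have "?Q (\<lambda>x. dird v g x * inverse (f x) ^ n)" using smooth_on_dird[OF g(1)] by blast
    ultimately show "\<exists>hs. (\<forall>k\<in>set hs. ?Q k) \<and> (\<forall>x\<in>U. dird v h x = (\<Sum>k\<leftarrow>hs. k x))"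
      using deriv
      by (intro exI[of _ "[\<lambda>x. dird v g x * inverse (f x) ^ n, \<lambda>x. g' x * inverse (f x) ^ Suc n]"])
        (simp del: power_Suc)
  qed (use assms smooth_on_open in auto)
qed

lemma dird_basis_sum:
  assumes "k differentiable (at x)"
  shows "dird v k x = (\<Sum>b\<in>Basis. (v \<bullet> b) *\<^sub>R dird b k x)"
proof -
  have "linear (frechet_derivative k (at x))" by (rule linear_frechet_derivative[OF assms])
  then have "frechet_derivative k (at x) (\<Sum>b\<in>Basis. (v \<bullet> b) *\<^sub>R b) =
      (\<Sum>b\<in>Basis. (v \<bullet> b) *\<^sub>R frechet_derivative k (at x) b)"
    by (simp add: linear_sum linear_scale)
  then show ?thesis by (simp add: dird_def euclidean_representation)
qed

lemma dird_comp:
  assumes "g differentiable (at x)" "k differentiable (at (g x))"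
  shows "dird v (\<lambda>x. k (g x)) x = dird (dird v g x) k (g x)"
  by (rule dird_eq[OF has_derivative_compose[OF has_dird[OF assms(1)] has_dird[OF assms(2)]]])

text \<open>By the chain rule, the derivatives of functions of the form \<open>f \<cdot> (k \<circ> g)\<close> are sums of functions of
  the same form.\<close>

lemma smooth_on_compose:
  fixes g :: "'a::euclidean_space \<Rightarrow> 'c::euclidean_space" and k :: "'c \<Rightarrow> 'b::real_normed_vector"
  assumes "smooth_on U g" "smooth_on V k" "\<And>x. x \<in> U \<Longrightarrow> g x \<in> V"
  shows "smooth_on U (\<lambda>x. k (g x))"
proof -
  let ?Q = "\<lambda>h. \<exists>f k. smooth_on U f \<and> smooth_on V k \<and> h = (\<lambda>x. f x *\<^sub>R k (g x))"
  note d = smooth_on_differentiable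
  have kd: "(\<lambda>x. k (g x)) differentiable (at x)" if "x \<in> U" "smooth_on V k" for x and k :: "'c \<Rightarrow> 'b"
    using differentiable_chain_at[OF d[OF assms(1) that(1)] d[OF that(2) assms(3)[OF that(1)]]]
    by (simp add: o_def)
  show ?thesis
  proof (rule smooth_on_coinduct_sums[where Q = ?Q])
    show "?Q (\<lambda>x. k (g x))"
      by (rule exI[of _ "\<lambda>_. 1"], rule exI[of _ k])
        (simp add: smooth_on_const smooth_on_open[OF assms(1)] assms)
  next
    fix h :: "'a \<Rightarrow> 'b" and x assume "?Q h" "x \<in> U"
    then show "h differentiable (at x)"
      using differentiable_scaleR[OF d kd] by blast
  next
    fix h :: "'a \<Rightarrow> 'b" and v assume "?Q h"
    then obtain f k where fk: "smooth_on U f" "smooth_on V k" "h = (\<lambda>x. f x *\<^sub>R k (g x))" by blast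
    obtain bs where bs: "set bs = (Basis::'c set)" "distinct bs"
      using finite_distinct_list[OF finite_Basis] by auto
    define ks where "ks = map (\<lambda>b x. (f x * (dird v g x \<bullet> b)) *\<^sub>R dird b k (g x)) bs"
    have ks: "(\<Sum>k\<leftarrow>ks. k x) = (\<Sum>b\<in>Basis. (f x * (dird v g x \<bullet> b)) *\<^sub>R dird b k (g x))" for x
      unfolding bs(1)[symmetric] sum.distinct_set_conv_list[OF bs(2)] ks_def by (simp add: o_def)
    have "dird v h x = dird v f x *\<^sub>R k (g x) + (\<Sum>k\<leftarrow>ks. k x)" if x: "x \<in> U" for x
    proof -
      have "dird v (\<lambda>x. k (g x)) x = (\<Sum>b\<in>Basis. (dird v g x \<bullet> b) *\<^sub>R dird b k (g x))"
        by (rule trans[OF dird_comp[OF d[OF assms(1) x] d[OF fk(2) assms(3)[OF x]]]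
              dird_basis_sum[OF d[OF fk(2) assms(3)[OF x]]]])
      then show ?thesis
        unfolding fk(3) dird_scaleR[OF d[OF fk(1) x] kd[OF x fk(2)]]
        by (simp add: scaleR_sum_right ks)
    qed
    moreover have "?Q j" if j: "j \<in> set ks" for j
    proof -
      obtain b where "j = (\<lambda>x. (f x * (dird v g x \<bullet> b)) *\<^sub>R dird b k (g x))"
        using j by (auto simp: ks_def)
      moreover have "smooth_on U (\<lambda>x. f x * (dird v g x \<bullet> b))"
        by (intro smooth_on_mult fk smooth_on_linear_comp[OF smooth_on_dird[OF assms(1)]
              bounded_linear_inner_left])
      ultimately show ?thesis using smooth_on_dird[OF fk(2)] by metis
    qed
    moreover have "?Q (\<lambda>x. dird v f x *\<^sub>R k (g x))" using smooth_on_dird[OF fk(1)] fk(2) by blast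
    ultimately show "\<exists>hs. (\<forall>k\<in>set hs. ?Q k) \<and> (\<forall>x\<in>U. dird v h x = (\<Sum>k\<leftarrow>hs. k x))"
      by (intro exI[of _ "(\<lambda>x. dird v f x *\<^sub>R k (g x)) # ks"]) simp
  qed (use assms smooth_on_open in auto)
qed

lemma smooth_on_ident [smooth_intros]: "open U \<Longrightarrow> smooth_on U (\<lambda>x. x)"
  by (rule smooth_on_linear) (simp_all add: bounded_linear_ident)

lemma smooth_on_vec_nth [smooth_intros]:
  fixes f :: "'a::euclidean_space \<Rightarrow> ('b::euclidean_space)^'n"
  shows "smooth_on U f \<Longrightarrow> smooth_on U (\<lambda>x. f x $ i)"
  by (erule smooth_on_linear_comp) (rule bounded_linear_vec_nth)

lemma dird_vec_nth:
  fixes f :: "'a::euclidean_space \<Rightarrow> ('b::euclidean_space)^'n"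
  shows "f differentiable (at x) \<Longrightarrow> dird v (\<lambda>x. f x $ i) x = dird v f x $ i"
  by (rule dird_linear_comp) (rule bounded_linear_vec_nth)

lemma smooth_on_vec:
  fixes f :: "'a::euclidean_space \<Rightarrow> real^'n"
  assumes "\<And>i. smooth_on U (\<lambda>x. f x $ i)"
  shows "smooth_on U f"
proof -
  have "smooth_on U (\<lambda>x. \<Sum>i\<in>UNIV. f x $ i *\<^sub>R axis i 1)"
    by (intro smooth_on_sum smooth_on_scaleR smooth_on_const assms smooth_on_open[OF assms])
  moreover have f: "f = (\<lambda>x. \<Sum>i\<in>UNIV. f x $ i *\<^sub>R axis i 1)"
    by (simp add: basis_expansion[symmetric] fun_eq_iff scalar_mult_eq_scaleR[symmetric])
  ultimately show ?thesis by (subst f)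
qed

lemma smooth_on_fst [smooth_intros]:
  fixes f :: "'a::euclidean_space \<Rightarrow> ('b::real_normed_vector) \<times> ('c::real_normed_vector)"
  shows "smooth_on U f \<Longrightarrow> smooth_on U (\<lambda>x. fst (f x))"
  by (erule smooth_on_linear_comp) (rule bounded_linear_fst)

lemma smooth_on_snd [smooth_intros]:
  fixes f :: "'a::euclidean_space \<Rightarrow> ('b::real_normed_vector) \<times> ('c::real_normed_vector)"
  shows "smooth_on U f \<Longrightarrow> smooth_on U (\<lambda>x. snd (f x))"
  by (erule smooth_on_linear_comp) (rule bounded_linear_snd)

lemma smooth_on_Pair [smooth_intros]:
  fixes f :: "'a::euclidean_space \<Rightarrow> 'b::real_normed_vector" and g :: "'a \<Rightarrow> 'c::real_normed_vector"
  assumes "smooth_on U f" "smooth_on U g"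
  shows "smooth_on U (\<lambda>x. (f x, g x))"
proof -
  have "bounded_linear (\<lambda>x::'b. (x, 0::'c))" "bounded_linear (\<lambda>x::'c. (0::'b, x))"
    by (intro bounded_linear_Pair bounded_linear_ident bounded_linear_zero)+
  from smooth_on_add[OF smooth_on_linear_comp[OF assms(1) this(1)]
      smooth_on_linear_comp[OF assms(2) this(2)]]
  show ?thesis by simp
qed

lemma has_vector_derivative_dird:
  fixes h :: "'a::euclidean_space \<Rightarrow> 'b::real_normed_vector"
  assumes "smooth_on N h" "c + t *\<^sub>R v \<in> N"
  shows "((\<lambda>s. h (c + s *\<^sub>R v)) has_vector_derivative dird v h (c + t *\<^sub>R v)) (at t)"
proof -
  have "((\<lambda>s. c + s *\<^sub>R v) has_derivative (\<lambda>s. s *\<^sub>R v)) (at t)"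
    by (auto intro!: derivative_eq_intros)
  from has_derivative_compose[OF this smooth_on_has_derivative[OF assms]]
  have "((\<lambda>s. h (c + s *\<^sub>R v)) has_derivative (\<lambda>s. dird (s *\<^sub>R v) h (c + t *\<^sub>R v))) (at t)" .
  moreover have "(\<lambda>s. dird (s *\<^sub>R v) h (c + t *\<^sub>R v)) = (\<lambda>s. s *\<^sub>R dird v h (c + t *\<^sub>R v))"
  proof
    show "dird (s *\<^sub>R v) h (c + t *\<^sub>R v) = s *\<^sub>R dird v h (c + t *\<^sub>R v)" for s
      using linear_scale[OF linear_frechet_derivative[OF smooth_on_differentiable[OF assms]], of s v]
      by (simp add: dird_def)
  qed
  ultimately show ?thesis by (simp only: has_vector_derivative_def)
qed

lemma smooth_on_has_field_derivative_line:
  fixes h :: "'a::euclidean_space \<Rightarrow> real"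
  assumes "smooth_on U h" "c + a *\<^sub>R v \<in> U"
  shows "((\<lambda>t. h (c + t *\<^sub>R v)) has_real_derivative dird v h (c + a *\<^sub>R v)) (at a)"
  using has_vector_derivative_dird[OF assms] by (simp add: has_real_derivative_iff_has_vector_derivative)

text \<open>Two applications of the mean value theorem to the second difference over a parallelogram.\<close>

lemma second_difference_mean_value:
  fixes h :: "'a::euclidean_space \<Rightarrow> real"
  assumes h: "smooth_on U h" and s: "0 < s"
    and U: "\<And>a b. 0 \<le> a \<Longrightarrow> a \<le> s \<Longrightarrow> 0 \<le> b \<Longrightarrow> b \<le> s \<Longrightarrow> x + a *\<^sub>R v + b *\<^sub>R w \<in> U"
  obtains a b where "0 < a" "a < s" "0 < b" "b < s"
    "h (x + s *\<^sub>R v + s *\<^sub>R w) - h (x + s *\<^sub>R v) - h (x + s *\<^sub>R w) + h x =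
      s * s * dird w (dird v h) (x + a *\<^sub>R v + b *\<^sub>R w)"
proof -
  have "((\<lambda>a. h (x + a *\<^sub>R v + s *\<^sub>R w) - h (x + a *\<^sub>R v)) has_real_derivative
      dird v h (x + a *\<^sub>R v + s *\<^sub>R w) - dird v h (x + a *\<^sub>R v)) (at a)" if "0 \<le> a" "a \<le> s" for a
    using smooth_on_has_field_derivative_line[OF h, of "x + s *\<^sub>R w" a v]
      smooth_on_has_field_derivative_line[OF h, of x a v] U[of a s] U[of a 0] that s
    by (intro derivative_intros) (auto simp: algebra_simps)
  from MVT2[OF s this] obtain a where a: "0 < a" "a < s"
    "h (x + s *\<^sub>R v + s *\<^sub>R w) - h (x + s *\<^sub>R v) - (h (x + s *\<^sub>R w) - h x) =
      s * (dird v h (x + a *\<^sub>R v + s *\<^sub>R w) - dird v h (x + a *\<^sub>R v))"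
    by auto
  have "((\<lambda>b. dird v h (x + a *\<^sub>R v + b *\<^sub>R w)) has_real_derivative
      dird w (dird v h) (x + a *\<^sub>R v + b *\<^sub>R w)) (at b)" if "0 \<le> b" "b \<le> s" for b
    using smooth_on_has_field_derivative_line[OF smooth_on_dird[OF h], of "x + a *\<^sub>R v" b w]
      U[of a b] that a by auto
  from MVT2[OF s this] obtain b where "0 < b" "b < s"
    "dird v h (x + a *\<^sub>R v + s *\<^sub>R w) - dird v h (x + a *\<^sub>R v) =
      s * dird w (dird v h) (x + a *\<^sub>R v + b *\<^sub>R w)"
    by auto
  with a show thesis by (intro that[of a b]) (auto simp: algebra_simps)
qed

text \<open>Both mixed derivatives are limits of the same second difference quotient.\<close>

lemma dird_commute_real:
  fixes h :: "'a::euclidean_space \<Rightarrow> real"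
  assumes h: "smooth_on U h" and x: "x \<in> U"
  shows "dird v (dird w h) x = dird w (dird v h) x"
proof (rule ccontr)
  define A where "A = dird w (dird v h)"
  define B where "B = dird v (dird w h)"
  assume "dird v (dird w h) x \<noteq> dird w (dird v h) x"
  then have e: "\<bar>A x - B x\<bar> / 2 > 0" by (simp add: A_def B_def)
  have "isCont A x" "isCont B x"
    unfolding A_def B_def
    using smooth_on_differentiable[OF smooth_on_dird[OF smooth_on_dird[OF h]] x]
    by (simp_all add: differentiable_imp_continuous_within)
  then obtain d1 d2 where d1: "d1 > 0" "\<And>y. dist y x < d1 \<Longrightarrow> \<bar>A y - A x\<bar> < \<bar>A x - B x\<bar> / 2"
    and d2: "d2 > 0" "\<And>y. dist y x < d2 \<Longrightarrow> \<bar>B y - B x\<bar> < \<bar>A x - B x\<bar> / 2"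
    using e unfolding continuous_at_eps_delta dist_real_def by metis
  obtain d3 where d3: "d3 > 0" "\<And>y. dist y x < d3 \<Longrightarrow> y \<in> U"
    using smooth_on_open[OF h] x unfolding open_dist by auto
  define d where "d = min d1 (min d2 d3)"
  define s where "s = d / (2 * (norm v + norm w + 1))"
  have d: "d > 0" using d1 d2 d3 by (simp add: d_def)
  then have s: "s > 0" by (auto simp: s_def intro!: divide_pos_pos add_nonneg_pos)
  have near: "dist (x + a *\<^sub>R v + b *\<^sub>R w) x < d" "dist (x + b *\<^sub>R w + a *\<^sub>R v) x < d"
    if "0 \<le> a" "a \<le> s" "0 \<le> b" "b \<le> s" for a b
  proof -
    have pos: "norm v + norm w < 2 * (norm v + norm w + 1)"
      using add_nonneg_nonneg[OF norm_ge_zero[of v] norm_ge_zero[of w]] by (simp only: distrib_left)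
    have "norm (a *\<^sub>R v + b *\<^sub>R w) \<le> norm (a *\<^sub>R v) + norm (b *\<^sub>R w)" by (rule norm_triangle_ineq)
    also have "\<dots> \<le> s * norm v + s * norm w"
      using that by (intro add_mono) (auto intro!: mult_right_mono)
    also have "\<dots> < s * (2 * (norm v + norm w + 1))"
      using mult_strict_left_mono[OF pos s] by (simp only: distrib_left)
    also have "\<dots> = d" unfolding s_def using norm_ge_zero[of v] norm_ge_zero[of w] by (simp add: add_nonneg_eq_0_iff)
    finally show "dist (x + a *\<^sub>R v + b *\<^sub>R w) x < d" "dist (x + b *\<^sub>R w + a *\<^sub>R v) x < d"
      by (simp_all add: dist_norm add.commute add.left_commute)
  qed
  obtain a b where ab: "0 < a" "a < s" "0 < b" "b < s"
    "h (x + s *\<^sub>R v + s *\<^sub>R w) - h (x + s *\<^sub>R v) - h (x + s *\<^sub>R w) + h x =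
      s * s * A (x + a *\<^sub>R v + b *\<^sub>R w)"
    unfolding A_def
    by (rule second_difference_mean_value[OF h s, of x v w]) (use near d3 d_def in auto)
  obtain a' b' where ab': "0 < a'" "a' < s" "0 < b'" "b' < s"
    "h (x + s *\<^sub>R w + s *\<^sub>R v) - h (x + s *\<^sub>R w) - h (x + s *\<^sub>R v) + h x =
      s * s * B (x + a' *\<^sub>R w + b' *\<^sub>R v)"
    unfolding B_def
    by (rule second_difference_mean_value[OF h s, of x w v]) (use near d3 d_def in auto)
  have "s * s * A (x + a *\<^sub>R v + b *\<^sub>R w) = s * s * B (x + a' *\<^sub>R w + b' *\<^sub>R v)"
    using ab(5) ab'(5) unfolding add.assoc[of x] add.commute[of "s *\<^sub>R w" "s *\<^sub>R v"] by linarith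
  then have "A (x + a *\<^sub>R v + b *\<^sub>R w) = B (x + a' *\<^sub>R w + b' *\<^sub>R v)" using s by simp
  moreover have "\<bar>A (x + a *\<^sub>R v + b *\<^sub>R w) - A x\<bar> < \<bar>A x - B x\<bar> / 2"
    by (rule d1(2)) (use near[of a b] ab d_def in auto)
  moreover have "\<bar>B (x + a' *\<^sub>R w + b' *\<^sub>R v) - B x\<bar> < \<bar>A x - B x\<bar> / 2"
    by (rule d2(2)) (use near(2)[of b' a'] ab' d_def in auto)
  ultimately show False by argo
qed

lemma dird_commute:
  fixes h :: "'a::euclidean_space \<Rightarrow> 'b::euclidean_space"
  assumes h: "smooth_on U h" and x: "x \<in> U"
  shows "dird v (dird w h) x = dird w (dird v h) x"
proof (rule euclidean_eqI)
  fix b :: 'b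
  have c: "dird v (\<lambda>y. k y \<bullet> b) y = dird v k y \<bullet> b" if "smooth_on U k" "y \<in> U" for k :: "'a \<Rightarrow> 'b" and y v
    by (rule dird_linear_comp[OF bounded_linear_inner_left smooth_on_differentiable[OF that]])
  have c2: "dird v (dird w (\<lambda>y. h y \<bullet> b)) x = dird v (dird w h) x \<bullet> b" for v w
    by (rule trans[OF dird_cong[OF smooth_on_open[OF h] x c[OF h]] c[OF smooth_on_dird[OF h] x]])
  show "dird v (dird w h) x \<bullet> b = dird w (dird v h) x \<bullet> b"
    using dird_commute_real[OF smooth_on_linear_comp[OF h bounded_linear_inner_left[of b]] x, of v w]
    by (simp add: c2)
qed

section \<open>Plane diffeomorphisms\<close>

lemma dird_axis:
  fixes k :: "point \<Rightarrow> 'b::real_normed_vector"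
  assumes "k differentiable (at x)"
  shows "dird v k x = v $ 1 *\<^sub>R partial 1 k x + v $ 2 *\<^sub>R partial 2 k x"
proof -
  have "v = v $ 1 *\<^sub>R axis 1 1 + v $ 2 *\<^sub>R axis 2 1"
    by (auto simp: vec_eq_iff forall_2 axis_def)
  then have "frechet_derivative k (at x) v =
      frechet_derivative k (at x) (v $ 1 *\<^sub>R axis 1 1 + v $ 2 *\<^sub>R axis 2 1)" by simp
  also have "\<dots> = v $ 1 *\<^sub>R partial 1 k x + v $ 2 *\<^sub>R partial 2 k x"
    using linear_frechet_derivative[OF assms] by (simp add: dird_def linear_add linear_scale)
  finally show ?thesis by (simp add: dird_def)
qed

lemma dird_chain:
  fixes g :: "'a::euclidean_space \<Rightarrow> point" and k :: "point \<Rightarrow> 'b::real_normed_vector"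
  assumes "g differentiable (at x)" "k differentiable (at (g x))"
  shows "dird v (\<lambda>x. k (g x)) x =
    dird v (\<lambda>x. g x $ 1) x *\<^sub>R partial 1 k (g x) + dird v (\<lambda>x. g x $ 2) x *\<^sub>R partial 2 k (g x)"
  using dird_comp[OF assms, of v] dird_axis[OF assms(2), of "dird v g x"] dird_vec_nth[OF assms(1), of v]
  by simp

text \<open>The Jacobian determinant and, for nonzero determinant, the inverse of the Jacobian matrix by
  Cramer's rule.\<close>

definition jac :: "(point \<Rightarrow> point) \<Rightarrow> point \<Rightarrow> real"
  where "jac f x = partial 1 (\<lambda>x. f x $ 1) x * partial 2 (\<lambda>x. f x $ 2) x
    - partial 2 (\<lambda>x. f x $ 1) x * partial 1 (\<lambda>x. f x $ 2) x"

definition inverse_diff :: "(point \<Rightarrow> point) \<Rightarrow> point \<Rightarrow> point \<Rightarrow> point"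
  where "inverse_diff f x w = vector
    [(partial 2 (\<lambda>x. f x $ 2) x * w $ 1 - partial 2 (\<lambda>x. f x $ 1) x * w $ 2) * inverse (jac f x),
     (partial 1 (\<lambda>x. f x $ 1) x * w $ 2 - partial 1 (\<lambda>x. f x $ 2) x * w $ 1) * inverse (jac f x)]"

lemma dird_point:
  fixes f :: "point \<Rightarrow> point"
  assumes "f differentiable (at x)"
  shows "dird v f x $ i = v $ 1 * partial 1 (\<lambda>x. f x $ i) x + v $ 2 * partial 2 (\<lambda>x. f x $ i) x"
  using dird_axis[OF assms, of v] dird_vec_nth[OF assms, of _ i] by simp

lemma inverse_diff_right:
  assumes "f differentiable (at x)" "jac f x \<noteq> 0"
  shows "dird (inverse_diff f x w) f x = w"
proof -
  have "jac f x * inverse (jac f x) = 1" using assms by simp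
  then show ?thesis
    unfolding vec_eq_iff forall_2 dird_point[OF assms(1)]
    by (simp add: inverse_diff_def) (simp add: jac_def; algebra)
qed

lemma linear_inverse_diff: "linear (inverse_diff f x)"
  by (rule linearI) (auto simp: inverse_diff_def vec_eq_iff forall_2 algebra_simps)

lemma inverse_diff_left:
  assumes "f differentiable (at x)" "jac f x \<noteq> 0"
  shows "inverse_diff f x \<circ> (\<lambda>v. dird v f x) = id"
proof (rule linear_inverse_left[THEN iffD1])
  show "linear (\<lambda>v. dird v f x)" using linear_frechet_derivative[OF assms(1)] by (simp add: dird_def)
  show "linear (inverse_diff f x)" by (rule linear_inverse_diff)
  show "(\<lambda>v. dird v f x) \<circ> inverse_diff f x = id"
    using inverse_diff_right[OF assms] by (simp add: fun_eq_iff)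
qed

lemma inverse_has_derivative:
  assumes f: "smooth_on U f" "inj_on f U" and j: "jac f x \<noteq> 0" and x: "x \<in> U"
  shows "(inv_into U f has_derivative inverse_diff f x) (at (f x))"
proof (rule has_derivative_inverse_strong[OF smooth_on_open[OF f(1)] x])
  show "continuous_on U f"
    using smooth_on_differentiable[OF f(1)]
    by (simp add: continuous_on_eq_continuous_at smooth_on_open[OF f(1)] differentiable_imp_continuous_within)
  show "(f has_derivative (\<lambda>v. dird v f x)) (at x)" by (rule smooth_on_has_derivative[OF f(1) x])
  show "(\<lambda>v. dird v f x) \<circ> inverse_diff f x = id"
    using inverse_diff_right[OF smooth_on_differentiable[OF f(1) x] j] by (simp add: fun_eq_iff)
qed (use f in auto)

lemma smooth_on_open_image:
  fixes f :: "point \<Rightarrow> point"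
  assumes "smooth_on U f" "inj_on f U"
  shows "open (f ` U)"
proof (rule invariance_of_domain)
  show "continuous_on U f"
    using smooth_on_differentiable[OF assms(1)]
    by (simp add: continuous_on_eq_continuous_at smooth_on_open[OF assms(1)] differentiable_imp_continuous_within)
qed (use assms smooth_on_open in auto)

lemma smooth_on_jac: "smooth_on U f \<Longrightarrow> smooth_on U (jac f)"
  unfolding jac_def by (intro smooth_intros smooth_on_dird)

text \<open>Derivatives of functions of the form \<open>k \<circ> f\<^sup>-\<^sup>1\<close> are of the same form, since the derivative of the
  inverse at \<open>z\<close> is the inverse matrix at \<open>f\<^sup>-\<^sup>1(z)\<close>.\<close>

lemma point_transformationI:
  assumes f: "smooth_on U f" "inj_on f U" and j: "\<And>x. x \<in> U \<Longrightarrow> jac f x \<noteq> 0"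
  shows "point_transformation U f"
proof -
  let ?g = "inv_into U f"
  have d: "(?g has_derivative inverse_diff f (?g z)) (at z)" if "z \<in> f ` U" for z
    using inverse_has_derivative[OF f j] that f(2) by auto
  have smooth_comp: "smooth_on (f ` U) h"
    if "\<exists>k. smooth_on U k \<and> (\<forall>z\<in>f ` U. h z = k (?g z))" for h :: "point \<Rightarrow> real"
  proof (rule smooth_on_coinduct[where P = "\<lambda>h. \<exists>k. smooth_on U k \<and> (\<forall>z\<in>f ` U. h z = k (?g z))"])
    show op: "open (f ` U)" by (rule smooth_on_open_image[OF f])
    fix h :: "point \<Rightarrow> real"
    assume "\<exists>k. smooth_on U k \<and> (\<forall>z\<in>f ` U. h z = k (?g z))"
    then obtain k where k: "smooth_on U k" "\<And>z. z \<in> f ` U \<Longrightarrow> h z = k (?g z)" by blast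
    have hd: "(h has_derivative (\<lambda>v. dird (inverse_diff f (?g z) v) k (?g z))) (at z)" if z: "z \<in> f ` U" for z
    proof (rule has_derivative_transform_within_open[OF _ op z])
      show "((\<lambda>z. k (?g z)) has_derivative (\<lambda>v. dird (inverse_diff f (?g z) v) k (?g z))) (at z)"
        by (rule has_derivative_compose[OF d[OF z] smooth_on_has_derivative[OF k(1)]])
          (rule inv_into_into[OF z])
    qed (use k in auto)
    show "h differentiable (at z)" if "z \<in> f ` U" for z
      using hd[OF that] differentiable_def by blast
    fix v
    define k' where "k' = (\<lambda>x. inverse_diff f x v $ 1 * partial 1 k x + inverse_diff f x v $ 2 * partial 2 k x)"
    have "smooth_on U k'"
      unfolding k'_def inverse_diff_def vector_2
      by (intro smooth_intros smooth_on_dird smooth_on_jac smooth_on_open[OF f(1)] f k j)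
    moreover have "dird v h z = k' (?g z)" if z: "z \<in> f ` U" for z
    proof -
      have "dird v h z = dird (inverse_diff f (?g z) v) k (?g z)" by (rule dird_eq[OF hd[OF z]])
      also have "\<dots> = k' (?g z)"
        unfolding k'_def using dird_axis[OF smooth_on_differentiable[OF k(1) inv_into_into[OF z]],
              of "inverse_diff f (?g z) v"] by simp
      finally show ?thesis .
    qed
    ultimately show "\<exists>h'. (\<exists>k. smooth_on U k \<and> (\<forall>z\<in>f ` U. h' z = k (?g z))) \<and> (\<forall>x\<in>f ` U. dird v h x = h' x)"
      by (intro exI[of _ "\<lambda>z. k' (?g z)"]) auto
  qed (use that in auto)
  have "smooth_on (f ` U) ?g"
  proof (rule smooth_on_vec, rule smooth_comp, intro exI conjI ballI)
    show "smooth_on U (\<lambda>x. x $ i)" for i :: 2 by (intro smooth_intros smooth_on_open[OF f(1)])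
  qed auto
  then show ?thesis using f by (simp add: point_transformation_def)
qed

text \<open>A map with invertible derivative at a point is injective nearby because the derivative depends
  continuously on the point.\<close>

lemma local_point_transformation:
  fixes f :: "point \<Rightarrow> point"
  assumes f: "smooth_on U f" and x: "x \<in> U" and j: "jac f x \<noteq> 0"
  obtains T where "open T" "x \<in> T" "T \<subseteq> U" "point_transformation T f"
proof -
  have op: "open U" by (rule smooth_on_open[OF f])
  have cont: "isCont (dird b f) x" for b
    using smooth_on_differentiable[OF smooth_on_dird[OF f] x] differentiable_imp_continuous_within by blast
  obtain r where r: "r > 0" "ball x r \<subseteq> U" "inj_on f (ball x r)"
  proof (rule has_derivative_locally_injective[OF x op _ inverse_diff_left smooth_on_has_derivative[OF f]])
    show "bounded_linear (inverse_diff f x)"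
      using linear_inverse_diff linear_conv_bounded_linear by blast
    fix e :: real assume "e > 0"
    have "((\<lambda>y. \<Sum>b\<in>Basis. norm (dird b f y - dird b f x)) \<longlongrightarrow> (\<Sum>b\<in>(Basis::point set). norm (dird b f x - dird b f x))) (at x)"
      by (intro tendsto_intros) (use cont isCont_def in blast)
    then have "((\<lambda>y. \<Sum>b\<in>Basis. norm (dird b f y - dird b f x)) \<longlongrightarrow> 0) (at x)" by simp
    from order_tendstoD(2)[OF this \<open>e > 0\<close>] eventually_at_in_open'[OF op x]
    have "\<forall>\<^sub>F y in at x. (\<Sum>b\<in>Basis. norm (dird b f y - dird b f x)) < e \<and> y \<in> U"
      by (rule eventually_conj)
    then obtain d where d: "d > 0" "\<And>y. y \<noteq> x \<Longrightarrow> dist y x < d \<Longrightarrow>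
        (\<Sum>b\<in>Basis. norm (dird b f y - dird b f x)) < e \<and> y \<in> U"
      unfolding eventually_at by auto
    have "onorm (\<lambda>v. dird v f y - dird v f x) < e" if "dist x y < d" for y
    proof (cases "y = x")
      case True
      then show ?thesis using \<open>e > 0\<close> by (simp add: onorm_zero)
    next
      case False
      then have y: "(\<Sum>b\<in>Basis. norm (dird b f y - dird b f x)) < e" "y \<in> U"
        using d(2)[of y] that by (auto simp: dist_commute)
      have "norm (dird v f y - dird v f x) \<le> (\<Sum>b\<in>Basis. norm (dird b f y - dird b f x)) * norm v" for v
      proof -
        have "dird v f y - dird v f x = (\<Sum>b\<in>Basis. (v \<bullet> b) *\<^sub>R (dird b f y - dird b f x))"
          using dird_basis_sum[OF smooth_on_differentiable[OF f y(2)], of v]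
            dird_basis_sum[OF smooth_on_differentiable[OF f x], of v]
          by (simp add: sum_subtractf scaleR_diff_right)
        also have "norm \<dots> \<le> (\<Sum>b\<in>Basis. norm v * norm (dird b f y - dird b f x))"
          by (rule sum_norm_le) (auto intro!: mult_right_mono Basis_le_norm)
        finally show ?thesis by (simp add: sum_distrib_left mult.commute)
      qed
      then show ?thesis using onorm_le y(1) by (meson le_less_trans)
    qed
    then show "\<exists>d>0. \<forall>y. dist x y < d \<longrightarrow> onorm (\<lambda>v. dird v f y - dird v f x) < e" using d(1) by blast
  qed (use smooth_on_differentiable[OF f x] j in auto)
  define T where "T = ball x r \<inter> {y \<in> U. jac f y \<noteq> 0}"
  have "continuous_on U (jac f)"
    using smooth_on_differentiable[OF smooth_on_jac[OF f]]
    by (simp add: continuous_on_eq_continuous_at op differentiable_imp_continuous_within)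
  then have "open (U \<inter> jac f -` (- {0}))" using continuous_open_preimage[OF _ op] by blast
  moreover have "U \<inter> jac f -` (- {0}) = {y \<in> U. jac f y \<noteq> 0}" by auto
  ultimately have T: "open T" "x \<in> T" "T \<subseteq> U" using r x j by (auto simp: T_def)
  moreover have "point_transformation T f"
    by (rule point_transformationI)
      (use T smooth_on_subset[OF f] inj_on_subset[OF r(3)] in \<open>auto simp: T_def\<close>)
  ultimately show thesis using that by blast
qed

lemma dird_const [simp]: "dird v (\<lambda>_. c) x = 0"
  by (simp add: dird_def)

lemma dird_ident [simp]: "dird v (\<lambda>x. x) x = v"
  by (simp add: dird_def)

lemma dird_diff:
  assumes "f differentiable (at x)" "g differentiable (at x)"
  shows "dird v (\<lambda>x. f x - g x) x = dird v f x - dird v g x"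
  by (rule dird_eq[OF has_derivative_diff[OF has_dird[OF assms(1)] has_dird[OF assms(2)]]])

lemma dird_mult:
  fixes f g :: "'a::euclidean_space \<Rightarrow> real"
  assumes "f differentiable (at x)" "g differentiable (at x)"
  shows "dird v (\<lambda>x. f x * g x) x = f x * dird v g x + dird v f x * g x"
  using dird_scaleR[OF assms] by simp

lemma axis_2_nth [simp]:
  "axis 1 (c::real) $ (1::2) = c" "axis 1 (c::real) $ (2::2) = 0"
  "axis 2 (c::real) $ (1::2) = 0" "axis 2 (c::real) $ (2::2) = c"
  by (simp_all add: axis_def)

section \<open>Iterated partial derivatives and jets\<close>

definition pd :: "nat \<Rightarrow> nat \<Rightarrow> (point \<Rightarrow> 'b::real_normed_vector) \<Rightarrow> point \<Rightarrow> 'b"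
  where "pd i j h = (partial 1 ^^ i) ((partial 2 ^^ j) h)"

lemma jet_pd: "jet k h p = (\<lambda>i j. if i + j \<le> k then pd i j h p else 0)"
  unfolding jet_def pd_def ..

lemma pd_0 [simp]: "pd 0 0 h = h"
  by (simp add: pd_def)

lemma pd_Suc_left: "pd (Suc i) j h = partial 1 (pd i j h)"
  by (simp add: pd_def)

lemma pd_0_Suc: "pd 0 (Suc j) h = partial 2 (pd 0 j h)"
  by (simp add: pd_def)

lemma pd_partial2: "pd i j (partial 2 h) = pd i (Suc j) h"
  by (simp add: pd_def funpow_swap1)

lemma smooth_on_pd [smooth_intros]: "smooth_on U h \<Longrightarrow> smooth_on U (pd i j h)"
proof (induction i)
  case 0
  then show ?case by (induction j) (simp_all add: pd_0_Suc smooth_on_dird)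
qed (simp add: pd_Suc_left smooth_on_dird)

lemma pd_cong:
  assumes U: "open U" and eq: "\<And>x. x \<in> U \<Longrightarrow> f x = g x" and x: "x \<in> U"
  shows "pd i j f x = pd i j g x"
  using x
proof (induction i arbitrary: x)
  case 0
  then show ?case
  proof (induction j arbitrary: x)
    case (Suc j)
    show ?case unfolding pd_0_Suc by (rule dird_cong[OF U Suc.prems]) (rule Suc.IH)
  qed (simp add: eq)
next
  case (Suc i)
  show ?case unfolding pd_Suc_left by (rule dird_cong[OF U Suc.prems]) (rule Suc.IH)
qed

lemma jet_cong:
  assumes "open U" "x \<in> U" "\<And>x. x \<in> U \<Longrightarrow> f x = g x"
  shows "jet k f x = jet k g x"
  by (auto simp: jet_pd fun_eq_iff intro!: pd_cong[OF assms(1)] assms(2,3))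

lemma pd_linear_comp:
  assumes L: "bounded_linear L" and h: "smooth_on U h" and x: "x \<in> U"
  shows "pd i j (\<lambda>x. L (h x)) x = L (pd i j h x)"
  using x
proof (induction i arbitrary: x)
  case 0
  then show ?case
  proof (induction j arbitrary: x)
    case (Suc j)
    have "pd 0 (Suc j) (\<lambda>x. L (h x)) x = dird (axis 2 1) (\<lambda>x. L (pd 0 j h x)) x"
      unfolding pd_0_Suc by (rule dird_cong[OF smooth_on_open[OF h] Suc.prems]) (rule Suc.IH)
    also have "\<dots> = L (pd 0 (Suc j) h x)" unfolding pd_0_Suc
      by (rule dird_linear_comp[OF L smooth_on_differentiable[OF smooth_on_pd[OF h] Suc.prems]])
    finally show ?case .
  qed simp
next
  case (Suc i)
  have "pd (Suc i) j (\<lambda>x. L (h x)) x = dird (axis 1 1) (\<lambda>x. L (pd i j h x)) x"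
    unfolding pd_Suc_left by (rule dird_cong[OF smooth_on_open[OF h] Suc.prems]) (rule Suc.IH)
  also have "\<dots> = L (pd (Suc i) j h x)" unfolding pd_Suc_left
    by (rule dird_linear_comp[OF L smooth_on_differentiable[OF smooth_on_pd[OF h] Suc.prems]])
  finally show ?case .
qed

lemma pd_vec_nth:
  fixes h :: "point \<Rightarrow> ('b::euclidean_space)^'n"
  shows "smooth_on U h \<Longrightarrow> x \<in> U \<Longrightarrow> pd i j (\<lambda>x. h x $ k) x = pd i j h x $ k"
  by (rule pd_linear_comp[OF bounded_linear_vec_nth])

lemma pd_add:
  assumes f: "smooth_on U f" and g: "smooth_on U g" and x: "x \<in> U"
  shows "pd i j (\<lambda>x. f x + g x) x = pd i j f x + pd i j g x"
proof -
  have "pd i j (\<lambda>x. f x + g x) x = pd i j (\<lambda>x. fst (f x, g x) + snd (f x, g x)) x" by simp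
  also have "\<dots> = fst (pd i j (\<lambda>x. (f x, g x)) x) + snd (pd i j (\<lambda>x. (f x, g x)) x)"
    by (rule pd_linear_comp[OF _ smooth_on_Pair[OF f g] x])
      (intro bounded_linear_add bounded_linear_fst bounded_linear_snd)
  also have "\<dots> = pd i j f x + pd i j g x"
    using pd_linear_comp[OF bounded_linear_fst smooth_on_Pair[OF f g] x, of i j]
      pd_linear_comp[OF bounded_linear_snd smooth_on_Pair[OF f g] x, of i j] by simp
  finally show ?thesis .
qed

lemma pd_scaleR_left:
  fixes f :: "point \<Rightarrow> 'b::real_normed_vector"
  shows "smooth_on U f \<Longrightarrow> x \<in> U \<Longrightarrow> pd i j (\<lambda>x. c *\<^sub>R f x) x = c *\<^sub>R pd i j f x"
  by (rule pd_linear_comp[OF bounded_linear_scaleR_right])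

lemma pd_const [simp]: "pd i j (\<lambda>_. c) x = (if i = 0 \<and> j = 0 then c else 0)"
proof -
  have z: "pd i j (\<lambda>_. 0) x = 0" for i j and x
    using pd_scaleR_left[OF smooth_on_const[OF open_UNIV, of 0], of x i j 0] by simp
  have z1: "partial k (\<lambda>_. c) = (\<lambda>_. 0)" for k by (simp add: fun_eq_iff)
  show ?thesis
  proof (cases j)
    case (Suc j')
    have "pd i j (\<lambda>_. c) = pd i j' (partial 2 (\<lambda>_. c))" by (simp only: Suc pd_partial2)
    then show ?thesis using z[of i j' x] Suc by (simp add: z1)
  next
    case 0
    show ?thesis
    proof (cases i)
      case (Suc i')
      have "pd i 0 (\<lambda>_. c) = pd i' 0 (partial 1 (\<lambda>_. c))" by (simp add: Suc pd_def funpow_swap1)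
      then show ?thesis using z[of i' 0 x] Suc 0 by (simp add: z1)
    qed (simp add: 0)
  qed
qed

lemma pd_sum:
  assumes "finite I" "open U" "\<And>k. k \<in> I \<Longrightarrow> smooth_on U (f k)" "x \<in> U"
  shows "pd i j (\<lambda>x. \<Sum>k\<in>I. f k x) x = (\<Sum>k\<in>I. pd i j (f k) x)"
  using assms
proof (induction I rule: finite_induct)
  case (insert k I)
  have "pd i j (\<lambda>x. f k x + (\<Sum>k\<in>I. f k x)) x = pd i j (f k) x + pd i j (\<lambda>x. \<Sum>k\<in>I. f k x) x"
    by (rule pd_add[of U]) (use insert in \<open>auto intro: smooth_on_sum\<close>)
  then show ?case using insert by simp
qed simp

text \<open>This is where the order of differentiation matters: \<open>pd\<close> differentiates in the second direction
  first.\<close>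

lemma pd_partial1:
  fixes h :: "point \<Rightarrow> 'b::euclidean_space"
  assumes h: "smooth_on U h" and x: "x \<in> U"
  shows "pd i j (partial 1 h) x = pd (Suc i) j h x"
  using x
proof (induction i arbitrary: x)
  case 0
  then show ?case
  proof (induction j arbitrary: x)
    case (Suc j)
    have "pd 0 (Suc j) (partial 1 h) x = partial 2 (pd (Suc 0) j h) x"
      unfolding pd_0_Suc by (rule dird_cong[OF smooth_on_open[OF h] Suc.prems]) (rule Suc.IH)
    also have "\<dots> = pd (Suc 0) (Suc j) h x"
      unfolding pd_Suc_left pd_0_Suc
      by (rule dird_commute[OF smooth_on_pd[OF h] Suc.prems])
    finally show ?case .
  qed (simp add: pd_Suc_left)
next
  case (Suc i)
  have "partial 1 (pd i j (partial 1 h)) x = partial 1 (pd (Suc i) j h) x"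
    by (rule dird_cong[OF smooth_on_open[OF h] Suc.prems]) (rule Suc.IH)
  then show ?case by (simp add: pd_Suc_left)
qed

lemma pd_Suc_right:
  fixes h :: "point \<Rightarrow> 'b::euclidean_space"
  assumes h: "smooth_on U h" and x: "x \<in> U"
  shows "partial 2 (pd i j h) x = pd i (Suc j) h x"
  using x
proof (induction i arbitrary: x)
  case (Suc i)
  have "partial 2 (pd (Suc i) j h) x = partial 1 (partial 2 (pd i j h)) x"
    unfolding pd_Suc_left by (rule dird_commute[OF smooth_on_pd[OF h] Suc.prems])
  also have "\<dots> = partial 1 (pd i (Suc j) h) x"
    by (rule dird_cong[OF smooth_on_open[OF h] Suc.prems]) (rule Suc.IH)
  finally show ?case by (simp add: pd_Suc_left)
qed (simp add: pd_0_Suc)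

definition monomial :: "point \<Rightarrow> nat \<Rightarrow> nat \<Rightarrow> point \<Rightarrow> real"
  where "monomial p i j x = inverse (fact i * fact j) * ((x $ 1 - p $ 1) ^ i * (x $ 2 - p $ 2) ^ j)"

lemma smooth_on_monomial: "open U \<Longrightarrow> smooth_on U (monomial p i j)"
  unfolding monomial_def by (intro smooth_intros)

lemma partial_monomial:
  "partial 1 (monomial p i j) = (\<lambda>x. if i = 0 then 0 else monomial p (i - 1) j x)"
  "partial 2 (monomial p i j) = (\<lambda>x. if j = 0 then 0 else monomial p i (j - 1) x)"
proof -
  have d: "((\<lambda>x. x $ l - p $ l) has_derivative (\<lambda>v. v $ l)) (at x)" for l and x :: point
    using has_derivative_diff[OF bounded_linear_imp_has_derivative[OF bounded_linear_vec_nth] has_derivative_const]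
    by simp
  have *: "(monomial p i j has_derivative (\<lambda>v. inverse (fact i * fact j) *
      ((x $ 1 - p $ 1) ^ i * (of_nat j * v $ 2 * (x $ 2 - p $ 2) ^ (j - 1)) +
      (of_nat i * v $ 1 * (x $ 1 - p $ 1) ^ (i - 1)) * (x $ 2 - p $ 2) ^ j))) (at x)" for x
    unfolding monomial_def
    by (rule has_derivative_mult_right[OF has_derivative_mult
          [OF has_derivative_power[OF d] has_derivative_power[OF d]]])
  have f: "inverse (fact (Suc n)) * real (Suc n) = inverse (fact n)" for n
    by (simp only: fact_Suc inverse_mult_distrib of_nat_id) (simp del: of_nat_Suc)
  have "partial 1 (monomial p i j) x = (if i = 0 then 0 else monomial p (i - 1) j x)" for x
  proof (cases i)
    case (Suc m)
    have "partial 1 (monomial p i j) x = (inverse (fact (Suc m)) * real (Suc m)) * inverse (fact j) *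
        ((x $ 1 - p $ 1) ^ m * (x $ 2 - p $ 2) ^ j)"
      unfolding dird_eq[OF *] unfolding Suc by simp
    then show ?thesis unfolding f by (simp add: Suc monomial_def)
  next
    case 0
    show ?thesis unfolding dird_eq[OF *] by (simp add: 0)
  qed
  then show "partial 1 (monomial p i j) = (\<lambda>x. if i = 0 then 0 else monomial p (i - 1) j x)" ..
  have "partial 2 (monomial p i j) x = (if j = 0 then 0 else monomial p i (j - 1) x)" for x
  proof (cases j)
    case (Suc m)
    have "partial 2 (monomial p i j) x = (inverse (fact (Suc m)) * real (Suc m)) * inverse (fact i) *
        ((x $ 1 - p $ 1) ^ i * (x $ 2 - p $ 2) ^ m)"
      unfolding dird_eq[OF *] unfolding Suc by (simp add: mult_ac del: of_nat_Suc fact_Suc)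
    then show ?thesis unfolding f by (simp add: Suc monomial_def)
  next
    case 0
    show ?thesis unfolding dird_eq[OF *] by (simp add: 0)
  qed
  then show "partial 2 (monomial p i j) = (\<lambda>x. if j = 0 then 0 else monomial p i (j - 1) x)" ..
qed

lemma pd_monomial: "pd a b (monomial p i j) p = (if a = i \<and> b = j then 1 else 0)"
proof -
  have 2: "pd 0 b (monomial p i j) = (\<lambda>x. if b \<le> j then monomial p i (j - b) x else 0)" for i j
  proof (induction b)
    case (Suc b)
    show ?case
      unfolding pd_0_Suc Suc
      by (cases "b \<le> j") (auto simp: fun_eq_iff partial_monomial)
  qed simp
  have "pd a b (monomial p i j) = (\<lambda>x. if a \<le> i \<and> b \<le> j then monomial p (i - a) (j - b) x else 0)"
  proof (induction a)
    case (Suc a)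
    show ?case
      unfolding pd_Suc_left Suc
      by (cases "a \<le> i \<and> b \<le> j") (auto simp: fun_eq_iff partial_monomial)
  qed (auto simp: 2 fun_eq_iff)
  then show ?thesis by (auto simp: monomial_def)
qed

definition poly_jet :: "nat \<Rightarrow> point \<Rightarrow> (nat \<Rightarrow> nat \<Rightarrow> 'b::euclidean_space) \<Rightarrow> point \<Rightarrow> 'b"
  where "poly_jet k p c x = (\<Sum>(i,j)\<in>{(i,j). i + j \<le> k}. monomial p i j x *\<^sub>R c i j)"

lemma finite_jet_indices: "finite {(i::nat,j). i + j \<le> k}"
  by (rule finite_subset[of _ "{..k} \<times> {..k}"]) auto

lemma smooth_on_poly_jet: "open U \<Longrightarrow> smooth_on U (poly_jet k p c)"
  unfolding poly_jet_def case_prod_beta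
  by (intro smooth_intros smooth_on_monomial)

lemma pd_poly_jet: "pd i j (poly_jet k p c) p = (if i + j \<le> k then c i j else 0)"
proof -
  have s: "smooth_on UNIV (\<lambda>x. monomial p i' j' x *\<^sub>R c i' j')" for i' j'
    by (intro smooth_intros smooth_on_monomial) auto
  have "pd i j (\<lambda>x. monomial p i' j' x *\<^sub>R c i' j') p = (if i = i' \<and> j = j' then c i j else 0)" for i' j'
    using pd_linear_comp[OF bounded_linear_scaleR_left[of "c i' j'"] smooth_on_monomial[OF open_UNIV, of p i' j'], of p i j]
    by (simp add: pd_monomial)
  moreover have "pd i j (poly_jet k p c) p =
      (\<Sum>q\<in>{(i,j). i + j \<le> k}. pd i j (\<lambda>x. monomial p (fst q) (snd q) x *\<^sub>R c (fst q) (snd q)) p)"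
    unfolding poly_jet_def case_prod_beta
    by (rule pd_sum[OF finite_jet_indices[unfolded case_prod_beta] open_UNIV s UNIV_I])
  ultimately have "pd i j (poly_jet k p c) p =
      (\<Sum>q\<in>{(i,j). i + j \<le> k}. if i = fst q \<and> j = snd q then c i j else 0)"
    by simp
  also have "\<dots> = (\<Sum>x\<in>{(i,j). i + j \<le> k}. if (i, j) = x then c i j else 0)"
    by (rule sum.cong) auto
  also have "\<dots> = (if i + j \<le> k then c i j else 0)"
    by (subst sum.delta'[OF finite_jet_indices]) auto
  finally show ?thesis .
qed

text \<open>The functions that vanish at \<open>p\<close> to order \<open>n\<close> form the \<open>n\<close>-th power of the maximal ideal at \<open>p\<close>.
  The recursion on first derivatives suits inductions with the Leibniz rule and the chain rule;
  \<open>vanishes_iff_pd\<close> translates it into a condition on jets.\<close>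

primrec vanishes :: "nat \<Rightarrow> (point \<Rightarrow> real) \<Rightarrow> point \<Rightarrow> bool" where
  "vanishes 0 h p \<longleftrightarrow> True"
| "vanishes (Suc n) h p \<longleftrightarrow> h p = 0 \<and> vanishes n (partial 1 h) p \<and> vanishes n (partial 2 h) p"

lemma vanishes_iff_pd:
  "smooth_on U h \<Longrightarrow> p \<in> U \<Longrightarrow> vanishes n h p \<longleftrightarrow> (\<forall>i j. i + j < n \<longrightarrow> pd i j h p = 0)"
proof (induction n arbitrary: h)
  case (Suc n)
  have "vanishes (Suc n) h p \<longleftrightarrow> h p = 0 \<and> (\<forall>i j. i + j < n \<longrightarrow> pd (Suc i) j h p = 0) \<and>
      (\<forall>i j. i + j < n \<longrightarrow> pd i (Suc j) h p = 0)"
    using Suc.IH[OF smooth_on_dird[OF Suc.prems(1)] Suc.prems(2)]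
    by (simp add: pd_partial1[OF Suc.prems] pd_partial2)
  also have "\<dots> \<longleftrightarrow> (\<forall>i j. i + j < Suc n \<longrightarrow> pd i j h p = 0)"
  proof
    assume *: "\<forall>i j. i + j < Suc n \<longrightarrow> pd i j h p = 0"
    from *[rule_format, of 0 0] * show "h p = 0 \<and> (\<forall>i j. i + j < n \<longrightarrow> pd (Suc i) j h p = 0) \<and>
      (\<forall>i j. i + j < n \<longrightarrow> pd i (Suc j) h p = 0)" by simp
  next
    assume *: "h p = 0 \<and> (\<forall>i j. i + j < n \<longrightarrow> pd (Suc i) j h p = 0) \<and>
      (\<forall>i j. i + j < n \<longrightarrow> pd i (Suc j) h p = 0)"
    have "pd i j h p = 0" if "i + j < Suc n" for i j
    proof (cases i)
      case 0
      then show ?thesis using * that by (cases j) simp_all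
    qed (use * that in simp)
    then show "\<forall>i j. i + j < Suc n \<longrightarrow> pd i j h p = 0" by blast
  qed
  finally show ?case .
qed simp

lemma vanishes_cong:
  assumes "open U" "p \<in> U" "\<And>x. x \<in> U \<Longrightarrow> f x = g x"
  shows "vanishes n f p \<longleftrightarrow> vanishes n g p"
  using assms(3)
proof (induction n arbitrary: f g)
  case (Suc n)
  have "\<And>x. x \<in> U \<Longrightarrow> partial i f x = partial i g x" for i
    by (rule dird_cong[OF assms(1)]) (use Suc.prems in auto)
  then show ?case using Suc.IH[of "partial 1 f" "partial 1 g"] Suc.IH[of "partial 2 f" "partial 2 g"]
      Suc.prems[OF assms(2)] by simp
qed simp

lemma vanishes_transfer:
  "vanishes n g p \<Longrightarrow> open U \<Longrightarrow> p \<in> U \<Longrightarrow> (\<And>x. x \<in> U \<Longrightarrow> f x = g x) \<Longrightarrow> vanishes n f p"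
  using vanishes_cong[of U p f g n] by blast

lemma vanishes_Suc_D: "vanishes (Suc n) h p \<Longrightarrow> vanishes n h p"
proof (induction n arbitrary: h)
  case (Suc n)
  show ?case using Suc.IH[of "partial 1 h"] Suc.IH[of "partial 2 h"] Suc.prems by simp
qed simp

lemma vanishes_mono: "vanishes n h p \<Longrightarrow> m \<le> n \<Longrightarrow> vanishes m h p"
proof (induction n)
  case (Suc n)
  then show ?case using vanishes_Suc_D[OF Suc.prems(1)] by (cases "m = Suc n") simp_all
qed simp

lemma vanishes_partial: "vanishes n h p \<Longrightarrow> vanishes (n - 1) (partial 1 h) p"
  "vanishes n h p \<Longrightarrow> vanishes (n - 1) (partial 2 h) p"
  by (cases n; simp)+

lemma vanishes_value: "vanishes n h p \<Longrightarrow> n > 0 \<Longrightarrow> h p = 0"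
  by (cases n) auto

lemma vanishes_add:
  assumes "smooth_on U f" "smooth_on U g" "p \<in> U" "vanishes n f p" "vanishes n g p"
  shows "vanishes n (\<lambda>x. f x + g x) p"
  using assms(4,5) vanishes_iff_pd[OF assms(1,3)] vanishes_iff_pd[OF assms(2,3)]
    vanishes_iff_pd[OF smooth_on_add[OF assms(1,2)] assms(3)] pd_add[OF assms(1,2,3)]
  by simp

lemma vanishes_mult:
  assumes "smooth_on U f" "smooth_on U g" "p \<in> U" "vanishes a f p" "vanishes b g p" "n \<le> a + b"
  shows "vanishes n (\<lambda>x. f x * g x) p"
  using assms
proof (induction n arbitrary: a b f g)
  case (Suc n)
  have "f p * g p = 0"
  proof (cases "a = 0")
    case True
    then show ?thesis using vanishes_value[OF Suc.prems(5)] Suc.prems(6) by simp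
  next
    case False
    then show ?thesis using vanishes_value[OF Suc.prems(4)] by simp
  qed
  moreover have "vanishes n (partial i (\<lambda>x. f x * g x)) p"
    if h: "vanishes (a - 1) (partial i f) p" "vanishes (b - 1) (partial i g) p" for i
  proof -
    have 1: "vanishes n (\<lambda>x. f x * partial i g x) p"
    proof (rule Suc.IH[OF Suc.prems(1) smooth_on_dird[OF Suc.prems(2)] Suc.prems(3,4) h(2)])
      show "n \<le> a + (b - 1)" using Suc.prems(6) by simp
    qed
    have 2: "vanishes n (\<lambda>x. partial i f x * g x) p"
    proof (rule Suc.IH[OF smooth_on_dird[OF Suc.prems(1)] Suc.prems(2,3) h(1) Suc.prems(5)])
      show "n \<le> a - 1 + b" using Suc.prems(6) by simp
    qed
    have "vanishes n (\<lambda>x. f x * partial i g x + partial i f x * g x) p"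
      by (rule vanishes_add[OF _ _ Suc.prems(3) 1 2])
        (intro smooth_intros smooth_on_dird Suc.prems)+
    then show ?thesis
      by (rule vanishes_transfer[OF _ smooth_on_open[OF Suc.prems(1)] Suc.prems(3)])
        (intro dird_mult smooth_on_differentiable[OF Suc.prems(1)] smooth_on_differentiable[OF Suc.prems(2)])
  qed
  ultimately show ?case using vanishes_partial[OF Suc.prems(4)] vanishes_partial[OF Suc.prems(5)]
    by simp
qed simp

lemma vanishes_compose:
  fixes g :: "point \<Rightarrow> point"
  assumes "smooth_on V h" "smooth_on U g" "\<And>x. x \<in> U \<Longrightarrow> g x \<in> V" "p \<in> U" "vanishes n h (g p)"
  shows "vanishes n (\<lambda>x. h (g x)) p"
  using assms(1,5)
proof (induction n arbitrary: h)
  case (Suc n)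
  have "vanishes n (partial i (\<lambda>x. h (g x))) p" for i
  proof -
    have sc: "smooth_on U (\<lambda>x. partial j h (g x))" "smooth_on U (partial i (\<lambda>x. g x $ j))" for j
      by (rule smooth_on_compose[OF assms(2) smooth_on_dird[OF Suc.prems(1)] assms(3)], assumption)
        (intro smooth_intros smooth_on_dird assms)
    have "vanishes n (\<lambda>x. partial i (\<lambda>x. g x $ 1) x * partial 1 h (g x) + partial i (\<lambda>x. g x $ 2) x * partial 2 h (g x)) p"
    proof (rule vanishes_add[OF smooth_on_mult[OF sc(2,1)] smooth_on_mult[OF sc(2,1)] assms(4)])
      show "vanishes n (\<lambda>x. partial i (\<lambda>x. g x $ 1) x * partial 1 h (g x)) p"
        by (rule vanishes_mult[OF sc(2,1) assms(4), where a = 0 and b = n]) (use Suc smooth_on_dird in auto)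
      show "vanishes n (\<lambda>x. partial i (\<lambda>x. g x $ 2) x * partial 2 h (g x)) p"
        by (rule vanishes_mult[OF sc(2,1) assms(4), where a = 0 and b = n]) (use Suc smooth_on_dird in auto)
    qed
    moreover have "partial i (\<lambda>x. h (g x)) x =
        partial i (\<lambda>x. g x $ 1) x * partial 1 h (g x) + partial i (\<lambda>x. g x $ 2) x * partial 2 h (g x)"
      if "x \<in> U" for x
      using dird_chain[OF smooth_on_differentiable[OF assms(2) that]
          smooth_on_differentiable[OF Suc.prems(1) assms(3)[OF that]], of "axis i 1"] by simp
    ultimately show ?thesis by (rule vanishes_transfer[OF _ smooth_on_open[OF assms(2)] assms(4)])
  qed
  then show ?case using Suc.prems by simp
qed simp

lemma jet_eq_iff_vanishes:
  fixes f g :: "point \<Rightarrow> real^'n"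
  assumes f: "smooth_on U f" and g: "smooth_on U g" and p: "p \<in> U"
  shows "jet k f p = jet k g p \<longleftrightarrow> (\<forall>c. vanishes (Suc k) (\<lambda>x. f x $ c - g x $ c) p)"
proof -
  have s: "smooth_on U (\<lambda>x. f x $ c - g x $ c)" for c by (intro smooth_intros f g)
  have "pd i j (\<lambda>x. f x $ c - g x $ c) p = pd i j f p $ c - pd i j g p $ c" for i j c
  proof -
    have "pd i j (\<lambda>x. f x $ c + (- 1) *\<^sub>R g x $ c) p = pd i j (\<lambda>x. f x $ c) p + pd i j (\<lambda>x. (- 1) *\<^sub>R g x $ c) p"
      by (rule pd_add[OF _ _ p]) (intro smooth_intros f g smooth_on_open[OF f])+
    also have "pd i j (\<lambda>x. (- 1) *\<^sub>R g x $ c) p = (-1) *\<^sub>R pd i j (\<lambda>x. g x $ c) p"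
      by (rule pd_scaleR_left[OF _ p]) (intro smooth_intros g)
    finally show ?thesis using pd_vec_nth[OF f p] pd_vec_nth[OF g p] by simp
  qed
  then have "(\<forall>c. vanishes (Suc k) (\<lambda>x. f x $ c - g x $ c) p) \<longleftrightarrow>
      (\<forall>i j. i + j < Suc k \<longrightarrow> pd i j f p = pd i j g p)"
    unfolding vanishes_iff_pd[OF s p] vec_eq_iff by auto
  then show ?thesis by (auto simp: jet_pd fun_eq_iff)
qed

text \<open>Composing with a map that agrees with the identity up to order \<open>r\<close> changes a function only in
  order \<open>r + 1\<close>, and in higher order still if its derivatives vanish at the point.\<close>

lemma vanishes_compose_near_identity:
  fixes \<psi> :: "point \<Rightarrow> point"
  assumes Q: "smooth_on V Q" and psi: "smooth_on U \<psi>" "\<And>x. x \<in> U \<Longrightarrow> \<psi> x \<in> V"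
    and p: "p \<in> U" "p \<in> V" and C: "\<And>j. vanishes (Suc r) (\<lambda>x. \<psi> x $ j - x $ j) p"
    and dQ: "vanishes s (partial 1 Q) p" "vanishes s (partial 2 Q) p" and n: "n \<le> Suc r + s"
  shows "vanishes n (\<lambda>x. Q (\<psi> x) - Q x) p"
  using Q dQ n
proof (induction n arbitrary: Q s)
  case (Suc n)
  define T where "T = U \<inter> V"
  have T: "open T" "p \<in> T" using smooth_on_open[OF psi(1)] smooth_on_open[OF Q] p by (auto simp: T_def)
  have sT: "smooth_on T f" if "smooth_on U f \<or> smooth_on V f" for f :: "point \<Rightarrow> real"
    using that smooth_on_subset[OF _ T(1)] by (auto simp: T_def)
  have psip: "\<psi> p = p" using C[of 1] C[of 2] by (simp add: vec_eq_iff forall_2)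
  have sQ: "smooth_on T (\<lambda>x. partial j Q (\<psi> x))" for j
    using sT smooth_on_compose[OF psi(1) smooth_on_dird[OF Suc.prems(1)] psi(2)] by blast
  have sC: "smooth_on T (\<lambda>x. \<psi> x $ j - x $ j)" for j
    by (rule sT) (intro disjI1 smooth_intros psi smooth_on_open[OF psi(1)])
  have "vanishes n (partial i (\<lambda>x. Q (\<psi> x) - Q x)) p"
    if i: "i = 1 \<or> i = 2" for i
  proof -
    have dv: "vanishes s (partial i Q) p" using i Suc.prems(2,3) by auto
    have 1: "vanishes n (\<lambda>x. partial i Q (\<psi> x) - partial i Q x) p"
      by (rule Suc.IH[OF smooth_on_dird[OF Suc.prems(1)], of "s - 1"])
        (use vanishes_partial[OF dv] Suc.prems(4) in auto)
    have 2: "vanishes n (\<lambda>x. partial i (\<lambda>x. \<psi> x $ j - x $ j) x * partial j Q (\<psi> x)) p" if "j = 1 \<or> j = 2" for j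
    proof (rule vanishes_mult[OF smooth_on_dird[OF sC] sQ T(2)])
      show "vanishes r (partial i (\<lambda>x. \<psi> x $ j - x $ j)) p" using C[of j] i by auto
      show "vanishes s (\<lambda>x. partial j Q (\<psi> x)) p"
        by (rule vanishes_compose[OF smooth_on_dird[OF Suc.prems(1)] psi p(1)])
           (use psip that Suc.prems(2,3) in auto)
      show "n \<le> r + s" using Suc.prems(4) by simp
    qed
    have "vanishes n (\<lambda>x. (partial i Q (\<psi> x) - partial i Q x) +
        (partial i (\<lambda>x. \<psi> x $ 1 - x $ 1) x * partial 1 Q (\<psi> x) + partial i (\<lambda>x. \<psi> x $ 2 - x $ 2) x * partial 2 Q (\<psi> x))) p"
    proof (intro vanishes_add[OF _ _ T(2)] 1 2 smooth_on_add smooth_on_diff smooth_on_mult sQ smooth_on_dird[OF sC])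
      show "smooth_on T (partial i Q)" by (rule sT[OF disjI2[OF smooth_on_dird[OF Suc.prems(1)]]])
    qed auto
    moreover have "partial i (\<lambda>x. Q (\<psi> x) - Q x) x = (partial i Q (\<psi> x) - partial i Q x) +
        (partial i (\<lambda>x. \<psi> x $ 1 - x $ 1) x * partial 1 Q (\<psi> x) + partial i (\<lambda>x. \<psi> x $ 2 - x $ 2) x * partial 2 Q (\<psi> x))"
      if x: "x \<in> T" for x
    proof -
      have xU: "x \<in> U" "x \<in> V" using x by (auto simp: T_def)
      note dp = smooth_on_differentiable[OF psi(1) xU(1)]
      note dQ = smooth_on_differentiable[OF Suc.prems(1) psi(2)[OF xU(1)]]
      have dx: "(\<lambda>x::point. x $ j) differentiable (at x)" "partial i (\<lambda>x. x $ j) x = axis i 1 $ j" for i j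
        using dird_vec_nth[of "\<lambda>x. x" x "axis i 1" j] by (auto intro!: bounded_linear_imp_differentiable bounded_linear_vec_nth)
      have dpj: "(\<lambda>x. \<psi> x $ j) differentiable (at x)" for j
        using smooth_on_differentiable[OF smooth_on_vec_nth[OF psi(1)] xU(1)] .
      have "partial i (\<lambda>x. Q (\<psi> x) - Q x) x = partial i (\<lambda>x. Q (\<psi> x)) x - partial i Q x"
        by (rule dird_diff) (use differentiable_chain_at[OF dp dQ] smooth_on_differentiable[OF Suc.prems(1) xU(2)] in \<open>auto simp: o_def\<close>)
      then show ?thesis
        using dird_chain[OF dp dQ, of "axis i 1"] i
        by (elim disjE) (simp_all add: dird_diff[OF dpj dx(1)] dx(2) algebra_simps)
    qed
    ultimately show ?thesis by (rule vanishes_transfer[OF _ T])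
  qed
  then show ?case using psip by simp
qed simp

section \<open>The transformation law\<close>

lemma forall_index_4: "(\<forall>i::4. P i) \<longleftrightarrow> P 0 \<and> P 1 \<and> P 2 \<and> P 3"
proof -
  have "(4::4) = 0" by simp
  then show ?thesis unfolding forall_4 by metis
qed

text \<open>The indices are those of the fibre coordinates \<open>u\<^sup>0, \<dots>, u\<^sup>3\<close>.\<close>

definition vec4 :: "real \<Rightarrow> real \<Rightarrow> real \<Rightarrow> real \<Rightarrow> real^4"
  where "vec4 c0 c1 c2 c3 = (\<chi> i. if i = 0 then c0 else if i = 1 then c1 else if i = 2 then c2 else c3)"

lemma vec4_nth [simp]:
  "vec4 c0 c1 c2 c3 $ 0 = c0" "vec4 c0 c1 c2 c3 $ 1 = c1"
  "vec4 c0 c1 c2 c3 $ 2 = c2" "vec4 c0 c1 c2 c3 $ 3 = c3"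
  by (simp_all add: vec4_def)

lemma vec4_eq_iff: "(v::real^4) = w \<longleftrightarrow> v $ 0 = w $ 0 \<and> v $ 1 = w $ 1 \<and> v $ 2 = w $ 2 \<and> v $ 3 = w $ 3"
  by (simp add: vec_eq_iff forall_index_4)

lemma sum_axis_vec4: "(\<Sum>\<alpha><4. c \<alpha> *\<^sub>R axis (of_nat \<alpha>) 1) = vec4 (c 0) (c 1) (c 2) (c 3)"
  by (simp add: vec4_eq_iff eval_nat_numeral axis_def)

text \<open>The coefficients, as a polynomial in \<open>q\<close>, of the transformed equation, where \<open>a\<close>, \<open>b\<close>, \<open>A\<close>, \<open>B\<close> are
  \<open>a0 + a1 q\<close>, \<open>b0 + b1 q\<close>, \<open>A0 + 2 A1 q + A2 q\<^sup>2\<close>, \<open>B0 + 2 B1 q + B2 q\<^sup>2\<close>.\<close>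

definition law :: "real \<Rightarrow> real \<Rightarrow> real \<Rightarrow> real \<Rightarrow> real \<Rightarrow> real \<Rightarrow> real \<Rightarrow> real \<Rightarrow> real \<Rightarrow> real \<Rightarrow> real^4 \<Rightarrow> real^4"
  where "law a0 a1 b0 b1 A0 A1 A2 B0 B1 B2 u = inverse (a0 * b1 - a1 * b0) *\<^sub>R vec4
    (u $ 0 * a0 ^ 3 + u $ 1 * (a0\<^sup>2 * b0) + u $ 2 * (a0 * b0\<^sup>2) + u $ 3 * b0 ^ 3
      + (b0 * A0 - a0 * B0))
    (u $ 0 * (3 * a0\<^sup>2 * a1) + u $ 1 * (2 * a0 * a1 * b0 + a0\<^sup>2 * b1)
      + u $ 2 * (a1 * b0\<^sup>2 + 2 * a0 * b0 * b1) + u $ 3 * (3 * b0\<^sup>2 * b1)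
      + (2 * b0 * A1 + b1 * A0 - 2 * a0 * B1 - a1 * B0))
    (u $ 0 * (3 * a0 * a1\<^sup>2) + u $ 1 * (a1\<^sup>2 * b0 + 2 * a0 * a1 * b1)
      + u $ 2 * (2 * a1 * b0 * b1 + a0 * b1\<^sup>2) + u $ 3 * (3 * b0 * b1\<^sup>2)
      + (b0 * A2 + 2 * b1 * A1 - a0 * B2 - 2 * a1 * B1))
    (u $ 0 * a1 ^ 3 + u $ 1 * (a1\<^sup>2 * b1) + u $ 2 * (a1 * b1\<^sup>2) + u $ 3 * b1 ^ 3
      + (b1 * A2 - a1 * B2))"

text \<open>The transformed coefficients at \<open>z\<close>, in terms of the inverse \<open>g\<close> of the point transformation.\<close>

definition transformed :: "(point \<Rightarrow> point) \<Rightarrow> point \<Rightarrow> real^4 \<Rightarrow> real^4"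
  where "transformed g z = law
    (partial 1 (\<lambda>x. g x $ 1) z) (partial 2 (\<lambda>x. g x $ 1) z)
    (partial 1 (\<lambda>x. g x $ 2) z) (partial 2 (\<lambda>x. g x $ 2) z)
    (partial 1 (partial 1 (\<lambda>x. g x $ 1)) z) (partial 1 (partial 2 (\<lambda>x. g x $ 1)) z)
    (partial 2 (partial 2 (\<lambda>x. g x $ 1)) z)
    (partial 1 (partial 1 (\<lambda>x. g x $ 2)) z) (partial 1 (partial 2 (\<lambda>x. g x $ 2)) z)
    (partial 2 (partial 2 (\<lambda>x. g x $ 2)) z)"

lemma lift0_eq: "lift0 U f (p, u) = (f p, transformed (inv_into U f) (f p) u)"
  unfolding lift0_def Let_def case_prod_conv sum_axis_vec4 transformed_def
  by (simp add: law_def vec4_eq_iff power3_eq_cube power2_eq_square eval_nat_numeral algebra_simps)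

lemma smooth_on_vec4 [smooth_intros]:
  assumes "smooth_on U c0" "smooth_on U c1" "smooth_on U c2" "smooth_on U c3"
  shows "smooth_on U (\<lambda>x. vec4 (c0 x) (c1 x) (c2 x) (c3 x))"
proof (rule smooth_on_vec)
  have "\<forall>i. smooth_on U (\<lambda>x. vec4 (c0 x) (c1 x) (c2 x) (c3 x) $ i)"
    using assms by (simp add: forall_index_4)
  then show "smooth_on U (\<lambda>x. vec4 (c0 x) (c1 x) (c2 x) (c3 x) $ i)" for i by blast
qed

lemma smooth_on_law:
  assumes "smooth_on U a0" "smooth_on U a1" "smooth_on U b0" "smooth_on U b1"
    "smooth_on U A0" "smooth_on U A1" "smooth_on U A2" "smooth_on U B0" "smooth_on U B1" "smooth_on U B2"
    "smooth_on U u" "\<And>x. x \<in> U \<Longrightarrow> a0 x * b1 x - a1 x * b0 x \<noteq> 0"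
  shows "smooth_on U (\<lambda>x. law (a0 x) (a1 x) (b0 x) (b1 x) (A0 x) (A1 x) (A2 x) (B0 x) (B1 x) (B2 x) (u x))"
  unfolding law_def by (intro smooth_intros assms smooth_on_open[OF assms(1)])

lemma smooth_on_transformed:
  assumes g: "smooth_on V g" and u: "smooth_on V u" and j: "\<And>z. z \<in> V \<Longrightarrow> jac g z \<noteq> 0"
  shows "smooth_on V (\<lambda>z. transformed g z (u z))"
  unfolding transformed_def
  by (intro smooth_on_law smooth_on_dird smooth_on_vec_nth g u) (use j in \<open>simp add: jac_def\<close>)

lemma point_transformation_image:
  assumes "point_transformation U f"
  shows "smooth_on U f" "inj_on f U" "smooth_on (f ` U) (inv_into U f)" "open U" "open (f ` U)"
  using assms smooth_on_open by (auto simp: point_transformation_def)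

text \<open>The chain rule for \<open>f \<circ> f\<^sup>-\<^sup>1\<close>, with determinants taken.\<close>

lemma jac_inverse:
  assumes f: "point_transformation U f" and x: "x \<in> U"
  shows "jac (inv_into U f) (f x) * jac f x = 1"
proof -
  let ?g = "inv_into U f"
  note F = point_transformation_image[OF f]
  have z: "f x \<in> f ` U" "?g (f x) = x" using x F(2) by auto
  have "partial i (\<lambda>z. ?g z $ 1) (f x) * partial 1 (\<lambda>x. f x $ j) x +
      partial i (\<lambda>z. ?g z $ 2) (f x) * partial 2 (\<lambda>x. f x $ j) x = axis i 1 $ j" for i j
  proof -
    have d: "?g differentiable (at (f x))" "(\<lambda>x. f x $ j) differentiable (at (?g (f x)))"
      using smooth_on_differentiable[OF F(3) z(1)]
        smooth_on_differentiable[OF smooth_on_vec_nth[OF F(1)]] x z by auto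
    have "partial i (\<lambda>z. f (?g z) $ j) (f x) = partial i (\<lambda>z. z $ j) (f x)"
      by (rule dird_cong[OF F(5) z(1)]) (simp add: f_inv_into_f)
    also have "\<dots> = axis i 1 $ j"
      using dird_vec_nth[of "\<lambda>x. x" "f x" "axis i 1" j] by simp
    finally show ?thesis using dird_chain[OF d, of "axis i 1"] z by simp
  qed
  from this[of 1 1] this[of 1 2] this[of 2 1] this[of 2 2] show ?thesis
    unfolding jac_def by simp algebra
qed

lemma jac_nonzero:
  assumes "point_transformation U f"
  shows "x \<in> U \<Longrightarrow> jac f x \<noteq> 0" "z \<in> f ` U \<Longrightarrow> jac (inv_into U f) z \<noteq> 0"
  using jac_inverse[OF assms] by force+

section \<open>Jet bundles and lifts\<close>

lemma section_rep:
  assumes "\<theta> \<in> jet_bundle k"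
  shows "section_near (fst \<theta>) (section_rep k \<theta>)" "sjet k (section_rep k \<theta>) (fst \<theta>) = \<theta>"
proof -
  obtain S p where "\<theta> = sjet k S p" "section_near p S" using assms by (auto simp: jet_bundle_def)
  then have "section_near (fst \<theta>) S \<and> sjet k S (fst \<theta>) = \<theta>" by (simp add: sjet_def)
  then have "section_near (fst \<theta>) (section_rep k \<theta>) \<and> sjet k (section_rep k \<theta>) (fst \<theta>) = \<theta>"
    unfolding section_rep_def by (rule someI[where P = "\<lambda>S. section_near (fst \<theta>) S \<and> sjet k S (fst \<theta>) = \<theta>"])
  then show "section_near (fst \<theta>) (section_rep k \<theta>)" "sjet k (section_rep k \<theta>) (fst \<theta>) = \<theta>" by auto
qed

lemma section_nearE:
  assumes "section_near p S"
  obtains N where "p \<in> N" "smooth_on N S" "\<And>x. x \<in> N \<Longrightarrow> fst (S x) = x" "smooth_on N (\<lambda>x. snd (S x))"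
  using assms smooth_on_snd unfolding section_near_def by blast

lemma section_near_graph:
  assumes "p \<in> N" "smooth_on N u"
  shows "section_near p (\<lambda>x. (x, u x))"
  unfolding section_near_def
  by (rule exI[of _ N]) (use assms smooth_on_open in \<open>auto intro!: smooth_intros\<close>)

lemma jet_bundleI:
  assumes "p \<in> N" "smooth_on N u"
  shows "(p, jet k u p) \<in> jet_bundle k"
  unfolding jet_bundle_def using section_near_graph[OF assms]
  by (auto simp: sjet_def o_def intro!: exI[of _ "\<lambda>x. (x, u x)"])

lemma lift_eq:
  assumes f: "point_transformation U f" and p: "fst \<theta> \<in> U" and S: "section_near (fst \<theta>) (section_rep k \<theta>)"
  shows "lift k U f \<theta> = (f (fst \<theta>), jet k (\<lambda>z. transformed (inv_into U f) z
    (snd (section_rep k \<theta> (inv_into U f z)))) (f (fst \<theta>)))"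
proof -
  let ?S = "section_rep k \<theta>" and ?g = "inv_into U f"
  note F = point_transformation_image[OF f]
  obtain N where N: "fst \<theta> \<in> N" "smooth_on N ?S" "\<And>x. x \<in> N \<Longrightarrow> fst (?S x) = x"
    by (rule section_nearE[OF S], rule that)
  have "open (f ` (U \<inter> N))"
  proof (rule smooth_on_open_image)
    show "smooth_on (U \<inter> N) f" using smooth_on_subset[OF F(1)] F(4) smooth_on_open[OF N(2)] by auto
    show "inj_on f (U \<inter> N)" using F(2) inj_on_subset by blast
  qed
  moreover have "f (fst \<theta>) \<in> f ` (U \<inter> N)" using p N by auto
  moreover have "(snd \<circ> (lift0 U f \<circ> ?S \<circ> ?g)) z = transformed ?g z (snd (?S (?g z)))"
    if zf: "z \<in> f ` (U \<inter> N)" for z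
  proof -
    obtain x where x: "x \<in> U" "x \<in> N" "z = f x" using zf by auto
    have gz: "?g z = x" using x F(2) by simp
    have "?S x = (x, snd (?S x))" using N(3)[OF x(2)] by (simp add: prod_eq_iff)
    then have "lift0 U f (?S x) = (f x, transformed ?g (f x) (snd (?S x)))" by (metis lift0_eq)
    then show ?thesis by (simp add: gz x(3)[symmetric])
  qed
  ultimately have "jet k (snd \<circ> (lift0 U f \<circ> ?S \<circ> ?g)) (f (fst \<theta>)) =
      jet k (\<lambda>z. transformed ?g z (snd (?S (?g z)))) (f (fst \<theta>))"
    by (rule jet_cong)
  then show ?thesis by (simp add: lift_def sjet_def)
qed

text \<open>The transform of a section with vanishing jet differs from the transform of the zero section only
  by multiples of a function that vanishes to the same order.\<close>

lemma jet_transformed_zero: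
  assumes f: "point_transformation U f" and x: "x \<in> U" and u: "smooth_on N u" "x \<in> N" "jet k u x = 0"
  shows "jet k (\<lambda>z. transformed (inv_into U f) z (u (inv_into U f z))) (f x) =
    jet k (\<lambda>z. transformed (inv_into U f) z 0) (f x)"
proof -
  let ?g = "inv_into U f"
  note F = point_transformation_image[OF f]
  define V where "V = f ` (U \<inter> N)"
  have V: "open V" unfolding V_def
  proof (rule smooth_on_open_image)
    show "smooth_on (U \<inter> N) f" using smooth_on_subset[OF F(1)] F(4) smooth_on_open[OF u(1)] by auto
    show "inj_on f (U \<inter> N)" using F(2) inj_on_subset by blast
  qed
  have z: "f x \<in> V" "?g (f x) = x" using x u F(2) by (auto simp: V_def)
  have g: "smooth_on V ?g" "\<And>z. z \<in> V \<Longrightarrow> ?g z \<in> N" "\<And>z. z \<in> V \<Longrightarrow> jac ?g z \<noteq> 0"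
    using smooth_on_subset[OF F(3) V] F(2) jac_nonzero(2)[OF f] by (auto simp: V_def)
  have ug: "smooth_on V (\<lambda>z. u (?g z))" by (rule smooth_on_compose[OF g(1) u(1) g(2)])
  have "vanishes (Suc k) (\<lambda>x. u x $ c) x" for c
    using u(3) jet_eq_iff_vanishes[OF u(1) smooth_on_const[OF smooth_on_open[OF u(1)], of 0] u(2), of k]
    by (simp add: jet_pd fun_eq_iff zero_fun_def split: if_splits)
  then have vu: "vanishes (Suc k) (\<lambda>z. u (?g z) $ c) (f x)" for c
    using vanishes_compose[OF smooth_on_vec_nth[OF u(1)] g(1,2) z(1), of "Suc k" c]
    by (simp only: z(2))
  have su: "smooth_on V (\<lambda>z. u (?g z) $ c)" for c by (rule smooth_on_vec_nth[OF ug])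
  have "vanishes (Suc k) (\<lambda>z. transformed ?g z (u (?g z)) $ c - transformed ?g z 0 $ c) (f x)" for c
  proof -
    let ?t = "\<lambda>b z. transformed ?g z (axis b 1) $ c - transformed ?g z 0 $ c"
    have st: "smooth_on V (?t b)" for b
      by (intro smooth_intros smooth_on_transformed g V)
    have lin: "law a0 a1 b0 b1 A0 A1 A2 B0 B1 B2 w $ c - law a0 a1 b0 b1 A0 A1 A2 B0 B1 B2 0 $ c =
      w $ 0 * (law a0 a1 b0 b1 A0 A1 A2 B0 B1 B2 (axis 0 1) $ c - law a0 a1 b0 b1 A0 A1 A2 B0 B1 B2 0 $ c) +
      (w $ 1 * (law a0 a1 b0 b1 A0 A1 A2 B0 B1 B2 (axis 1 1) $ c - law a0 a1 b0 b1 A0 A1 A2 B0 B1 B2 0 $ c) +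
      (w $ 2 * (law a0 a1 b0 b1 A0 A1 A2 B0 B1 B2 (axis 2 1) $ c - law a0 a1 b0 b1 A0 A1 A2 B0 B1 B2 0 $ c) +
      w $ 3 * (law a0 a1 b0 b1 A0 A1 A2 B0 B1 B2 (axis 3 1) $ c - law a0 a1 b0 b1 A0 A1 A2 B0 B1 B2 0 $ c)))"
      for a0 a1 b0 b1 A0 A1 A2 B0 B1 B2 and w :: "real^4"
    proof -
      have "\<forall>c. law a0 a1 b0 b1 A0 A1 A2 B0 B1 B2 w $ c - law a0 a1 b0 b1 A0 A1 A2 B0 B1 B2 0 $ c =
      w $ 0 * (law a0 a1 b0 b1 A0 A1 A2 B0 B1 B2 (axis 0 1) $ c - law a0 a1 b0 b1 A0 A1 A2 B0 B1 B2 0 $ c) +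
      (w $ 1 * (law a0 a1 b0 b1 A0 A1 A2 B0 B1 B2 (axis 1 1) $ c - law a0 a1 b0 b1 A0 A1 A2 B0 B1 B2 0 $ c) +
      (w $ 2 * (law a0 a1 b0 b1 A0 A1 A2 B0 B1 B2 (axis 2 1) $ c - law a0 a1 b0 b1 A0 A1 A2 B0 B1 B2 0 $ c) +
      w $ 3 * (law a0 a1 b0 b1 A0 A1 A2 B0 B1 B2 (axis 3 1) $ c - law a0 a1 b0 b1 A0 A1 A2 B0 B1 B2 0 $ c)))"
        unfolding forall_index_4 law_def by (simp add: axis_def algebra_simps)
      then show ?thesis by blast
    qed
    have "vanishes (Suc k) (\<lambda>z. u (?g z) $ b * ?t b z) (f x)" for b
      by (rule vanishes_mult[OF su st z(1) vu, where b = 0]) auto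
    then have "vanishes (Suc k) (\<lambda>z. u (?g z) $ 0 * ?t 0 z + (u (?g z) $ 1 * ?t 1 z +
        (u (?g z) $ 2 * ?t 2 z + u (?g z) $ 3 * ?t 3 z))) (f x)"
      by (intro vanishes_add[OF _ _ z(1)] smooth_on_add smooth_on_mult su st)
    moreover have "transformed ?g z (u (?g z)) $ c - transformed ?g z 0 $ c =
        u (?g z) $ 0 * ?t 0 z + (u (?g z) $ 1 * ?t 1 z + (u (?g z) $ 2 * ?t 2 z + u (?g z) $ 3 * ?t 3 z))" for z
      unfolding transformed_def by (rule lin)
    ultimately show ?thesis by (simp only:)
  qed
  then show ?thesis
    using jet_eq_iff_vanishes[OF smooth_on_transformed[OF g(1) ug g(3)]
        smooth_on_transformed[OF g(1) smooth_on_const[OF V] g(3)] z(1), of k 0] by simp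
qed

lemma orbit_zero_section:
  "orbit k (sjet k zero_section 0) =
    {(f 0, jet k (\<lambda>z. transformed (inv_into U f) z 0) (f 0)) | U f. point_transformation U f \<and> 0 \<in> U}"
proof -
  let ?\<theta> = "sjet k zero_section 0"
  have z: "fst ?\<theta> = 0" "snd ?\<theta> = 0"
    by (simp_all add: sjet_def zero_section_def o_def jet_pd fun_eq_iff)
  have "?\<theta> = (0, jet k (\<lambda>x. 0) 0)" by (simp add: sjet_def zero_section_def o_def)
  then have "?\<theta> \<in> jet_bundle k" using jet_bundleI[OF _ smooth_on_const[OF open_UNIV, of 0], of 0 k] by simp
  note S = section_rep[OF this, unfolded z]
  obtain N where N: "0 \<in> N" "smooth_on N (\<lambda>x. snd (section_rep k ?\<theta> x))"
    by (rule section_nearE[OF S(1)], rule that)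
  have "snd (sjet k (section_rep k ?\<theta>) 0) = 0" by (simp only: S(2) z)
  then have "jet k (\<lambda>x. snd (section_rep k ?\<theta> x)) 0 = 0" by (simp add: sjet_def o_def)
  then have "lift k U f ?\<theta> = (f 0, jet k (\<lambda>z. transformed (inv_into U f) z 0) (f 0))"
    if "point_transformation U f" "0 \<in> U" for U f
    using lift_eq[OF that(1), of ?\<theta> k] jet_transformed_zero[OF that N(2,1)] that S(1) z by simp
  then show ?thesis unfolding orbit_def z by (auto; metis)
qed

section \<open>The velocity of a lifted flow\<close>

text \<open>The terms of first and of second order in the infinitesimal transformation law below; their
  arguments are the first, respectively second, partial derivatives of a vector field.\<close>

definition twist :: "real^4 \<Rightarrow> point \<Rightarrow> point \<Rightarrow> real^4"
  where "twist u P Q = (P $ 1 + Q $ 2) *\<^sub>R u - vec4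
    (3 * u $ 0 * P $ 1 + u $ 1 * P $ 2)
    (3 * u $ 0 * Q $ 1 + u $ 1 * (2 * P $ 1 + Q $ 2) + 2 * u $ 2 * P $ 2)
    (2 * u $ 1 * Q $ 1 + u $ 2 * (P $ 1 + 2 * Q $ 2) + 3 * u $ 3 * P $ 2)
    (u $ 2 * Q $ 1 + 3 * u $ 3 * Q $ 2)"

definition thomas :: "point \<Rightarrow> point \<Rightarrow> point \<Rightarrow> real^4"
  where "thomas P Q R = vec4 (P $ 2) (2 * Q $ 2 - P $ 1) (R $ 2 - 2 * Q $ 1) (- R $ 1)"

definition inf_law :: "(point \<Rightarrow> point) \<Rightarrow> (point \<Rightarrow> real^4) \<Rightarrow> point \<Rightarrow> real^4"
  where "inf_law X u x = twist (u x) (partial 1 X x) (partial 2 X x) +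
    thomas (partial 1 (partial 1 X) x) (partial 1 (partial 2 X) x) (partial 2 (partial 2 X) x)"

lemma has_vector_derivative_vec4:
  assumes "(c0 has_real_derivative d0) (at t)" "(c1 has_real_derivative d1) (at t)"
    "(c2 has_real_derivative d2) (at t)" "(c3 has_real_derivative d3) (at t)"
  shows "((\<lambda>t. vec4 (c0 t) (c1 t) (c2 t) (c3 t)) has_vector_derivative vec4 d0 d1 d2 d3) (at t)"
proof -
  have e: "vec4 a b c d = a *\<^sub>R axis 0 1 + b *\<^sub>R axis 1 1 + c *\<^sub>R axis 2 1 + d *\<^sub>R axis 3 1" for a b c d
    by (simp add: vec4_eq_iff axis_def)
  show ?thesis unfolding e
    using assms by (auto intro!: derivative_eq_intros simp: has_real_derivative_iff_has_vector_derivative)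
qed

text \<open>The derivative of the transformation law at the identity.\<close>

lemma law_has_vector_derivative:
  fixes P Q :: point
  assumes "(a0 has_real_derivative - P $ 1) (at t)" "(a1 has_real_derivative - Q $ 1) (at t)"
    "(b0 has_real_derivative - P $ 2) (at t)" "(b1 has_real_derivative - Q $ 2) (at t)"
    "(A0 has_real_derivative - P' $ 1) (at t)" "(A1 has_real_derivative - Q' $ 1) (at t)"
    "(A2 has_real_derivative - R' $ 1) (at t)"
    "(B0 has_real_derivative - P' $ 2) (at t)" "(B1 has_real_derivative - Q' $ 2) (at t)"
    "(B2 has_real_derivative - R' $ 2) (at t)"
    and "a0 t = 1" "a1 t = 0" "b0 t = 0" "b1 t = 1" "A0 t = 0" "A1 t = 0" "A2 t = 0" "B0 t = 0" "B1 t = 0" "B2 t = 0"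
  shows "((\<lambda>t. law (a0 t) (a1 t) (b0 t) (b1 t) (A0 t) (A1 t) (A2 t) (B0 t) (B1 t) (B2 t) u)
    has_vector_derivative twist u P Q + thomas P' Q' R') (at t)"
proof -
  have 1: "((\<lambda>t. inverse (a0 t * b1 t - a1 t * b0 t)) has_real_derivative P $ 1 + Q $ 2) (at t)"
    using assms by (auto intro!: derivative_eq_intros)
  have c0: "((\<lambda>t. u $ 0 * a0 t ^ 3 + u $ 1 * ((a0 t)\<^sup>2 * b0 t) + u $ 2 * (a0 t * (b0 t)\<^sup>2) + u $ 3 * b0 t ^ 3
        + (b0 t * A0 t - a0 t * B0 t))
      has_real_derivative - 3 * u $ 0 * P $ 1 - u $ 1 * P $ 2 + P' $ 2) (at t)"
    by (rule derivative_eq_intros refl assms(1-10))+ (simp add: assms(11-))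
  have c1: "((\<lambda>t. u $ 0 * (3 * (a0 t)\<^sup>2 * a1 t) + u $ 1 * (2 * a0 t * a1 t * b0 t + (a0 t)\<^sup>2 * b1 t)
        + u $ 2 * (a1 t * (b0 t)\<^sup>2 + 2 * a0 t * b0 t * b1 t) + u $ 3 * (3 * (b0 t)\<^sup>2 * b1 t)
        + (2 * b0 t * A1 t + b1 t * A0 t - 2 * a0 t * B1 t - a1 t * B0 t))
      has_real_derivative - 3 * u $ 0 * Q $ 1 - u $ 1 * (2 * P $ 1 + Q $ 2) - 2 * u $ 2 * P $ 2
        - P' $ 1 + 2 * Q' $ 2) (at t)"
    by (rule derivative_eq_intros refl assms(1-10))+ (simp add: assms(11-) algebra_simps)
  have c2: "((\<lambda>t. u $ 0 * (3 * a0 t * (a1 t)\<^sup>2) + u $ 1 * ((a1 t)\<^sup>2 * b0 t + 2 * a0 t * a1 t * b1 t)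
        + u $ 2 * (2 * a1 t * b0 t * b1 t + a0 t * (b1 t)\<^sup>2) + u $ 3 * (3 * b0 t * (b1 t)\<^sup>2)
        + (b0 t * A2 t + 2 * b1 t * A1 t - a0 t * B2 t - 2 * a1 t * B1 t))
      has_real_derivative - 2 * u $ 1 * Q $ 1 - u $ 2 * (P $ 1 + 2 * Q $ 2) - 3 * u $ 3 * P $ 2
        + R' $ 2 - 2 * Q' $ 1) (at t)"
    by (rule derivative_eq_intros refl assms(1-10))+ (simp add: assms(11-) algebra_simps)
  have c3: "((\<lambda>t. u $ 0 * a1 t ^ 3 + u $ 1 * ((a1 t)\<^sup>2 * b1 t) + u $ 2 * (a1 t * (b1 t)\<^sup>2) + u $ 3 * b1 t ^ 3
        + (b1 t * A2 t - a1 t * B2 t))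
      has_real_derivative - u $ 2 * Q $ 1 - 3 * u $ 3 * Q $ 2 - R' $ 1) (at t)"
    by (rule derivative_eq_intros refl assms(1-10))+ (simp add: assms(11-))
  show ?thesis
    unfolding law_def
    by (rule has_vector_derivative_eq_rhs[OF has_vector_derivative_scaleR
          [OF 1 has_vector_derivative_vec4[OF c0 c1 c2 c3]]])
      (simp add: assms(11-) vec4_eq_iff twist_def thomas_def)
qed

lemma velocity_unique:
  assumes "velocity \<gamma> \<xi>" "velocity \<gamma> \<eta>"
  shows "\<xi> = \<eta>"
proof (intro prod_eqI ext)
  show "fst \<xi> = fst \<eta>"
    using assms unfolding velocity_def by (elim conjE) (rule vector_derivative_unique_at)
  have "((\<lambda>t. snd (\<gamma> t) i j) has_vector_derivative snd \<xi> i j) (at 0)"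
    "((\<lambda>t. snd (\<gamma> t) i j) has_vector_derivative snd \<eta> i j) (at 0)" for i j
    using assms unfolding velocity_def by auto
  then show "snd \<xi> i j = snd \<eta> i j" for i j by (rule vector_derivative_unique_at)
qed

abbreviation dt :: "(real \<times> point \<Rightarrow> 'b::real_normed_vector) \<Rightarrow> real \<times> point \<Rightarrow> 'b"
  where "dt \<equiv> dird (1, 0)"

abbreviation dx :: "2 \<Rightarrow> (real \<times> point \<Rightarrow> 'b::real_normed_vector) \<Rightarrow> real \<times> point \<Rightarrow> 'b"
  where "dx i \<equiv> dird (0, axis i 1)"

lemma partial_slice:
  assumes "smooth_on D h" "(t, x) \<in> D"
  shows "partial i (\<lambda>y. h (t, y)) x = dx i h (t, x)"
proof -
  have d: "((\<lambda>y. (t, y)) has_derivative (\<lambda>v. (0, v))) (at x)"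
    by (auto intro!: derivative_eq_intros)
  show ?thesis
    by (rule dird_eq[OF has_derivative_compose[OF d smooth_on_has_derivative[OF assms]]])
qed

lemma has_vector_derivative_slice:
  assumes "smooth_on D h" "(t, x) \<in> D"
  shows "((\<lambda>s. h (s, x)) has_vector_derivative dt h (t, x)) (at t)"
proof -
  have "((\<lambda>s. (s, x)) has_derivative (\<lambda>s. (s, 0))) (at t)"
    by (auto intro!: derivative_eq_intros)
  from has_derivative_compose[OF this smooth_on_has_derivative[OF assms]]
  have "((\<lambda>s. h (s, x)) has_derivative (\<lambda>s. dird (s, 0) h (t, x))) (at t)" .
  moreover have "(\<lambda>s. dird (s, 0) h (t, x)) = (\<lambda>s. s *\<^sub>R dt h (t, x))"
  proof
    show "dird (s, 0) h (t, x) = s *\<^sub>R dt h (t, x)" for s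
    using linear_scale[OF linear_frechet_derivative[OF smooth_on_differentiable[OF assms]], of s "(1, 0)"]
    by (simp add: dird_def)
  qed
  ultimately show ?thesis by (simp only: has_vector_derivative_def)
qed

text \<open>Only the following data of a local flow enter the computation of the lifted velocity at time 0.\<close>

locale flow_at_0 =
  fixes \<epsilon> :: real and U :: "point set" and \<phi> :: "real \<Rightarrow> point \<Rightarrow> point" and X :: "point \<Rightarrow> point"
  assumes eps: "\<epsilon> > 0"
    and smooth_flow: "smooth_on ({-\<epsilon><..<\<epsilon>} \<times> U) (\<lambda>(t, x). \<phi> t x)"
    and flow_0: "x \<in> U \<Longrightarrow> \<phi> 0 x = x"
    and flow_pt: "t \<in> {-\<epsilon><..<\<epsilon>} \<Longrightarrow> point_transformation U (\<phi> t)"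
    and flow_deriv: "x \<in> U \<Longrightarrow> ((\<lambda>t. \<phi> t x) has_vector_derivative X x) (at 0)"
    and smooth_X: "smooth_on U X"
begin

abbreviation I where "I \<equiv> {-\<epsilon><..<\<epsilon>}"

lemma zero_I [simp]: "0 \<in> I"
  using eps by simp

lemma open_U: "open U"
  by (rule smooth_on_open[OF smooth_X])

text \<open>A lifted flow involves the inverses of the maps \<open>\<phi>\<^sub>t\<close>. To avoid differentiating these in \<open>t\<close>, all
  functions of \<open>z = \<phi>\<^sub>t x\<close> are pulled back to functions of \<open>(t, x)\<close>, where they become rational
  expressions in the derivatives of the flow itself.\<close>

definition F :: "2 \<Rightarrow> real \<times> point \<Rightarrow> real"
  where "F i q = \<phi> (fst q) (snd q) $ i"

lemma smooth_F: "smooth_on (I \<times> U) (F i)"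
  unfolding F_def using smooth_on_vec_nth[OF smooth_flow, of i] by (simp add: case_prod_beta)

definition Delta :: "real \<times> point \<Rightarrow> real"
  where "Delta q = dx 1 (F 1) q * dx 2 (F 2) q - dx 2 (F 1) q * dx 1 (F 2) q"

lemma dx_F: "q \<in> I \<times> U \<Longrightarrow> dx j (F i) q = partial j (\<lambda>y. \<phi> (fst q) y $ i) (snd q)"
  using partial_slice[OF smooth_F, of "fst q" "snd q" j i] by (simp add: F_def)

lemma Delta_jac: "q \<in> I \<times> U \<Longrightarrow> Delta q = jac (\<phi> (fst q)) (snd q)"
  by (simp add: Delta_def jac_def dx_F)

lemma Delta_nonzero: "q \<in> I \<times> U \<Longrightarrow> Delta q \<noteq> 0"
  using jac_nonzero(1)[OF flow_pt] by (auto simp: Delta_jac)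

text \<open>The derivative \<open>\<partial>g\<^sup>i/\<partial>z\<^sup>j\<close> of the inverse \<open>g\<close> of \<open>\<phi>\<^sub>t\<close>, pulled back by \<open>\<phi>\<^sub>t\<close>.\<close>

definition G :: "2 \<Rightarrow> 2 \<Rightarrow> real \<times> point \<Rightarrow> real"
  where "G i j q = (if i = j then dx (if i = 1 then 2 else 1) (F (if i = 1 then 2 else 1)) q
    else - dx j (F i) q) * inverse (Delta q)"

lemma smooth_G: "smooth_on (I \<times> U) (G i j)"
proof -
  have "smooth_on (I \<times> U) (\<lambda>q. inverse (Delta q))"
    unfolding Delta_def using Delta_nonzero
    by (intro smooth_intros smooth_on_dird smooth_F) (simp add: Delta_def)
  moreover have "smooth_on (I \<times> U) (\<lambda>q. if i = j then dx (if i = 1 then 2 else 1) (F (if i = 1 then 2 else 1)) q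
    else - dx j (F i) q)"
    by (cases "i = j") (auto intro!: smooth_intros smooth_on_dird smooth_F)
  ultimately show ?thesis unfolding G_def by (rule smooth_on_mult[rotated])
qed

text \<open>The derivative \<open>\<partial>/\<partial>z\<^sup>m\<close> pulled back by \<open>\<phi>\<^sub>t\<close>.\<close>

definition dz :: "2 \<Rightarrow> (real \<times> point \<Rightarrow> 'b::real_normed_vector) \<Rightarrow> real \<times> point \<Rightarrow> 'b"
  where "dz m h q = G 1 m q *\<^sub>R dx 1 h q + G 2 m q *\<^sub>R dx 2 h q"

lemma smooth_dz:
  assumes "smooth_on (I \<times> T) h" "open T" "T \<subseteq> U"
  shows "smooth_on (I \<times> T) (dz m h)"
proof -
  have "smooth_on (I \<times> T) (G i m)" for i
    by (rule smooth_on_subset[OF smooth_G]) (use assms in \<open>auto intro: open_Times\<close>)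
  then show ?thesis unfolding dz_def by (intro smooth_intros smooth_on_dird assms)
qed

lemma partial_inverse:
  assumes t: "t \<in> I" and x: "x \<in> U"
  shows "partial j (\<lambda>z. inv_into U (\<phi> t) z $ i) (\<phi> t x) = G i j (t, x)"
proof -
  note P = point_transformation_image[OF flow_pt[OF t]]
  have "(inv_into U (\<phi> t) has_derivative inverse_diff (\<phi> t) x) (at (\<phi> t x))"
    by (rule inverse_has_derivative[OF P(1,2) jac_nonzero(1)[OF flow_pt[OF t] x] x])
  from dird_eq[OF this] have "dird (axis j 1) (inv_into U (\<phi> t)) (\<phi> t x) = inverse_diff (\<phi> t) x (axis j 1)" .
  moreover have "inv_into U (\<phi> t) differentiable (at (\<phi> t x))"
    using smooth_on_differentiable[OF P(3)] x by blast
  ultimately have "partial j (\<lambda>z. inv_into U (\<phi> t) z $ i) (\<phi> t x) = inverse_diff (\<phi> t) x (axis j 1) $ i"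
    using dird_vec_nth by metis
  also have "\<dots> = G i j (t, x)"
    using exhaust_2[of i] exhaust_2[of j] t x
    by (elim disjE) (simp_all add: inverse_diff_def G_def Delta_jac dx_F)
  finally show ?thesis .
qed

lemma partial_pullback:
  assumes t: "t \<in> I" and T: "open T" "T \<subseteq> U" and h: "smooth_on (I \<times> T) h"
    and eq: "\<And>x. x \<in> T \<Longrightarrow> k (\<phi> t x) = h (t, x)" and x: "x \<in> T"
  shows "partial m k (\<phi> t x) = dz m h (t, x)"
proof -
  note P = point_transformation_image[OF flow_pt[OF t]]
  let ?g = "inv_into U (\<phi> t)"
  have g: "?g (\<phi> t y) = y" if "y \<in> T" for y using that T P(2) by auto
  have op: "open (\<phi> t ` T)"
    by (rule smooth_on_open_image[OF smooth_on_subset[OF P(1) T] inj_on_subset[OF P(2) T(2)]])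
  have "partial m k (\<phi> t x) = partial m (\<lambda>z. h (t, ?g z)) (\<phi> t x)"
    by (rule dird_cong[OF op]) (use x eq g in auto)
  also have "\<dots> = partial m (\<lambda>z. ?g z $ 1) (\<phi> t x) *\<^sub>R partial 1 (\<lambda>y. h (t, y)) (?g (\<phi> t x)) +
      partial m (\<lambda>z. ?g z $ 2) (\<phi> t x) *\<^sub>R partial 2 (\<lambda>y. h (t, y)) (?g (\<phi> t x))"
  proof (rule dird_chain)
    show "?g differentiable (at (\<phi> t x))" using smooth_on_differentiable[OF P(3)] x T by blast
    have "smooth_on T (\<lambda>y. h (t, y))"
      by (rule smooth_on_compose[OF _ h]) (use t T in \<open>auto intro!: smooth_intros\<close>)
    then show "(\<lambda>y. h (t, y)) differentiable (at (?g (\<phi> t x)))"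
      using smooth_on_differentiable g x by metis
  qed
  also have "\<dots> = dz m h (t, x)"
    using x t T partial_slice[OF h, of t x] partial_inverse[OF t, of x]
    by (simp add: g dz_def subset_iff)
  finally show ?thesis .
qed

text \<open>The transformed coefficients at \<open>\<phi>\<^sub>t x\<close>, as a function of \<open>(t, x)\<close>.\<close>

definition Fhat :: "(point \<Rightarrow> real^4) \<Rightarrow> real \<times> point \<Rightarrow> real^4"
  where "Fhat u q = law (G 1 1 q) (G 1 2 q) (G 2 1 q) (G 2 2 q)
    (dz 1 (G 1 1) q) (dz 1 (G 1 2) q) (dz 2 (G 1 2) q)
    (dz 1 (G 2 1) q) (dz 1 (G 2 2) q) (dz 2 (G 2 2) q) (u (snd q))"

lemma transformed_flow:
  assumes t: "t \<in> I" and x: "x \<in> U"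
  shows "transformed (inv_into U (\<phi> t)) (\<phi> t x) (u x) = Fhat u (t, x)"
proof -
  have "partial k (partial j (\<lambda>z. inv_into U (\<phi> t) z $ i)) (\<phi> t x) = dz k (G i j) (t, x)" for i j k
    by (rule partial_pullback[OF t open_U order_refl smooth_G partial_inverse[OF t] x])
  then show ?thesis
    unfolding transformed_def Fhat_def by (simp add: partial_inverse[OF t x])
qed

lemma det_G: "q \<in> I \<times> U \<Longrightarrow> G 1 1 q * G 2 2 q - G 1 2 q * G 2 1 q \<noteq> 0"
proof -
  assume q: "q \<in> I \<times> U"
  have "G 1 1 q * G 2 2 q - G 1 2 q * G 2 1 q = Delta q * i * i" if "i = inverse (Delta q)" for i
    unfolding G_def that[symmetric] by (simp add: Delta_def algebra_simps)
  then show ?thesis using Delta_nonzero[OF q] by simp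
qed

lemma smooth_Fhat:
  assumes u: "smooth_on T u" and T: "T \<subseteq> U"
  shows "smooth_on (I \<times> T) (Fhat u)"
proof -
  have op: "open (I \<times> T)" using smooth_on_open[OF u] by (auto intro: open_Times)
  have sub: "I \<times> T \<subseteq> I \<times> U" using T by auto
  have su: "smooth_on (I \<times> T) (\<lambda>q. u (snd q))"
    by (rule smooth_on_compose[OF _ u]) (use op in \<open>auto intro!: smooth_intros\<close>)
  show ?thesis
    unfolding Fhat_def
    by (intro smooth_on_law su smooth_on_subset[OF smooth_G op sub]
        smooth_on_subset[OF smooth_dz[OF smooth_G open_U order_refl] op sub])
      (rule det_G, use sub in blast)
qed

text \<open>Initial values and velocities of the functions above. The mixed derivatives \<open>\<partial>\<^sub>t\<partial>\<^sub>x\<close> are obtained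
  as \<open>\<partial>\<^sub>x\<partial>\<^sub>t\<close>.\<close>

lemma dz_at_0:
  fixes h :: "real \<times> point \<Rightarrow> 'b::euclidean_space"
  assumes T: "open T" "T \<subseteq> U" and h: "smooth_on (I \<times> T) h" and x: "x \<in> T"
    and G0: "\<And>i j. G i j (0, x) = (if i = j then 1 else 0)"
    and G1: "\<And>i j. dt (G i j) (0, x) = - partial j (\<lambda>x. X x $ i) x"
    and k0: "\<And>y. y \<in> T \<Longrightarrow> h (0, y) = k0 y" and k1: "\<And>y. y \<in> T \<Longrightarrow> dt h (0, y) = k1 y"
  shows "dz m h (0, x) = partial m k0 x"
    and "dt (dz m h) (0, x) = partial m k1 x - partial m (\<lambda>x. X x $ 1) x *\<^sub>R partial 1 k0 x
      - partial m (\<lambda>x. X x $ 2) x *\<^sub>R partial 2 k0 x"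
proof -
  have q: "(0, x) \<in> I \<times> T" "(0, x) \<in> I \<times> U" using x T eps by auto
  have v: "dx l h (0, x) = partial l k0 x" for l
    unfolding partial_slice[OF h q(1), symmetric] by (rule dird_cong[OF T(1) x]) (rule k0)
  have w: "dt (dx l h) (0, x) = partial l k1 x" for l
  proof -
    have "dt (dx l h) (0, x) = dx l (dt h) (0, x)" by (rule dird_commute[OF h q(1)])
    also have "\<dots> = partial l (\<lambda>y. dt h (0, y)) x" by (rule partial_slice[OF smooth_on_dird[OF h] q(1), symmetric])
    also have "\<dots> = partial l k1 x" by (rule dird_cong[OF T(1) x]) (rule k1)
    finally show ?thesis .
  qed
  show "dz m h (0, x) = partial m k0 x"
    using exhaust_2[of m] by (auto simp: dz_def G0 v)
  have dG: "G l m differentiable (at (0, x))" for l by (rule smooth_on_differentiable[OF smooth_G q(2)])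
  have dh: "dx l h differentiable (at (0, x))" for l
    by (rule smooth_on_differentiable[OF smooth_on_dird[OF h] q(1)])
  have "dt (dz m h) (0, x) = (G 1 m (0, x) *\<^sub>R dt (dx 1 h) (0, x) + dt (G 1 m) (0, x) *\<^sub>R dx 1 h (0, x)) +
      (G 2 m (0, x) *\<^sub>R dt (dx 2 h) (0, x) + dt (G 2 m) (0, x) *\<^sub>R dx 2 h (0, x))"
    unfolding dz_def
    by (subst dird_add) (auto intro!: differentiable_scaleR dG dh simp: dird_scaleR[OF dG dh])
  then show "dt (dz m h) (0, x) = partial m k1 x - partial m (\<lambda>x. X x $ 1) x *\<^sub>R partial 1 k0 x
      - partial m (\<lambda>x. X x $ 2) x *\<^sub>R partial 2 k0 x"
    using exhaust_2[of m] by (auto simp: G0 G1 v w)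
qed

lemma F_at_0:
  assumes x: "x \<in> U"
  shows "dx j (F i) (0, x) = (if i = j then 1 else 0)"
    and "dt (dx j (F i)) (0, x) = partial j (\<lambda>x. X x $ i) x"
proof -
  have q: "(0, y) \<in> I \<times> U" if "y \<in> U" for y using that eps by auto
  have "dx j (F i) (0, x) = partial j (\<lambda>y. y $ i) x"
    unfolding partial_slice[OF smooth_F q[OF x], symmetric]
    by (rule dird_cong[OF open_U x]) (simp add: F_def flow_0)
  also have "\<dots> = axis j 1 $ i" using dird_vec_nth[of "\<lambda>x. x" x "axis j 1" i] by simp
  finally show "dx j (F i) (0, x) = (if i = j then 1 else 0)" by (auto simp: axis_def)
  have dtF: "dt (F i) (0, y) = X y $ i" if y: "y \<in> U" for y
  proof (rule vector_derivative_unique_at[OF has_vector_derivative_slice[OF smooth_F q[OF y]]])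
    show "((\<lambda>s. F i (s, y)) has_vector_derivative X y $ i) (at 0)"
      unfolding F_def
      using bounded_linear.has_vector_derivative[OF bounded_linear_vec_nth flow_deriv[OF y]] by simp
  qed
  have "dt (dx j (F i)) (0, x) = dx j (dt (F i)) (0, x)" by (rule dird_commute[OF smooth_F q[OF x]])
  also have "\<dots> = partial j (\<lambda>y. dt (F i) (0, y)) x"
    by (rule partial_slice[OF smooth_on_dird[OF smooth_F] q[OF x], symmetric])
  also have "\<dots> = partial j (\<lambda>x. X x $ i) x" by (rule dird_cong[OF open_U x]) (rule dtF)
  finally show "dt (dx j (F i)) (0, x) = partial j (\<lambda>x. X x $ i) x" .
qed

lemma G_at_0:
  assumes x: "x \<in> U"
  shows "G i j (0, x) = (if i = j then 1 else 0)"
    and "dt (G i j) (0, x) = - partial j (\<lambda>x. X x $ i) x"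
proof -
  have q: "(0, x) \<in> I \<times> U" using x eps by auto
  have der: "((\<lambda>s. dx j (F i) (s, x)) has_real_derivative partial j (\<lambda>x. X x $ i) x) (at 0)" for i j
    using has_vector_derivative_slice[OF smooth_on_dird[OF smooth_F[of i], of "(0, axis j 1)"] q]
    by (simp add: F_at_0(2)[OF x] has_real_derivative_iff_has_vector_derivative)
  note v = F_at_0(1)[OF x]
  show "G i j (0, x) = (if i = j then 1 else 0)"
    using exhaust_2[of i] exhaust_2[of j] by (elim disjE) (simp_all add: G_def Delta_def v)
  have "((\<lambda>s. G i j (s, x)) has_real_derivative - partial j (\<lambda>x. X x $ i) x) (at 0)"
    using exhaust_2[of i] exhaust_2[of j] unfolding G_def Delta_def
    by (elim disjE) (auto intro!: derivative_eq_intros der simp: v)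
  then show "dt (G i j) (0, x) = - partial j (\<lambda>x. X x $ i) x"
    using vector_derivative_unique_at[OF has_vector_derivative_slice[OF smooth_G q]]
    by (simp only: has_real_derivative_iff_has_vector_derivative)
qed

lemma dz_G_at_0:
  assumes x: "x \<in> U"
  shows "dz k (G i j) (0, x) = 0"
    and "dt (dz k (G i j)) (0, x) = - partial k (partial j (\<lambda>x. X x $ i)) x"
proof -
  note * = dz_at_0[OF open_U order_refl smooth_G[of i j] x G_at_0[OF x], where ?m = k
      and ?k0.0 = "\<lambda>_. if i = j then 1 else 0" and ?k1.0 = "\<lambda>y. - partial j (\<lambda>x. X x $ i) y", OF G_at_0]
  show "dz k (G i j) (0, x) = 0" using *(1) by simp
  have sX: "smooth_on U (partial j (\<lambda>x. X x $ i))" by (intro smooth_on_dird smooth_intros smooth_X)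
  have "dird v (\<lambda>x. - h x) x = - dird v h x" if "h differentiable (at x)" for h :: "point \<Rightarrow> real" and v x
    by (rule dird_eq[OF has_derivative_minus[OF has_dird[OF that]]])
  from this[OF smooth_on_differentiable[OF sX x]]
  show "dt (dz k (G i j)) (0, x) = - partial k (partial j (\<lambda>x. X x $ i)) x"
    using *(2) by simp
qed

lemma Fhat_at_0:
  assumes u: "smooth_on T u" and T: "T \<subseteq> U" and x: "x \<in> T"
  shows "Fhat u (0, x) = u x" and "dt (Fhat u) (0, x) = inf_law X u x"
proof -
  have xU: "x \<in> U" using x T by auto
  have q: "(0, x) \<in> I \<times> U" "(0, x) \<in> I \<times> T" using xU x eps by auto
  show "Fhat u (0, x) = u x"
    by (simp add: Fhat_def G_at_0[OF xU] dz_G_at_0[OF xU] law_def vec4_eq_iff)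
  have c: "partial j (\<lambda>x. X x $ i) y = partial j X y $ i" if "y \<in> U" for i j y
    by (rule dird_vec_nth[OF smooth_on_differentiable[OF smooth_X that]])
  have c2: "partial k (partial j (\<lambda>x. X x $ i)) x = partial k (partial j X) x $ i" for i j k
  proof -
    have "partial k (partial j (\<lambda>x. X x $ i)) x = partial k (\<lambda>x. partial j X x $ i) x"
      by (rule dird_cong[OF open_U xU]) (rule c)
    also have "\<dots> = partial k (partial j X) x $ i"
      by (rule dird_vec_nth[OF smooth_on_differentiable[OF smooth_on_dird[OF smooth_X] xU]])
    finally show ?thesis .
  qed
  have dG: "((\<lambda>s. G i j (s, x)) has_real_derivative - partial j X x $ i) (at 0)" for i j
    using has_vector_derivative_slice[OF smooth_G q(1), of i j]
    by (simp add: G_at_0[OF xU] c[OF xU] has_real_derivative_iff_has_vector_derivative)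
  have ddG: "((\<lambda>s. dz k (G i j) (s, x)) has_real_derivative - partial k (partial j X) x $ i) (at 0)" for i j k
    using has_vector_derivative_slice[OF smooth_dz[OF smooth_G open_U order_refl] q(1), of k i j]
    by (simp add: dz_G_at_0[OF xU] c2 has_real_derivative_iff_has_vector_derivative)
  have "((\<lambda>s. Fhat u (s, x)) has_vector_derivative inf_law X u x) (at 0)"
    unfolding Fhat_def inf_law_def snd_conv
    by (rule law_has_vector_derivative) (auto simp: G_at_0[OF xU] dz_G_at_0[OF xU] intro: dG ddG)
  then show "dt (Fhat u) (0, x) = inf_law X u x"
    by (rule vector_derivative_unique_at[OF has_vector_derivative_slice[OF smooth_Fhat[OF u T] q(2)]])
qed

end

lemma has_vector_derivative_line:
  fixes h :: "point \<Rightarrow> 'b::real_normed_vector"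
  assumes "smooth_on N h" "p \<in> N"
  shows "((\<lambda>t. h (p + t *\<^sub>R w)) has_vector_derivative w $ 1 *\<^sub>R partial 1 h p + w $ 2 *\<^sub>R partial 2 h p) (at 0)"
  using has_vector_derivative_dird[of N h p 0 w] assms dird_axis[OF smooth_on_differentiable[OF assms], of w]
  by simp

context flow_at_0
begin

text \<open>The value of the jet moves along with the base point \<open>\<phi>\<^sub>t p\<close>, which accounts for the two correction
  terms in the derivative of a first-order coordinate.\<close>

lemma flow_velocity:
  assumes p: "fst \<theta> \<in> U" and S: "section_near (fst \<theta>) (section_rep k \<theta>)" and k: "k \<le> 1"
    and u: "u = (\<lambda>x. snd (section_rep k \<theta> x))"
    and first_def: "first = (\<lambda>m. partial m (inf_law X u) (fst \<theta>)
      - partial m (\<lambda>x. X x $ 1) (fst \<theta>) *\<^sub>R partial 1 u (fst \<theta>)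
      - partial m (\<lambda>x. X x $ 2) (fst \<theta>) *\<^sub>R partial 2 u (fst \<theta>))"
  shows "velocity (\<lambda>t. lift k U (\<phi> t) \<theta>) (X (fst \<theta>),
    \<lambda>i j. if i + j \<le> k then (if i = 1 then first 1 else if j = 1 then first 2 else inf_law X u (fst \<theta>)) else 0)"
proof -
  let ?p = "fst \<theta>"
  obtain N where N: "?p \<in> N" "smooth_on N u" 
    by (rule section_nearE[OF S], rule that) (simp_all add: u)
  define T where "T = U \<inter> N"
  have T: "open T" "T \<subseteq> U" "?p \<in> T" using open_U smooth_on_open[OF N(2)] p N(1) by (auto simp: T_def)
  have uT: "smooth_on T u" by (rule smooth_on_subset[OF N(2) T(1)]) (simp add: T_def)
  note sF = smooth_Fhat[OF uT T(2)]
  define K where "K = (\<lambda>t z. transformed (inv_into U (\<phi> t)) z (u (inv_into U (\<phi> t) z)))"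
  have lift: "lift k U (\<phi> t) \<theta> = (\<phi> t ?p, jet k (K t) (\<phi> t ?p))" if "t \<in> I" for t
    unfolding lift_eq[OF flow_pt[OF that] p S] K_def u ..
  have K: "K t (\<phi> t x) = Fhat u (t, x)" if "t \<in> I" "x \<in> T" for t x
  proof -
    have "inv_into U (\<phi> t) (\<phi> t x) = x"
      using that T point_transformation_image(2)[OF flow_pt[OF that(1)]] by auto
    then show ?thesis using transformed_flow[OF that(1), of x u] that(2) T by (auto simp: K_def)
  qed
  have dK: "partial m (K t) (\<phi> t ?p) = dz m (Fhat u) (t, ?p)" if "t \<in> I" for m t
    by (rule partial_pullback[OF that T(1,2) sF K[OF that] T(3)])
  have q: "(0, ?p) \<in> I \<times> T" using T eps by auto
  have dd: "dt (dz m (Fhat u)) (0, ?p) = first m" for m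
    unfolding first_def
    by (rule dz_at_0(2)[OF T(1,2) sF T(3) G_at_0[OF p] Fhat_at_0[OF uT T(2)]])
  have tr: "(f has_vector_derivative d) (at 0)"
    if "(g has_vector_derivative d) (at 0)" "\<And>t. t \<in> I \<Longrightarrow> f t = g t" for f g :: "real \<Rightarrow> real^4" and d
    by (rule has_vector_derivative_transform_within_open[OF that(1) _ zero_I]) (use that(2) in auto)
  have 0: "((\<lambda>t. Fhat u (t, ?p)) has_vector_derivative inf_law X u ?p) (at 0)"
    using has_vector_derivative_slice[OF sF q] Fhat_at_0(2)[OF uT T(2,3)] by simp
  have 1: "((\<lambda>t. dz m (Fhat u) (t, ?p)) has_vector_derivative first m) (at 0)" for m
    using has_vector_derivative_slice[OF smooth_dz[OF sF T(1,2)] q, of m] by (simp only: dd)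
  show ?thesis
    unfolding velocity_def fst_conv snd_conv
  proof (intro conjI allI)
    show "((\<lambda>t. fst (lift k U (\<phi> t) \<theta>)) has_vector_derivative X ?p) (at 0)"
      by (rule has_vector_derivative_transform_within_open[OF flow_deriv[OF p] _ zero_I]) (auto simp: lift)
    fix i j :: nat
    have "i + j \<le> 1 \<Longrightarrow> (i = 0 \<and> j = 0) \<or> (i = 1 \<and> j = 0) \<or> (i = 0 \<and> j = 1)" by arith
    then consider "i + j > k" | "i + j \<le> k" "i = 0" "j = 0" | "i + j \<le> k" "i = 1" "j = 0" | "i + j \<le> k" "i = 0" "j = 1"
      using k by (metis le_trans not_less)
    then show "((\<lambda>t. snd (lift k U (\<phi> t) \<theta>) i j) has_vector_derivative
      (if i + j \<le> k then (if i = 1 then first 1 else if j = 1 then first 2 else inf_law X u ?p) else 0)) (at 0)"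
    proof cases
      case 1
      have "((\<lambda>t. snd (lift k U (\<phi> t) \<theta>) i j) has_vector_derivative 0) (at 0)"
        by (rule tr[OF has_vector_derivative_const[of 0]]) (use 1 in \<open>simp add: lift jet_pd\<close>)
      then show ?thesis using 1 by simp
    next
      case 2
      have "((\<lambda>t. snd (lift k U (\<phi> t) \<theta>) i j) has_vector_derivative inf_law X u ?p) (at 0)"
        by (rule tr[OF 0]) (use 2 K T(3) in \<open>simp add: lift jet_pd\<close>)
      then show ?thesis using 2 by simp
    next
      case 3
      have "((\<lambda>t. snd (lift k U (\<phi> t) \<theta>) i j) has_vector_derivative first 1) (at 0)"
        by (rule tr[OF 1]) (use 3 dK in \<open>simp add: lift jet_pd pd_Suc_left\<close>)
      then show ?thesis using 3 by simp
    next
      case 4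
      have "((\<lambda>t. snd (lift k U (\<phi> t) \<theta>) i j) has_vector_derivative first 2) (at 0)"
        by (rule tr[OF 1]) (use 4 dK in \<open>simp add: lift jet_pd pd_0_Suc\<close>)
      then show ?thesis using 4 by simp
    qed
  qed
qed

end

lemma local_flow_at_0:
  assumes "local_flow X U \<phi>" "p \<in> U"
  obtains \<epsilon> where "flow_at_0 \<epsilon> U \<phi> X" "smooth_near p X"
proof -
  obtain \<epsilon> N where e: "\<epsilon> > 0" and N: "smooth_on N X"
    and s: "smooth_on ({-\<epsilon><..<\<epsilon>} \<times> U) (\<lambda>(t, x). \<phi> t x)"
    and id: "\<And>x. x \<in> U \<Longrightarrow> \<phi> 0 x = x"
    and f: "\<And>t. t \<in> {-\<epsilon><..<\<epsilon>} \<Longrightarrow> point_transformation U (\<phi> t)"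
    and d: "\<And>t x. t \<in> {-\<epsilon><..<\<epsilon>} \<Longrightarrow> x \<in> U \<Longrightarrow> \<phi> t x \<in> N \<and>
      ((\<lambda>s. \<phi> s x) has_vector_derivative X (\<phi> t x)) (at t)"
    using assms(1) unfolding local_flow_def by blast
  have 0: "0 \<in> {-\<epsilon><..<\<epsilon>}" using e by simp
  have U: "open U" by (rule point_transformation_image(4)[OF f[OF 0]])
  have sub: "U \<subseteq> N" using d[OF 0] id by force
  have "flow_at_0 \<epsilon> U \<phi> X"
    by unfold_locales (use e s id f d[OF 0] smooth_on_subset[OF N U sub] in auto)
  moreover have "smooth_near p X" unfolding smooth_near_def using N sub assms(2) by blast
  ultimately show thesis by (rule that)
qed

section \<open>Isotropy spaces\<close>

text \<open>The tangent plane depends on the representing section only through the jet of one order more.\<close>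

lemma jet_plane_eq:
  assumes "(p, c) \<in> jet_bundle (Suc k)"
  shows "jet_plane k (p, c) = {(w, \<lambda>i j. if i + j \<le> k then w $ 1 *\<^sub>R c (Suc i) j + w $ 2 *\<^sub>R c i (Suc j) else 0) | w. True}"
proof -
  define S where "S = section_rep (Suc k) (p, c)"
  note SR = section_rep[OF assms, folded S_def]
  define u where "u = (\<lambda>x. snd (S x))"
  obtain N where N: "p \<in> N" "smooth_on N u"
    by (rule section_nearE[OF SR(1)[unfolded fst_conv]], rule that) (simp_all add: u_def)
  have "jet (Suc k) u p = c" using SR(2) by (simp add: sjet_def u_def o_def)
  then have c: "pd i j u p = c i j" if "i + j \<le> Suc k" for i j using that by (auto simp: jet_pd)
  have v: "velocity (\<lambda>t. sjet k S (p + t *\<^sub>R w))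
      (w, \<lambda>i j. if i + j \<le> k then w $ 1 *\<^sub>R c (Suc i) j + w $ 2 *\<^sub>R c i (Suc j) else 0)" for w
    unfolding velocity_def sjet_def fst_conv snd_conv
  proof (intro conjI allI)
    show "((\<lambda>t. p + t *\<^sub>R w) has_vector_derivative w) (at 0)"
      by (auto intro!: derivative_eq_intros)
    fix i j
    show "((\<lambda>t. jet k (snd \<circ> S) (p + t *\<^sub>R w) i j) has_vector_derivative
      (if i + j \<le> k then w $ 1 *\<^sub>R c (Suc i) j + w $ 2 *\<^sub>R c i (Suc j) else 0)) (at 0)"
    proof (cases "i + j \<le> k")
      case True
      have "((\<lambda>t. pd i j u (p + t *\<^sub>R w)) has_vector_derivative
          w $ 1 *\<^sub>R partial 1 (pd i j u) p + w $ 2 *\<^sub>R partial 2 (pd i j u) p) (at 0)"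
        by (rule has_vector_derivative_line[OF smooth_on_pd[OF N(2)] N(1)])
      then show ?thesis using True
        by (simp add: jet_pd o_def u_def[symmetric] pd_Suc_left[symmetric] pd_Suc_right[OF N(2,1)] c)
    qed (simp add: jet_pd)
  qed
  show ?thesis
    unfolding jet_plane_def fst_conv Suc_eq_plus1[symmetric] S_def[symmetric]
  proof (intro Collect_cong iffI; elim exE conjE)
    fix \<xi> :: jet_point and w :: point assume "velocity (\<lambda>t. sjet k S (p + t *\<^sub>R w)) \<xi>"
    from velocity_unique[OF this v]
    show "\<exists>w. \<xi> = (w, \<lambda>i j. if i + j \<le> k then w $ 1 *\<^sub>R c (Suc i) j + w $ 2 *\<^sub>R c i (Suc j) else 0) \<and> True"
      by blast
  next
    fix \<xi> :: jet_point and w :: point assume "\<xi> = (w, \<lambda>i j. if i + j \<le> k then w $ 1 *\<^sub>R c (Suc i) j + w $ 2 *\<^sub>R c i (Suc j) else 0)"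
    then show "\<exists>w. velocity (\<lambda>t. sjet k S (p + t *\<^sub>R w)) \<xi>" using v by blast
  qed
qed

lemma jproj_section:
  assumes "(p, c) \<in> jet_bundle (Suc k)"
  shows "jproj k (p, c) \<in> jet_bundle k" "fst (jproj k (p, c)) = p"
    "i + j \<le> k \<Longrightarrow> snd (jproj k (p, c)) i j = c i j"
proof -
  obtain S where S: "section_near p S" "c = jet (Suc k) (snd \<circ> S) p"
    using assms by (auto simp: jet_bundle_def sjet_def)
  have "jproj k (p, c) = sjet k S p"
    by (auto simp: jproj_def sjet_def S(2) trunc_def jet_def fun_eq_iff)
  then show "jproj k (p, c) \<in> jet_bundle k" using S(1) by (auto simp: jet_bundle_def)
qed (simp_all add: jproj_def trunc_def)

text \<open>As \<open>twist\<close> is bilinear and the first derivatives of \<open>X\<close> vanish at \<open>p\<close>, derivatives of \<open>u\<close> do not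
  contribute.\<close>

lemma partial_inf_law:
  assumes X: "smooth_on N X" and u: "smooth_on N u" and p: "p \<in> N"
    and z: "partial 1 X p = 0" "partial 2 X p = 0"
  shows "partial m (inf_law X u) p = twist (u p) (partial m (partial 1 X) p) (partial m (partial 2 X) p) +
    thomas (partial m (partial 1 (partial 1 X)) p) (partial m (partial 1 (partial 2 X)) p)
      (partial m (partial 2 (partial 2 X)) p)"
proof -
  note d = smooth_on_differentiable[OF _ p]
  define L1 where "L1 = (\<lambda>u::real^4. u - vec4 (3 * u $ 0) (2 * u $ 1) (u $ 2) 0)"
  define L2 where "L2 = (\<lambda>u::real^4. - vec4 (u $ 1) (2 * u $ 2) (3 * u $ 3) 0)"
  define L3 where "L3 = (\<lambda>u::real^4. - vec4 0 (3 * u $ 0) (2 * u $ 1) (u $ 2))"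
  define L4 where "L4 = (\<lambda>u::real^4. u - vec4 0 (u $ 1) (2 * u $ 2) (3 * u $ 3))"
  have tw: "twist w P Q = P $ 1 *\<^sub>R L1 w + P $ 2 *\<^sub>R L2 w + (Q $ 1 *\<^sub>R L3 w + Q $ 2 *\<^sub>R L4 w)" for w P Q
    by (simp add: twist_def L1_def L2_def L3_def L4_def vec4_eq_iff algebra_simps)
  have sL: "smooth_on N (\<lambda>x. L1 (u x))" "smooth_on N (\<lambda>x. L2 (u x))" "smooth_on N (\<lambda>x. L3 (u x))" "smooth_on N (\<lambda>x. L4 (u x))"
    unfolding L1_def L2_def L3_def L4_def by (intro smooth_intros u smooth_on_open[OF u])+
  have sX: "smooth_on N (\<lambda>x. partial i X x $ j)" for i j by (intro smooth_intros smooth_on_dird X)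
  have pr: "partial m (\<lambda>x. partial i X x $ j *\<^sub>R L (u x)) p = partial m (partial i X) p $ j *\<^sub>R L (u p)"
    if "smooth_on N (\<lambda>x. L (u x))" "i = 1 \<or> i = 2" for i j and L :: "real^4 \<Rightarrow> real^4"
    using dird_scaleR[OF d[OF sX] d[OF that(1)], of "axis m 1" i j] z that(2)
      dird_vec_nth[OF d[OF smooth_on_dird[OF X]], of "axis m 1" "axis i 1" j] by auto
  have s1: "smooth_on N (\<lambda>x. partial 1 X x $ 1 *\<^sub>R L1 (u x) + partial 1 X x $ 2 *\<^sub>R L2 (u x))"
    and s2: "smooth_on N (\<lambda>x. partial 2 X x $ 1 *\<^sub>R L3 (u x) + partial 2 X x $ 2 *\<^sub>R L4 (u x))"
    by (intro smooth_on_add smooth_on_scaleR sX sL)+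
  have "partial m (\<lambda>x. twist (u x) (partial 1 X x) (partial 2 X x)) p =
      twist (u p) (partial m (partial 1 X) p) (partial m (partial 2 X) p)"
    unfolding tw dird_add[OF d[OF s1] d[OF s2]]
    by (subst dird_add, (intro d smooth_on_scaleR sX sL)+, subst dird_add, (intro d smooth_on_scaleR sX sL)+)
      (simp add: pr sL)
  moreover have "partial m (\<lambda>x. thomas (partial 1 (partial 1 X) x) (partial 1 (partial 2 X) x) (partial 2 (partial 2 X) x)) p =
    thomas (partial m (partial 1 (partial 1 X)) p) (partial m (partial 1 (partial 2 X)) p)
      (partial m (partial 2 (partial 2 X)) p)"
  proof -
    let ?L = "\<lambda>(P, Q, R). thomas P Q R"
    have "linear ?L"
      by (rule linearI) (auto simp: thomas_def vec4_eq_iff algebra_simps)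
    then have L: "bounded_linear ?L" by (simp add: linear_conv_bounded_linear)
    have s: "smooth_on N (partial i (partial j X))" for i j by (intro smooth_on_dird X)
    have hd: "((\<lambda>x. (partial 1 (partial 1 X) x, partial 1 (partial 2 X) x, partial 2 (partial 2 X) x)) has_derivative
      (\<lambda>v. (dird v (partial 1 (partial 1 X)) p, dird v (partial 1 (partial 2 X)) p, dird v (partial 2 (partial 2 X)) p))) (at p)"
      by (intro has_derivative_Pair smooth_on_has_derivative[OF s p])
    show ?thesis
      using dird_eq[OF bounded_linear.has_derivative[OF L hd], of "axis m 1"] by simp
  qed
  moreover have st1: "smooth_on N (\<lambda>x. twist (u x) (partial 1 X x) (partial 2 X x))"
    unfolding tw by (intro smooth_on_add s1 s2)
  moreover have st2: "smooth_on N (\<lambda>x. thomas (partial 1 (partial 1 X) x) (partial 1 (partial 2 X) x) (partial 2 (partial 2 X) x))"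
    unfolding thomas_def by (intro smooth_intros smooth_on_dird X smooth_on_open[OF X])
  ultimately show ?thesis
    unfolding inf_law_def dird_add[OF d[OF st1] d[OF st2]] by simp
qed

text \<open>The conditions that define the isotropy spaces, for jets of vector fields with vanishing first
  derivatives.\<close>

definition iso_equations :: "nat \<Rightarrow> (nat \<Rightarrow> nat \<Rightarrow> real^4) \<Rightarrow> vjet \<Rightarrow> bool"
  where "iso_equations k c a \<longleftrightarrow>
    thomas (a 2 0) (a 1 1) (a 0 2) = a 0 0 $ 1 *\<^sub>R c 1 0 + a 0 0 $ 2 *\<^sub>R c 0 1 \<and>
    (k = 1 \<longrightarrow>
      twist (c 0 0) (a 2 0) (a 1 1) + thomas (a 3 0) (a 2 1) (a 1 2) = a 0 0 $ 1 *\<^sub>R c 2 0 + a 0 0 $ 2 *\<^sub>R c 1 1 \<and>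
      twist (c 0 0) (a 1 1) (a 0 2) + thomas (a 2 1) (a 1 2) (a 0 3) = a 0 0 $ 1 *\<^sub>R c 1 1 + a 0 0 $ 2 *\<^sub>R c 0 2)"

text \<open>The base component of the lifted value is \<open>X p\<close>, which determines the only candidate vector in the
  jet plane; comparing the remaining components order by order gives the equations.\<close>

lemma lifted_value_in_jet_plane:
  assumes \<theta>: "(p, c) \<in> jet_bundle (Suc k)" and k: "k \<le> 1" and flow: "local_flow X U \<phi>" and p: "p \<in> U"
    and z: "partial 1 X p = 0" "partial 2 X p = 0"
  shows "(\<exists>\<xi>\<in>jet_plane k (p, c). velocity (\<lambda>t. lift k U (\<phi> t) (jproj k (p, c))) \<xi>) \<longleftrightarrow>
    iso_equations k c (jet (k + 2) X p)"
proof -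
  obtain \<epsilon> where loc: "flow_at_0 \<epsilon> U \<phi> X" by (rule local_flow_at_0[OF flow p], rule that)
  interpret flow_at_0 \<epsilon> U \<phi> X by (rule loc)
  let ?\<theta> = "jproj k (p, c)"
  note J = jproj_section[OF \<theta>]
  note S = section_rep[OF J(1), unfolded J(2)]
  define u where "u = (\<lambda>x. snd (section_rep k ?\<theta> x))"
  obtain N where N: "p \<in> N" "smooth_on N u" 
    by (rule section_nearE[OF S(1)], rule that) (simp_all add: u_def)
  have "snd (sjet k (section_rep k ?\<theta>) p) = snd ?\<theta>" by (simp only: S(2))
  then have jet: "jet k u p = snd ?\<theta>" by (simp only: sjet_def u_def o_def snd_conv)
  have c: "pd i j u p = c i j" if "i + j \<le> k" for i j
  proof -
    have "pd i j u p = jet k u p i j" using that by (simp add: jet_pd)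
    then show ?thesis by (simp only: jet J(3)[OF that])
  qed
  define first where "first = (\<lambda>m. partial m (inf_law X u) p
      - partial m (\<lambda>x. X x $ 1) p *\<^sub>R partial 1 u p - partial m (\<lambda>x. X x $ 2) p *\<^sub>R partial 2 u p)"
  note vel = flow_velocity[of ?\<theta> k u first, unfolded J(2), OF p S(1) k u_def first_def]
  define T where "T = U \<inter> N"
  have T: "open T" "p \<in> T" using open_U smooth_on_open[OF N(2)] p N(1) by (auto simp: T_def)
  have sT: "smooth_on T X" "smooth_on T u"
    using smooth_on_subset[OF smooth_X T(1)] smooth_on_subset[OF N(2) T(1)] by (auto simp: T_def)
  have pX: "pd 0 0 X p = X p" "pd 1 0 X p = 0" "pd 0 1 X p = 0"
    "pd 2 0 X p = partial 1 (partial 1 X) p" "pd 1 1 X p = partial 1 (partial 2 X) p"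
    "pd 0 2 X p = partial 2 (partial 2 X) p"
    "pd 3 0 X p = partial 1 (partial 1 (partial 1 X)) p" "pd 2 1 X p = partial 1 (partial 1 (partial 2 X)) p"
    "pd 1 2 X p = partial 1 (partial 2 (partial 2 X)) p" "pd 0 3 X p = partial 2 (partial 2 (partial 2 X)) p"
    using z by (simp_all add: pd_def eval_nat_numeral)
  have comm: "partial 2 (partial 1 Y) p = partial 1 (partial 2 Y) p" if "smooth_on U Y" for Y :: "point \<Rightarrow> point"
    by (rule dird_commute[OF that p])
  have comm2: "partial 2 (partial 1 (partial i X)) p = partial 1 (partial 2 (partial i X)) p" for i
    by (rule comm[OF smooth_on_dird[OF smooth_X]])
  have comm3: "partial 1 (partial 2 (partial 1 X)) p = partial 1 (partial 1 (partial 2 X)) p"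
    by (rule dird_cong[OF open_U p dird_commute[OF smooth_X]])
  have val0: "inf_law X u p = thomas (pd 2 0 X p) (pd 1 1 X p) (pd 0 2 X p)"
    unfolding inf_law_def z pX by (simp add: twist_def vec4_eq_iff)
  have zX: "partial m (\<lambda>x. X x $ i) p = 0" for m i
    using dird_vec_nth[OF smooth_on_differentiable[OF smooth_X p], of "axis m 1" i] z exhaust_2[of m] by auto
  have first: "first 1 = twist (c 0 0) (pd 2 0 X p) (pd 1 1 X p) + thomas (pd 3 0 X p) (pd 2 1 X p) (pd 1 2 X p)"
      "first 2 = twist (c 0 0) (pd 1 1 X p) (pd 0 2 X p) + thomas (pd 2 1 X p) (pd 1 2 X p) (pd 0 3 X p)"
    using c[of 0 0] unfolding first_def partial_inf_law[OF sT T(2) z] zX pX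
    by (simp_all add: comm[OF smooth_X] comm2 comm3)
  let ?\<xi> = "(X p, \<lambda>i j. if i + j \<le> k then (if i = 1 then first 1 else if j = 1 then first 2 else inf_law X u p) else 0)"
  have "(\<exists>\<xi>\<in>jet_plane k (p, c). velocity (\<lambda>t. lift k U (\<phi> t) ?\<theta>) \<xi>) \<longleftrightarrow> ?\<xi> \<in> jet_plane k (p, c)"
  proof
    assume "\<exists>\<xi>\<in>jet_plane k (p, c). velocity (\<lambda>t. lift k U (\<phi> t) ?\<theta>) \<xi>"
    then obtain \<xi> where "\<xi> \<in> jet_plane k (p, c)" "velocity (\<lambda>t. lift k U (\<phi> t) ?\<theta>) \<xi>" by (rule bexE)
    then show "?\<xi> \<in> jet_plane k (p, c)" using velocity_unique[OF vel, of \<xi>] by simp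
  next
    assume "?\<xi> \<in> jet_plane k (p, c)"
    with vel show "\<exists>\<xi>\<in>jet_plane k (p, c). velocity (\<lambda>t. lift k U (\<phi> t) ?\<theta>) \<xi>" by (rule bexI)
  qed
  also have "\<dots> \<longleftrightarrow> (\<forall>i j. i + j \<le> k \<longrightarrow> (if i = 1 then first 1 else if j = 1 then first 2 else inf_law X u p) =
      X p $ 1 *\<^sub>R c (Suc i) j + X p $ 2 *\<^sub>R c i (Suc j))"
    unfolding jet_plane_eq[OF \<theta>] by (auto simp: fun_eq_iff split: if_splits)
  also have "\<dots> \<longleftrightarrow> inf_law X u p = X p $ 1 *\<^sub>R c 1 0 + X p $ 2 *\<^sub>R c 0 1 \<and>
      (k = 1 \<longrightarrow> first 1 = X p $ 1 *\<^sub>R c 2 0 + X p $ 2 *\<^sub>R c 1 1 \<and> first 2 = X p $ 1 *\<^sub>R c 1 1 + X p $ 2 *\<^sub>R c 0 2)"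
    (is "?A \<longleftrightarrow> ?B")
  proof
    assume A: ?A
    show ?B using A[rule_format, of 0 0] A[rule_format, of 1 0] A[rule_format, of 0 1]
      by (auto simp: eval_nat_numeral)
  next
    assume B: ?B
    show ?A
    proof (intro allI impI)
      fix i j assume "i + j \<le> k"
      then have "(i = 0 \<and> j = 0) \<or> (k = 1 \<and> i = 1 \<and> j = 0) \<or> (k = 1 \<and> i = 0 \<and> j = 1)" using k by arith
      then show "(if i = 1 then first 1 else if j = 1 then first 2 else inf_law X u p) =
        X p $ 1 *\<^sub>R c (Suc i) j + X p $ 2 *\<^sub>R c i (Suc j)"
        using B by (auto simp: eval_nat_numeral)
    qed
  qed
  also have "\<dots> \<longleftrightarrow> iso_equations k c (jet (k + 2) X p)"
    unfolding iso_equations_def val0 first using k by (auto simp: jet_pd)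
  finally show ?thesis .
qed

lemma isotropy_equations:
  assumes \<theta>: "(p, c) \<in> jet_bundle (Suc k)" and k: "k \<le> 1" and a: "a \<in> isotropy k (p, c)"
    and z: "a 1 0 = 0" "a 0 1 = 0"
  shows "iso_equations k c a"
proof -
  obtain X \<xi> where X: "a = jet (k + 2) X p" "smooth_near p X" "\<xi> \<in> jet_plane k (p, c)"
      "has_lifted_value k X (jproj k (p, c)) \<xi>"
    using a unfolding isotropy_def by auto
  obtain U \<phi> where U: "p \<in> U" "local_flow X U \<phi>" "velocity (\<lambda>t. lift k U (\<phi> t) (jproj k (p, c))) \<xi>"
    using X(4) unfolding has_lifted_value_def jproj_section(2)[OF \<theta>] by auto
  have "partial 1 X p = 0" "partial 2 X p = 0" using z unfolding X(1) by (simp_all add: jet_pd pd_def)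
  from lifted_value_in_jet_plane[OF \<theta> k U(2,1) this] U(3) X(1,3) show ?thesis by blast
qed

lemma isotropyI:
  assumes \<theta>: "(p, c) \<in> jet_bundle (Suc k)" and k: "k \<le> 1"
    and X: "local_flow X U \<phi>" "p \<in> U" and a: "jet (k + 2) X p = a" and z: "a 1 0 = 0" "a 0 1 = 0"
    and eq: "iso_equations k c a"
  shows "a \<in> isotropy k (p, c)"
proof -
  have "partial 1 X p = 0" "partial 2 X p = 0" using z unfolding a[symmetric] by (simp_all add: jet_pd pd_def)
  from lifted_value_in_jet_plane[OF \<theta> k X this] eq a obtain \<xi> where
    "\<xi> \<in> jet_plane k (p, c)" "velocity (\<lambda>t. lift k U (\<phi> t) (jproj k (p, c))) \<xi>" by blast
  moreover have "smooth_near p X" by (rule local_flow_at_0[OF X])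
  ultimately show ?thesis
    using a X unfolding isotropy_def has_lifted_value_def fst_conv jproj_section(2)[OF \<theta>] by blast
qed

section \<open>Vector fields with given jet and explicit flow\<close>

lemma point_transformation_left_inverse:
  assumes f: "smooth_on U f" and g: "smooth_on V g" and fV: "\<And>x. x \<in> U \<Longrightarrow> f x \<in> V"
    and gf: "\<And>x. x \<in> U \<Longrightarrow> g (f x) = x"
  shows "point_transformation U f"
proof -
  have inj: "inj_on f U" by (rule inj_on_inverseI[of U g f]) (rule gf)
  have "smooth_on (f ` U) g"
    by (rule smooth_on_subset[OF g smooth_on_open_image[OF f inj]]) (use fV in auto)
  then have "smooth_on (f ` U) (inv_into U f)"
    by (rule smooth_on_cong) (use gf inj in auto)
  then show ?thesis using f inj by (simp add: point_transformation_def)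
qed

text \<open>The recursion for Taylor coefficients of a solution of \<open>v\<^sub>1 \<partial>\<^sub>1C + v\<^sub>2 \<partial>\<^sub>2C = A\<close> with initial value
  0 on a line transversal to \<open>v\<close>, when \<open>v\<^sub>1 \<noteq> 0\<close>.\<close>

primrec antiderivative_coeffs :: "real \<Rightarrow> real \<Rightarrow> (nat \<Rightarrow> nat \<Rightarrow> 'b::real_vector) \<Rightarrow> nat \<Rightarrow> nat \<Rightarrow> 'b" where
  "antiderivative_coeffs v1 v2 A 0 = (\<lambda>j. 0)"
| "antiderivative_coeffs v1 v2 A (Suc i) =
    (\<lambda>j. inverse v1 *\<^sub>R (A i j - v2 *\<^sub>R antiderivative_coeffs v1 v2 A i (Suc j)))"

lemma antiderivative_coeffs_zero:
  assumes "\<And>i j. i + j < n \<Longrightarrow> A i j = 0" "i + j < Suc n"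
  shows "antiderivative_coeffs v1 v2 A i j = 0"
  using assms(2) by (induction i arbitrary: j) (simp_all add: assms(1))

lemma directional_antiderivative:
  fixes v :: point and A :: "nat \<Rightarrow> nat \<Rightarrow> 'b::real_vector"
  assumes "v \<noteq> 0" and A: "\<And>i j. i + j < n \<Longrightarrow> A i j = 0"
  obtains c where "\<And>i j. v $ 1 *\<^sub>R c (Suc i) j + v $ 2 *\<^sub>R c i (Suc j) = A i j"
    "\<And>i j. i + j < Suc n \<Longrightarrow> c i j = 0"
proof (cases "v $ 1 = 0")
  case False
  then show thesis
    by (intro that[of "antiderivative_coeffs (v $ 1) (v $ 2) A"])
      (simp_all add: antiderivative_coeffs_zero[OF A])
next
  case True
  then have v2: "v $ 2 \<noteq> 0" using assms(1) by (auto simp: vec_eq_iff forall_2)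
  have A': "\<And>i j. i + j < n \<Longrightarrow> A j i = 0" using A by simp
  show thesis
    by (rule that[of "\<lambda>i j. antiderivative_coeffs (v $ 2) (v $ 1) (\<lambda>i j. A j i) j i"])
      (use v2 antiderivative_coeffs_zero[OF A'] in \<open>simp_all add: True\<close>)
qed

text \<open>The flow of \<open>X\<close> is conjugate to the translations in the direction \<open>v = X p\<close> by a diffeomorphism
  \<open>\<psi>\<close>: the flow is explicit, and \<open>X \<circ> \<psi> = D\<psi>(v)\<close>. As the first derivatives of the prescribed jet
  vanish, \<open>\<psi>\<close> can be taken to agree with the identity up to order two, and then the conjugation
  does not change three-jets.\<close>

lemma local_flow_with_jet:
  fixes a :: vjet
  assumes v: "a 0 0 \<noteq> 0" and a1: "a 1 0 = 0" "a 0 1 = 0"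
  obtains X U \<phi> where "local_flow X U \<phi>" "p \<in> U" "jet 3 X p = trunc 3 a"
proof -
  define v where "v = a 0 0"
  define A where "A = (\<lambda>i j. if i + j < 2 then 0 else a i j)"
  obtain c where c: "\<And>i j. v $ 1 *\<^sub>R c (Suc i) j + v $ 2 *\<^sub>R c i (Suc j) = A i j"
    and c0: "\<And>i j. i + j < 3 \<Longrightarrow> c i j = 0"
    using directional_antiderivative[of v 2 A] v by (auto simp: A_def v_def numeral_3_eq_3)
  define C where "C = poly_jet 4 p c"
  define \<psi> where "\<psi> = (\<lambda>x. x + C x)"
  define h where "h = dird v \<psi>"
  have sC: "smooth_on UNIV C" unfolding C_def by (rule smooth_on_poly_jet) simp
  have s\<psi>: "smooth_on UNIV \<psi>" unfolding \<psi>_def by (intro smooth_intros sC) simp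
  have sh: "smooth_on UNIV h" unfolding h_def by (rule smooth_on_dird[OF s\<psi>])
  have pC: "pd i j C p = c i j" if "i + j \<le> 4" for i j using that by (simp add: C_def pd_poly_jet)
  have dC: "C differentiable (at x)" for x by (rule smooth_on_differentiable[OF sC]) simp
  have pC0: "C p = 0" "partial 1 C p = 0" "partial 2 C p = 0"
    using pC[of 0 0] pC[of 1 0] pC[of 0 1] c0[of 0 0] c0[of 1 0] c0[of 0 1]
    by (simp_all add: pd_Suc_left pd_0_Suc)
  have \<psi>p: "\<psi> p = p" by (simp add: \<psi>_def pC0)
  have "partial i (\<lambda>x. \<psi> x $ j) p = axis i 1 $ j" if "i = 1 \<or> i = 2" for i j
    unfolding dird_vec_nth[OF smooth_on_differentiable[OF s\<psi> UNIV_I]]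
    unfolding \<psi>_def dird_add[OF differentiable_ident dC] using pC0 that by auto
  then have "jac \<psi> p = 1" by (simp add: jac_def)
  then obtain T where T: "open T" "p \<in> T" "point_transformation T \<psi>"
    using local_point_transformation[OF s\<psi> UNIV_I, of p] by auto
  note P = point_transformation_image[OF T(3)]
  define g where "g = inv_into T \<psi>"
  define N where "N = \<psi> ` T"
  have g: "smooth_on N g" "\<And>x. x \<in> T \<Longrightarrow> g (\<psi> x) = x" "\<And>z. z \<in> N \<Longrightarrow> g z \<in> T" "\<And>z. z \<in> N \<Longrightarrow> \<psi> (g z) = z"
    using P by (auto simp: g_def N_def)
  have pN: "p \<in> N" unfolding N_def using T(2) \<psi>p by (metis imageI)
  define X where "X = (\<lambda>z. h (g z))"
  have sX: "smooth_on N X" unfolding X_def by (rule smooth_on_compose[OF g(1) sh]) simp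
  have X\<psi>: "X (\<psi> x) = h x" if "x \<in> T" for x using g(2)[OF that] by (simp add: X_def)

  have pdh: "pd i j h p = a i j" if "i + j \<le> 3" for i j
  proof -
    have hx: "h x = v + (v $ 1 *\<^sub>R partial 1 C x + v $ 2 *\<^sub>R partial 2 C x)" for x
      unfolding h_def \<psi>_def dird_add[OF differentiable_ident dC] using dird_axis[OF dC, of v] by simp
    have s: "smooth_on UNIV (\<lambda>x. v $ 1 *\<^sub>R partial 1 C x)" "smooth_on UNIV (\<lambda>x. v $ 2 *\<^sub>R partial 2 C x)"
      by (intro smooth_on_scaleR smooth_on_const smooth_on_dird sC open_UNIV)+
    have "pd i j h p = pd i j (\<lambda>x. v + (v $ 1 *\<^sub>R partial 1 C x + v $ 2 *\<^sub>R partial 2 C x)) p"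
      by (rule arg_cong[where f = "\<lambda>h. pd i j h p"]) (simp add: hx fun_eq_iff)
    also have "\<dots> = (if i = 0 \<and> j = 0 then v else 0) +
        (v $ 1 *\<^sub>R pd i j (partial 1 C) p + v $ 2 *\<^sub>R pd i j (partial 2 C) p)"
      using pd_add[OF smooth_on_const[OF open_UNIV, of v] smooth_on_add[OF s] UNIV_I, of i j p]
        pd_add[OF s UNIV_I, of i j p]
        pd_scaleR_left[OF smooth_on_dird[OF sC] UNIV_I] by simp
    also have "\<dots> = (if i = 0 \<and> j = 0 then v else 0) + A i j"
      unfolding pd_partial1[OF sC UNIV_I] pd_partial2 using that by (simp add: pC c)
    also have "\<dots> = a i j"
    proof (cases "i + j < 2")
      case True
      then have "(i = 0 \<and> j = 0) \<or> (i = 1 \<and> j = 0) \<or> (i = 0 \<and> j = 1)" by arith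
      then show ?thesis using a1 by (auto simp: A_def v_def)
    qed (auto simp: A_def)
    finally show ?thesis .
  qed
  define T' where "T' = T \<inter> N"
  have T': "open T'" "p \<in> T'" using T pN smooth_on_open[OF sX] by (auto simp: T'_def)
  have near: "vanishes (Suc 2) (\<lambda>x. \<psi> x $ j - x $ j) p" for j
  proof -
    have "(\<lambda>x. \<psi> x $ j - x $ j) = (\<lambda>x. C x $ j)" by (simp add: \<psi>_def)
    then show ?thesis
      using vanishes_iff_pd[OF smooth_on_vec_nth[OF sC] UNIV_I, of "Suc 2" j p] pd_vec_nth[OF sC UNIV_I]
      by (simp add: pC c0)
  qed
  have sXc: "smooth_on N (\<lambda>x. X x $ i)" for i by (rule smooth_on_vec_nth[OF sX])
  \<comment> \<open>used twice: with \<open>s = 0\<close> to see that the first derivatives of \<open>X\<close> vanish, and then with \<open>s = 1\<close>\<close>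
  have diff: "vanishes n (\<lambda>x. h x $ i - X x $ i) p"
    if "vanishes s (partial 1 (\<lambda>x. X x $ i)) p" "vanishes s (partial 2 (\<lambda>x. X x $ i)) p" "n \<le> Suc 2 + s" for n s i
  proof (rule vanishes_transfer[OF vanishes_compose_near_identity
        [OF sXc smooth_on_subset[OF s\<psi> T(1) subset_UNIV] _ T(2) pN near that]])
    show "\<psi> x \<in> N" if "x \<in> T" for x using that by (simp add: N_def)
    show "open T'" "p \<in> T'" by (fact T')+
    show "h x $ i - X x $ i = X (\<psi> x) $ i - X x $ i" if "x \<in> T'" for x
      using X\<psi> that by (simp add: T'_def)
  qed
  have dh: "partial m (\<lambda>x. h x $ i) p = 0" if "m = 1 \<or> m = 2" for m i
    using pdh[of 1 0] pdh[of 0 1] a1 that dird_vec_nth[OF smooth_on_differentiable[OF sh UNIV_I], of "axis m 1" i p]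
    by (auto simp: pd_Suc_left pd_0_Suc)
  have dX: "partial m (\<lambda>x. X x $ i) p = 0" if m: "m = 1 \<or> m = 2" for m i
  proof -
    have "partial m (\<lambda>x. h x $ i - X x $ i) p = 0"
      using diff[of 0 i 2] m by (auto simp: eval_nat_numeral)
    moreover have "partial m (\<lambda>x. h x $ i - X x $ i) p = partial m (\<lambda>x. h x $ i) p - partial m (\<lambda>x. X x $ i) p"
      by (rule dird_diff[OF smooth_on_differentiable[OF smooth_on_vec_nth[OF sh] UNIV_I]
            smooth_on_differentiable[OF sXc pN]])
    ultimately show ?thesis using dh[OF m] by simp
  qed
  have "jet 3 h p = jet 3 X p"
  proof (rule iffD2[OF jet_eq_iff_vanishes[OF smooth_on_subset[OF sh T'(1)] smooth_on_subset[OF sX T'(1)] T'(2)]])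
    show "\<forall>i. vanishes (Suc 3) (\<lambda>x. h x $ i - X x $ i) p"
      using diff[of 1 _ "Suc 3"] dX by simp
  qed (auto simp: T'_def)
  moreover have "jet 3 h p = trunc 3 a" by (auto simp: jet_pd trunc_def pdh fun_eq_iff)
  ultimately have jetX: "jet 3 X p = trunc 3 a" by simp

  \<comment> \<open>Translating points of the half ball for times less than \<open>\<epsilon>\<close> does not leave the ball.\<close>
  obtain r where r: "r > 0" "ball p r \<subseteq> T" using T openE by blast
  define B where "B = ball p (r / 2)"
  define U where "U = \<psi> ` B"
  define \<epsilon> where "\<epsilon> = r / 2 / (norm v + 1)"
  define \<phi> where "\<phi> = (\<lambda>t x. \<psi> (g x + t *\<^sub>R v))"
  have BT: "B \<subseteq> T" using r by (auto simp: B_def)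
  have \<epsilon>: "\<epsilon> > 0" using r by (auto simp: \<epsilon>_def intro!: divide_pos_pos add_nonneg_pos)
  have UN: "U \<subseteq> N" using BT by (auto simp: U_def N_def)
  have opU: "open U" unfolding U_def
    by (rule smooth_on_open_image[OF smooth_on_subset[OF s\<psi>] inj_on_subset[OF P(2) BT]]) (auto simp: B_def)
  have move: "g x + t *\<^sub>R v \<in> T" if xU: "x \<in> U" and tI: "t \<in> {-\<epsilon><..<\<epsilon>}" for x t
  proof -
    obtain y where y: "y \<in> B" "x = \<psi> y" using xU by (auto simp: U_def)
    then have "g x = y" using g(2) BT by auto
    have "norm (t *\<^sub>R v) \<le> \<epsilon> * norm v" using tI by (auto intro!: mult_right_mono)
    also have "\<dots> \<le> \<epsilon> * (norm v + 1)" using \<epsilon> by (intro mult_left_mono) auto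
    also have "\<dots> = r / 2"
    proof -
      have "norm v + 1 \<noteq> 0" using norm_ge_zero[of v] by linarith
      then show ?thesis by (simp add: \<epsilon>_def del: divide_divide_eq_left)
    qed
    finally have "norm (t *\<^sub>R v) \<le> r / 2" .
    moreover have "dist p y < r / 2" using y(1) by (simp add: B_def)
    moreover have "dist p (y + t *\<^sub>R v) \<le> dist p y + norm (t *\<^sub>R v)"
      using dist_triangle[of p "y + t *\<^sub>R v" y] by (simp add: dist_norm)
    ultimately have "dist p (y + t *\<^sub>R v) < r" by simp
    then show ?thesis using r(2) \<open>g x = y\<close> by auto
  qed
  have gU: "smooth_on U g" by (rule smooth_on_subset[OF g(1) opU UN])
  have "local_flow X U \<phi>"
    unfolding local_flow_def
  proof (intro exI[of _ \<epsilon>] exI[of _ N] conjI ballI \<epsilon> sX)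
    have op: "open ({-\<epsilon><..<\<epsilon>} \<times> U)" by (intro open_Times opU open_greaterThanLessThan)
    have "smooth_on ({-\<epsilon><..<\<epsilon>} \<times> U) (\<lambda>q. g (snd q) + fst q *\<^sub>R v)"
      by (intro smooth_on_add smooth_on_scaleR smooth_on_compose[OF _ gU] smooth_on_fst smooth_on_snd
          smooth_on_ident smooth_on_const op) auto
    from smooth_on_compose[OF this s\<psi>]
    show "smooth_on ({-\<epsilon><..<\<epsilon>} \<times> U) (\<lambda>(t, x). \<phi> t x)"
      by (simp add: \<phi>_def case_prod_unfold)
    show "\<phi> 0 x = x" if "x \<in> U" for x using that UN g(4) by (auto simp: \<phi>_def)
    fix t assume t: "t \<in> {-\<epsilon><..<\<epsilon>}"
    show "point_transformation U (\<phi> t)"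
    proof (rule point_transformation_left_inverse)
      show "smooth_on U (\<phi> t)" unfolding \<phi>_def
        by (rule smooth_on_compose[OF _ s\<psi>]) (auto intro!: smooth_intros gU opU)
      show "smooth_on N (\<lambda>z. \<psi> (g z - t *\<^sub>R v))"
        by (rule smooth_on_compose[OF _ s\<psi>]) (auto intro!: smooth_intros g smooth_on_open[OF sX])
      show "\<phi> t x \<in> N" if "x \<in> U" for x using move[OF that t] by (auto simp: \<phi>_def N_def)
      show "\<psi> (g (\<phi> t x) - t *\<^sub>R v) = x" if "x \<in> U" for x
        using g(2)[OF move[OF that t]] g(4) that UN by (auto simp: \<phi>_def)
    qed
    fix x assume x: "x \<in> U"
    show "\<phi> t x \<in> N" using move[OF x t] by (auto simp: \<phi>_def N_def)
    have "X (\<phi> t x) = dird v \<psi> (g x + t *\<^sub>R v)"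
      using X\<psi>[OF move[OF x t]] by (simp add: \<phi>_def h_def)
    then show "((\<lambda>s. \<phi> s x) has_vector_derivative X (\<phi> t x)) (at t)"
      using has_vector_derivative_dird[OF s\<psi> UNIV_I, of "g x" v t] by (simp add: \<phi>_def)
  qed
  moreover have "p \<in> U"
  proof -
    have "p \<in> B" using r by (simp add: B_def)
    then show ?thesis unfolding U_def using \<psi>p by (metis imageI)
  qed
  ultimately show thesis using jetX by (rule that)
qed

lemma local_flow_zero: "local_flow (\<lambda>_. 0) UNIV (\<lambda>t x. x)"
  unfolding local_flow_def
proof (intro exI[of _ "1::real"] exI[of _ "UNIV :: point set"] conjI ballI)
  show "smooth_on ({-1<..<1::real} \<times> UNIV) (\<lambda>(t, x::point). x)"
    unfolding case_prod_beta by (intro smooth_intros open_Times) auto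
  show "point_transformation UNIV (\<lambda>x. x)"
    by (rule point_transformation_left_inverse[where V = UNIV and g = "\<lambda>x. x"]) (auto intro: smooth_intros)
qed (auto intro: smooth_intros)

lemma fun_arith_apply [simp]:
  fixes f g :: "'a \<Rightarrow> 'b::real_vector"
  shows "(f + g) x = f x + g x" "(0 :: 'a \<Rightarrow> 'b) x = 0" "(f - g) x = f x - g x" "(r *\<^sub>R f) x = r *\<^sub>R f x"
  by (simp_all add: plus_fun_def zero_fun_def fun_diff_def scaleR_fun_def)

section \<open>Brackets of jets\<close>

lemma field_rep:
  assumes "a \<in> W k p"
  shows "smooth_near p (field_rep k p a)" "jet k (field_rep k p a) p = a"
proof -
  obtain X where "smooth_near p X \<and> jet k X p = a" using assms by (auto simp: W_def)
  then have "smooth_near p (field_rep k p a) \<and> jet k (field_rep k p a) p = a"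
    unfolding field_rep_def by (rule someI[where P = "\<lambda>X. smooth_near p X \<and> jet k X p = a"])
  then show "smooth_near p (field_rep k p a)" "jet k (field_rep k p a) p = a" by auto
qed

lemma W_trunc: "a \<in> W k p \<Longrightarrow> k < i + j \<Longrightarrow> a i j = 0"
  by (auto simp: W_def jet_pd)

text \<open>For fields with vanishing first derivatives, the second-order jet of the bracket is that of the
  expression in which the undifferentiated fields are replaced by their values at the point, since
  \<open>(X - X p)\<partial>Y\<close> vanishes to order three.\<close>

lemma jet_bracket_eq:
  assumes a: "a \<in> W k p" "a 1 0 = 0" "a 0 1 = 0" and b: "b \<in> W k p" "b 1 0 = 0" "b 0 1 = 0"
    and k: "1 \<le> k" "k \<le> 3"
  shows "jet_bracket k p a b = (\<lambda>i j. if i + j < k then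
    a 0 0 $ 1 *\<^sub>R b (Suc i) j + a 0 0 $ 2 *\<^sub>R b i (Suc j)
    - (b 0 0 $ 1 *\<^sub>R a (Suc i) j + b 0 0 $ 2 *\<^sub>R a i (Suc j)) else 0)"
proof -
  define X where "X = field_rep k p a"
  define Y where "Y = field_rep k p b"
  obtain N1 N2 where N: "p \<in> N1" "smooth_on N1 X" "p \<in> N2" "smooth_on N2 Y"
    using field_rep(1)[OF a(1)] field_rep(1)[OF b(1)] unfolding smooth_near_def X_def Y_def by blast
  define N where "N = N1 \<inter> N2"
  have op: "open N" "p \<in> N" using N smooth_on_open by (auto simp: N_def)
  have sX: "smooth_on N X" and sY: "smooth_on N Y"
    using smooth_on_subset[OF N(2) op(1)] smooth_on_subset[OF N(4) op(1)] by (auto simp: N_def)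
  have "pd i j X p = jet k X p i j" "pd i j Y p = jet k Y p i j" if "i + j \<le> k" for i j
    using that by (simp_all add: jet_pd)
  then have pX: "pd i j X p = a i j" and pY: "pd i j Y p = b i j" if "i + j \<le> k" for i j
    using that field_rep(2)[OF a(1)] field_rep(2)[OF b(1)] by (simp_all add: X_def Y_def)
  have X0: "X p = a 0 0" "Y p = b 0 0" using pX[of 0 0] pY[of 0 0] by auto
  have Xd: "partial i X p = 0" "partial i Y p = 0" if "i = 1 \<or> i = 2" for i
    using pX[of 1 0] pX[of 0 1] pY[of 1 0] pY[of 0 1] a b k that by (auto simp: pd_Suc_left pd_0_Suc)
  define Z where "Z = (\<lambda>x. (X p $ 1 *\<^sub>R partial 1 Y x + X p $ 2 *\<^sub>R partial 2 Y x)
    - (Y p $ 1 *\<^sub>R partial 1 X x + Y p $ 2 *\<^sub>R partial 2 X x))"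
  have br: "lie_bracket X Y x = (X x $ 1 *\<^sub>R partial 1 Y x + X x $ 2 *\<^sub>R partial 2 Y x)
    - (Y x $ 1 *\<^sub>R partial 1 X x + Y x $ 2 *\<^sub>R partial 2 X x)" if "x \<in> N" for x
    unfolding lie_bracket_def
    using dird_axis[OF smooth_on_differentiable[OF sY that], of "X x"]
      dird_axis[OF smooth_on_differentiable[OF sX that], of "Y x"] by simp
  have sL: "smooth_on N (lie_bracket X Y)"
    by (rule smooth_on_cong[OF _ br]) (intro smooth_intros smooth_on_dird sX sY)
  have sZ: "smooth_on N Z"
    unfolding Z_def by (intro smooth_intros smooth_on_dird sX sY op)
  have zero_order: "vanishes 2 (\<lambda>x. V x $ m - V p $ m) p"
    if V: "smooth_on N V" "\<And>i. i = 1 \<or> i = 2 \<Longrightarrow> partial i V p = 0" for V :: "point \<Rightarrow> point" and m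
  proof -
    have "partial i (\<lambda>x. V x $ m - V p $ m) p = 0" if "i = 1 \<or> i = 2" for i
      using dird_diff[OF smooth_on_differentiable[OF smooth_on_vec_nth[OF V(1)] op(2)], of "\<lambda>_. V p $ m" "axis i 1" m]
        dird_vec_nth[OF smooth_on_differentiable[OF V(1) op(2)], of "axis i 1" m] V(2)[OF that] by simp
    then show ?thesis by (simp add: eval_nat_numeral)
  qed
  have one_order: "vanishes 1 (\<lambda>x. partial i V x $ m) p"
    if "partial i V p = 0" for V :: "point \<Rightarrow> point" and i m
    using that by simp
  have "vanishes 3 (\<lambda>x. lie_bracket X Y x $ m - Z x $ m) p" for m
  proof (rule vanishes_transfer[OF _ op])
    let ?t = "\<lambda>V Y i x. (V x $ i - V p $ i) * partial i Y x $ m"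
    have s: "smooth_on N (?t V Y i)" if "smooth_on N V" "smooth_on N Y" for V Y :: "point \<Rightarrow> point" and i
      by (intro smooth_intros smooth_on_dird that op)
    have v: "vanishes 3 (?t V Y i) p"
      if V: "smooth_on N V" "smooth_on N Y" "\<And>i. i = 1 \<or> i = 2 \<Longrightarrow> partial i V p = 0"
        "\<And>i. i = 1 \<or> i = 2 \<Longrightarrow> partial i Y p = 0" and i: "i = 1 \<or> i = 2" for V Y :: "point \<Rightarrow> point" and i
      by (rule vanishes_mult[OF _ _ op(2) zero_order[OF V(1,3)] one_order[OF V(4)[OF i]]])
        (intro smooth_intros smooth_on_dird V op | simp)+
    have neg: "smooth_on N (\<lambda>x. - 1 * ?t Y X i x)" "vanishes 3 (\<lambda>x. - 1 * ?t Y X i x) p" if "i = 1 \<or> i = 2" for i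
      using vanishes_mult[OF smooth_on_const[OF op(1), of "- 1"] s[OF sY sX, of i] op(2), of 0 3 3]
        v[OF sY sX Xd(2,1) that] smooth_on_mult[OF smooth_on_const[OF op(1), of "- 1"] s[OF sY sX, of i]] by simp_all
    show "vanishes 3 (\<lambda>x. (?t X Y 1 x + ?t X Y 2 x) + (- 1 * ?t Y X 1 x + - 1 * ?t Y X 2 x)) p"
      by (intro vanishes_add[OF _ _ op(2)] smooth_on_add s sX sY v Xd neg) auto
    show "lie_bracket X Y x $ m - Z x $ m = (?t X Y 1 x + ?t X Y 2 x) + (- 1 * ?t Y X 1 x + - 1 * ?t Y X 2 x)"
      if "x \<in> N" for x
      by (simp add: br[OF that] Z_def algebra_simps)
  qed
  then have "vanishes (Suc (k - 1)) (\<lambda>x. lie_bracket X Y x $ m - Z x $ m) p" for m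
    by (rule vanishes_mono) (use k in simp)
  then have "jet_bracket k p a b = jet (k - 1) Z p"
    unfolding jet_bracket_def X_def[symmetric] Y_def[symmetric]
    using jet_eq_iff_vanishes[OF sL sZ op(2), of "k - 1"] by blast
  moreover have "pd i j Z p = X p $ 1 *\<^sub>R pd (Suc i) j Y p + X p $ 2 *\<^sub>R pd i (Suc j) Y p
      - (Y p $ 1 *\<^sub>R pd (Suc i) j X p + Y p $ 2 *\<^sub>R pd i (Suc j) X p)" for i j
  proof -
    have lin: "pd i j (\<lambda>x. r *\<^sub>R partial 1 V x + s *\<^sub>R partial 2 V x) p = r *\<^sub>R pd (Suc i) j V p + s *\<^sub>R pd i (Suc j) V p"
      if "smooth_on N V" for r s and V :: "point \<Rightarrow> point"
    proof -
      have "pd i j (\<lambda>x. r *\<^sub>R partial 1 V x + s *\<^sub>R partial 2 V x) p =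
          pd i j (\<lambda>x. r *\<^sub>R partial 1 V x) p + pd i j (\<lambda>x. s *\<^sub>R partial 2 V x) p"
        by (rule pd_add[OF _ _ op(2)]; intro smooth_intros smooth_on_dird that op)
      then show ?thesis
        by (simp only: pd_scaleR_left[OF smooth_on_dird[OF that] op(2)] pd_partial1[OF that op(2)] pd_partial2)
    qed
    have "pd i j Z p = pd i j (\<lambda>x. (X p $ 1 *\<^sub>R partial 1 Y x + X p $ 2 *\<^sub>R partial 2 Y x) +
        (- 1) *\<^sub>R (Y p $ 1 *\<^sub>R partial 1 X x + Y p $ 2 *\<^sub>R partial 2 X x)) p"
      by (rule arg_cong[where f = "\<lambda>h. pd i j h p"]) (simp add: Z_def fun_eq_iff algebra_simps)
    also have "\<dots> = pd i j (\<lambda>x. X p $ 1 *\<^sub>R partial 1 Y x + X p $ 2 *\<^sub>R partial 2 Y x) p +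
        pd i j (\<lambda>x. (- 1) *\<^sub>R (Y p $ 1 *\<^sub>R partial 1 X x + Y p $ 2 *\<^sub>R partial 2 X x)) p"
      by (rule pd_add[OF _ _ op(2)]; intro smooth_intros smooth_on_dird sX sY op)
    also have "pd i j (\<lambda>x. (- 1) *\<^sub>R (Y p $ 1 *\<^sub>R partial 1 X x + Y p $ 2 *\<^sub>R partial 2 X x)) p =
        (- 1) *\<^sub>R pd i j (\<lambda>x. Y p $ 1 *\<^sub>R partial 1 X x + Y p $ 2 *\<^sub>R partial 2 X x) p"
      by (rule pd_scaleR_left[OF _ op(2)]; intro smooth_intros smooth_on_dird sX sY op)
    finally show ?thesis by (simp only: lin[OF sX] lin[OF sY]) simp
  qed
  ultimately show ?thesis
    using k by (auto simp: jet_pd fun_eq_iff X0 pX pY)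
qed

section \<open>The normalized isotropy planes\<close>

text \<open>The unique solution \<open>(T\<^sub>3\<^sub>0, T\<^sub>2\<^sub>1, T\<^sub>1\<^sub>2, T\<^sub>0\<^sub>3)\<close> of the linear system
  \<open>thomas T\<^sub>3\<^sub>0 T\<^sub>2\<^sub>1 T\<^sub>1\<^sub>2 = K\<close>, \<open>thomas T\<^sub>2\<^sub>1 T\<^sub>1\<^sub>2 T\<^sub>0\<^sub>3 = L\<close>.\<close>

definition sol30 :: "real^4 \<Rightarrow> real^4 \<Rightarrow> point"
  where "sol30 K L = vector [2 * L $ 0 - K $ 1, K $ 0]"
definition sol21 :: "real^4 \<Rightarrow> real^4 \<Rightarrow> point"
  where "sol21 K L = vector [(L $ 1 - 2 * K $ 2) / 3, L $ 0]"
definition sol12 :: "real^4 \<Rightarrow> real^4 \<Rightarrow> point"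
  where "sol12 K L = vector [- K $ 3, (2 * L $ 1 - K $ 2) / 3]"
definition sol03 :: "real^4 \<Rightarrow> real^4 \<Rightarrow> point"
  where "sol03 K L = vector [- L $ 3, L $ 2 - 2 * K $ 3]"

lemmas sol_defs = sol30_def sol21_def sol12_def sol03_def

lemma thomas_system:
  "thomas P Q R = K \<and> thomas Q R S = L \<longleftrightarrow>
    P = sol30 K L \<and> Q = sol21 K L \<and> R = sol12 K L \<and> S = sol03 K L"
  by (auto simp: thomas_def sol_defs vec4_eq_iff vec_eq_iff forall_2 field_simps)

lemma sol_linear:
  "sol30 (r *\<^sub>R K + s *\<^sub>R K') (r *\<^sub>R L + s *\<^sub>R L') = r *\<^sub>R sol30 K L + s *\<^sub>R sol30 K' L'"
  "sol21 (r *\<^sub>R K + s *\<^sub>R K') (r *\<^sub>R L + s *\<^sub>R L') = r *\<^sub>R sol21 K L + s *\<^sub>R sol21 K' L'"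
  "sol12 (r *\<^sub>R K + s *\<^sub>R K') (r *\<^sub>R L + s *\<^sub>R L') = r *\<^sub>R sol12 K L + s *\<^sub>R sol12 K' L'"
  "sol03 (r *\<^sub>R K + s *\<^sub>R K') (r *\<^sub>R L + s *\<^sub>R L') = r *\<^sub>R sol03 K L + s *\<^sub>R sol03 K' L'"
  by (simp_all add: sol_defs vec_eq_iff forall_2 field_simps)

text \<open>For the plane at a one-jet, symmetry makes the second derivatives of the element with value \<open>v\<close>
  the contraction with \<open>v\<close> of the tensor that solves the system for the first derivatives of the section.\<close>

definition second20 :: "(nat \<Rightarrow> nat \<Rightarrow> real^4) \<Rightarrow> point \<Rightarrow> point"
  where "second20 c v = v $ 1 *\<^sub>R sol30 (c 1 0) (c 0 1) + v $ 2 *\<^sub>R sol21 (c 1 0) (c 0 1)"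
definition second11 :: "(nat \<Rightarrow> nat \<Rightarrow> real^4) \<Rightarrow> point \<Rightarrow> point"
  where "second11 c v = v $ 1 *\<^sub>R sol21 (c 1 0) (c 0 1) + v $ 2 *\<^sub>R sol12 (c 1 0) (c 0 1)"
definition second02 :: "(nat \<Rightarrow> nat \<Rightarrow> real^4) \<Rightarrow> point \<Rightarrow> point"
  where "second02 c v = v $ 1 *\<^sub>R sol12 (c 1 0) (c 0 1) + v $ 2 *\<^sub>R sol03 (c 1 0) (c 0 1)"

lemmas second_defs = second20_def second11_def second02_def

text \<open>The values of \<open>thomas\<close> that the first-order isotropy equations prescribe for the third derivatives of
  the element with value \<open>v\<close>.\<close>

definition rhs1 :: "(nat \<Rightarrow> nat \<Rightarrow> real^4) \<Rightarrow> point \<Rightarrow> real^4"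
  where "rhs1 c v = v $ 1 *\<^sub>R c 2 0 + v $ 2 *\<^sub>R c 1 1 - twist (c 0 0) (second20 c v) (second11 c v)"
definition rhs2 :: "(nat \<Rightarrow> nat \<Rightarrow> real^4) \<Rightarrow> point \<Rightarrow> real^4"
  where "rhs2 c v = v $ 1 *\<^sub>R c 1 1 + v $ 2 *\<^sub>R c 0 2 - twist (c 0 0) (second11 c v) (second02 c v)"

text \<open>The element with value \<open>v\<close> of the plane \<open>H\<close> at the two-jet \<open>c\<close>; its two-jet is the element of the
  plane at the one-jet.\<close>

definition H_jet :: "(nat \<Rightarrow> nat \<Rightarrow> real^4) \<Rightarrow> point \<Rightarrow> vjet"
  where "H_jet c v = (\<lambda>i j.
    if i = 0 \<and> j = 0 then v
    else if i = 2 \<and> j = 0 then second20 c v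
    else if i = 1 \<and> j = 1 then second11 c v
    else if i = 0 \<and> j = 2 then second02 c v
    else if i = 3 \<and> j = 0 then sol30 (rhs1 c v) (rhs2 c v)
    else if i = 2 \<and> j = 1 then sol21 (rhs1 c v) (rhs2 c v)
    else if i = 1 \<and> j = 2 then sol12 (rhs1 c v) (rhs2 c v)
    else if i = 0 \<and> j = 3 then sol03 (rhs1 c v) (rhs2 c v)
    else 0)"

lemma H_jet_simps [simp]:
  "H_jet c v 0 0 = v" "H_jet c v 1 0 = 0" "H_jet c v 0 1 = 0" "H_jet c v (Suc 0) 0 = 0" "H_jet c v 0 (Suc 0) = 0"
  "H_jet c v 2 0 = second20 c v" "H_jet c v 1 1 = second11 c v" "H_jet c v (Suc 0) (Suc 0) = second11 c v"
  "H_jet c v 0 2 = second02 c v"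
  "H_jet c v 3 0 = sol30 (rhs1 c v) (rhs2 c v)" "H_jet c v 2 1 = sol21 (rhs1 c v) (rhs2 c v)"
  "H_jet c v 2 (Suc 0) = sol21 (rhs1 c v) (rhs2 c v)" "H_jet c v 1 2 = sol12 (rhs1 c v) (rhs2 c v)"
  "H_jet c v (Suc 0) 2 = sol12 (rhs1 c v) (rhs2 c v)" "H_jet c v 0 3 = sol03 (rhs1 c v) (rhs2 c v)"
  by (simp_all add: H_jet_def)

lemma H_jet_trunc: "3 < i + j \<Longrightarrow> H_jet c v i j = 0"
  by (auto simp: H_jet_def)

lemma twist_linear:
  "twist u (r *\<^sub>R P + s *\<^sub>R P') (r *\<^sub>R Q + s *\<^sub>R Q') = r *\<^sub>R twist u P Q + s *\<^sub>R twist u P' Q'"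
  by (simp add: twist_def vec4_eq_iff algebra_simps)

lemma second_linear:
  "second20 c (r *\<^sub>R v + s *\<^sub>R w) = r *\<^sub>R second20 c v + s *\<^sub>R second20 c w"
  "second11 c (r *\<^sub>R v + s *\<^sub>R w) = r *\<^sub>R second11 c v + s *\<^sub>R second11 c w"
  "second02 c (r *\<^sub>R v + s *\<^sub>R w) = r *\<^sub>R second02 c v + s *\<^sub>R second02 c w"
  by (simp_all add: second_defs algebra_simps)

lemma rhs_linear:
  "rhs1 c (r *\<^sub>R v + s *\<^sub>R w) = r *\<^sub>R rhs1 c v + s *\<^sub>R rhs1 c w"
  "rhs2 c (r *\<^sub>R v + s *\<^sub>R w) = r *\<^sub>R rhs2 c v + s *\<^sub>R rhs2 c w"
  by (simp_all add: rhs1_def rhs2_def second_linear twist_linear algebra_simps)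

lemma H_jet_linear: "H_jet c (r *\<^sub>R v + s *\<^sub>R w) = r *\<^sub>R H_jet c v + s *\<^sub>R H_jet c w"
proof (intro ext)
  fix i j :: nat
  let ?S = "{(0, 0), (2, 0), (1, 1), (0, 2), (3, 0), (2, 1), (1, 2), (0, 3)}"
  show "H_jet c (r *\<^sub>R v + s *\<^sub>R w) i j = (r *\<^sub>R H_jet c v + s *\<^sub>R H_jet c w) i j"
  proof (cases "(i, j) \<in> ?S")
    case True
    then show ?thesis
      unfolding insert_iff empty_iff prod.inject
      by (elim disjE conjE FalseE) (simp_all add: second_linear rhs_linear sol_linear)
  next
    case False
    then have "H_jet c v i j = 0" for v by (auto simp: H_jet_def)
    then show ?thesis by simp
  qed
qed

lemma H_jet_axis: "H_jet c v = v $ 1 *\<^sub>R H_jet c (axis 1 1) + v $ 2 *\<^sub>R H_jet c (axis 2 1)"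
proof -
  have "v = v $ 1 *\<^sub>R axis 1 1 + v $ 2 *\<^sub>R axis 2 1" by (simp add: vec_eq_iff forall_2)
  then show ?thesis by (metis H_jet_linear)
qed

lemma iso_equations_H_jet: "iso_equations k c (H_jet c v)"
proof -
  note s1 = thomas_system[THEN iffD2, OF conjI[OF refl conjI[OF refl conjI[OF refl refl]]]]
  have "thomas (second20 c v) (second11 c v) (second02 c v) = v $ 1 *\<^sub>R c 1 0 + v $ 2 *\<^sub>R c 0 1"
  proof -
    have "thomas (second20 c v) (second11 c v) (second02 c v) =
        v $ 1 *\<^sub>R thomas (sol30 (c 1 0) (c 0 1)) (sol21 (c 1 0) (c 0 1)) (sol12 (c 1 0) (c 0 1)) +
        v $ 2 *\<^sub>R thomas (sol21 (c 1 0) (c 0 1)) (sol12 (c 1 0) (c 0 1)) (sol03 (c 1 0) (c 0 1))"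
      by (simp add: second_defs thomas_def vec4_eq_iff algebra_simps)
    then show ?thesis using s1[of "c 1 0" "c 0 1"] by simp
  qed
  then show ?thesis
    using s1[of "rhs1 c v" "rhs2 c v"] by (simp add: iso_equations_def rhs1_def rhs2_def)
qed

lemma iso_equations_third_order:
  assumes "iso_equations 1 c a" "a 0 0 = v" "a 2 0 = second20 c v" "a 1 1 = second11 c v" "a 0 2 = second02 c v"
  shows "a 3 0 = sol30 (rhs1 c v) (rhs2 c v)" "a 2 1 = sol21 (rhs1 c v) (rhs2 c v)"
    "a 1 2 = sol12 (rhs1 c v) (rhs2 c v)" "a 0 3 = sol03 (rhs1 c v) (rhs2 c v)"
proof -
  have "thomas (a 3 0) (a 2 1) (a 1 2) = rhs1 c v \<and> thomas (a 2 1) (a 1 2) (a 0 3) = rhs2 c v"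
    using assms unfolding iso_equations_def rhs1_def rhs2_def by (auto simp: algebra_simps)
  then show "a 3 0 = sol30 (rhs1 c v) (rhs2 c v)" "a 2 1 = sol21 (rhs1 c v) (rhs2 c v)"
    "a 1 2 = sol12 (rhs1 c v) (rhs2 c v)" "a 0 3 = sol03 (rhs1 c v) (rhs2 c v)"
    unfolding thomas_system by auto
qed

lemma local_flow_H_jet:
  obtains X U \<phi> where "local_flow X U \<phi>" "p \<in> U" "jet 3 X p = H_jet c v"
proof (cases "v = 0")
  case True
  have "H_jet c 0 = 0" using H_jet_linear[of c 0 0 0 0] by simp
  moreover have "jet 3 (\<lambda>_. 0 :: point) p = 0" by (simp add: jet_pd fun_eq_iff)
  ultimately show thesis using that[OF local_flow_zero] True by auto
next
  case False
  have "trunc 3 (H_jet c v) = H_jet c v" by (auto simp: trunc_def fun_eq_iff H_jet_trunc)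
  then show thesis
    using local_flow_with_jet[of "H_jet c v" p thesis] False that by auto
qed

lemma trunc_jet: "r \<le> k \<Longrightarrow> trunc r (jet k X p) = jet r X p"
  by (auto simp: trunc_def jet_pd fun_eq_iff)

lemma H_jet_isotropy:
  assumes "(p, c) \<in> jet_bundle (Suc k)" "k \<le> 1"
  shows "trunc (k + 2) (H_jet c v) \<in> isotropy k (p, c)" "trunc (k + 2) (H_jet c v) \<in> W (k + 2) p"
proof -
  obtain X U \<phi> where X: "local_flow X U \<phi>" "p \<in> U" "jet 3 X p = H_jet c v" by (rule local_flow_H_jet)
  have j: "jet (k + 2) X p = trunc (k + 2) (H_jet c v)"
    unfolding X(3)[symmetric] by (rule trunc_jet[symmetric]) (use assms in simp)
  have "iso_equations k c (trunc (k + 2) (H_jet c v))"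
    using iso_equations_H_jet[of k c v] assms(2) by (auto simp: iso_equations_def trunc_def)
  then show "trunc (k + 2) (H_jet c v) \<in> isotropy k (p, c)"
    by (intro isotropyI[OF assms X(1,2) j]) (simp_all add: trunc_def)
  show "trunc (k + 2) (H_jet c v) \<in> W (k + 2) p"
    unfolding W_def j[symmetric] using local_flow_at_0[OF X(1,2)] by blast
qed

lemma horizontal_range:
  assumes lin: "\<And>r s v w. f (r *\<^sub>R v + s *\<^sub>R w) = r *\<^sub>R f v + s *\<^sub>R f w"
    and rho: "\<And>v. rho (f v) = v" and W: "\<And>v. f v \<in> W k p"
  shows "horizontal k p (range f)"
proof -
  have l: "linear f" using lin[of 1 _ 1] lin[of _ _ 0 0] by (intro linearI) auto
  have "inj f" using rho by (metis injI)
  then have "independent (f ` (Basis :: point set))"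
    using linear_independent_injective_image[OF l independent_Basis inj_on_subset[OF _ subset_UNIV]] by simp
  moreover have "span (f ` (Basis :: point set)) = span (range f)"
  proof -
    have "span (range f) = range f"
      using linear_subspace_image[OF l subspace_UNIV] by (simp only: span_eq_iff)
    then show ?thesis using linear_span_image[OF l, of Basis] by (simp only: span_Basis)
  qed
  ultimately have "dim (range f) = card (f ` (Basis :: point set))"
    by (intro dim_eq_card) simp_all
  also have "\<dots> = 2"
    using card_image[OF inj_on_subset[OF \<open>inj f\<close> subset_UNIV], of "Basis :: point set"] by simp
  finally have "dim (range f) = 2" .
  moreover have "subspace (range f)" using linear_subspace_image[OF l subspace_UNIV] .
  moreover have "rho ` range f = UNIV" using rho by (auto simp: image_image)
  ultimately show ?thesis using W by (auto simp: horizontal_def)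
qed

text \<open>A nonzero element over 0, together with two elements over the basis vectors, would be three
  independent vectors in a space of dimension two.\<close>

lemma horizontal_inj:
  assumes H: "horizontal k p H" and d: "d \<in> H" "rho d = 0"
  shows "d = 0"
proof (rule ccontr)
  assume d0: "d \<noteq> 0"
  have sub: "subspace H" and dim: "dim H = 2" and onto: "rho ` H = UNIV"
    using H by (auto simp: horizontal_def)
  have "axis 1 1 \<in> rho ` H" "axis 2 1 \<in> rho ` H" using onto by simp_all
  then obtain x y where xy: "x \<in> H" "y \<in> H" "rho x = axis 1 1" "rho y = axis 2 1" by auto
  obtain B where B: "B \<subseteq> H" "independent B" "H \<subseteq> span B" "card B = dim H" by (rule basis_exists)
  have fin: "finite B" using B(4) dim by (metis card.infinite zero_neq_numeral)
  have rl: "rho (r *\<^sub>R f) = r *\<^sub>R rho f" "rho (f + g) = rho f + rho g" "rho 0 = 0" for r f g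
    by (simp_all add: rho_def)
  have lin: "linear rho" by (rule linearI) (simp_all add: rl)
  have ind: "independent {d, x, y}"
  proof -
    have sx: "\<exists>r s. z = r *\<^sub>R x + s *\<^sub>R y" if z: "z \<in> span {x, y}" for z
    proof -
      obtain r where "z - r *\<^sub>R x \<in> span {y}" using z span_breakdown_eq[of z x "{y}"] by auto
      then obtain s where "z - r *\<^sub>R x = s *\<^sub>R y" by (auto simp: span_singleton)
      then have "z = r *\<^sub>R x + s *\<^sub>R y" by (simp add: diff_eq_eq add.commute)
      then show ?thesis by blast
    qed
    have y0: "y \<noteq> 0" using xy(4) by (metis rl(3) axis_eq_0_iff zero_neq_one)
    have "x \<notin> span {y}"
    proof
      assume "x \<in> span {y}"
      then obtain s where "x = s *\<^sub>R y" by (auto simp: span_singleton)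
      then have "axis 1 1 = s *\<^sub>R (axis 2 1 :: point)" using xy rl by metis
      then have "axis 1 1 $ (1::2) = (s *\<^sub>R (axis 2 1 :: point)) $ 1" by simp
      then show False by simp
    qed
    moreover have "d \<notin> span {x, y}"
    proof
      assume "d \<in> span {x, y}"
      then obtain r s where rs: "d = r *\<^sub>R x + s *\<^sub>R y" using sx by blast
      then have "(0::point) = r *\<^sub>R axis 1 1 + s *\<^sub>R axis 2 1" using d(2) xy by (simp add: rl)
      then have "r = 0" "s = 0" by (auto simp: vec_eq_iff forall_2)
      then show False using rs d0 by simp
    qed
    ultimately show ?thesis
      using y0 span_base[of x "{y}"] span_base[of d "{x, y}"] by (auto simp: independent_insert)
  qed
  have "card {d, x, y} \<le> card B"
    using independent_span_bound[OF fin ind] B(3) d xy by auto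
  moreover have "card {d, x, y} = 3"
  proof -
    have "x \<noteq> y"
    proof
      assume "x = y"
      then have "axis 1 1 $ (1::2) = (axis 2 1 :: point) $ 1" using xy by metis
      then show False by simp
    qed
    moreover have "d \<noteq> x" "d \<noteq> y" using d(2) xy by (metis axis_eq_0_iff zero_neq_one)+
    ultimately show ?thesis by simp
  qed
  ultimately show False using B(4) dim by simp
qed

lemma inv_into_range_section:
  assumes "\<And>v. g (f v) = v"
  shows "inv_into (range f) g v = f v"
proof (rule inv_into_f_eq)
  show "inj_on g (range f)" by (rule inj_on_inverseI[of _ f]) (use assms in auto)
qed (use assms in auto)

lemma H_const_iff: "a \<in> H_const p \<longleftrightarrow> (\<forall>i j. i + j \<noteq> 0 \<longrightarrow> a i j = 0)"
proof
  assume "\<forall>i j. i + j \<noteq> 0 \<longrightarrow> a i j = 0"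
  then have "a = jet 1 (\<lambda>_. a 0 0) p" by (auto simp: jet_pd fun_eq_iff)
  then show "a \<in> H_const p" by (auto simp: H_const_def)
qed (auto simp: H_const_def jet_pd)

text \<open>Uniqueness: for the two elements \<open>x\<close>, \<open>y\<close> over the basis vectors, the bracket condition says that
  their second derivatives agree where they overlap, so that the isotropy equations become the system of
  \<open>thomas_system\<close>.\<close>

lemma H1_eq:
  assumes \<theta>: "(p, c) \<in> jet_bundle 1"
  shows "H1 (p, c) = range (\<lambda>v. trunc 2 (H_jet c v))"
  unfolding H1_def fst_conv
proof (rule the_equality)
  let ?Q = "\<lambda>v. trunc 2 (H_jet c v)"
  have \<theta>': "(p, c) \<in> jet_bundle (Suc 0)" using \<theta> by simp
  note iso = H_jet_isotropy[OF \<theta>' zero_le_one, unfolded add_0]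
  have lin: "?Q (r *\<^sub>R v + s *\<^sub>R w) = r *\<^sub>R ?Q v + s *\<^sub>R ?Q w" for r s v w
    by (auto simp: trunc_def fun_eq_iff H_jet_linear)
  have rho: "rho (?Q v) = v" for v by (simp add: rho_def trunc_def)
  have inv: "inv_into (range ?Q) rho v = ?Q v" for v
    by (rule inv_into_range_section) (rule rho)
  have br: "jet_bracket 2 p (?Q v) (?Q w) = 0" for v w
  proof -
    have "jet_bracket 2 p (?Q v) (?Q w) = (\<lambda>i j. if i + j < 2 then
      ?Q v 0 0 $ 1 *\<^sub>R ?Q w (Suc i) j + ?Q v 0 0 $ 2 *\<^sub>R ?Q w i (Suc j)
      - (?Q w 0 0 $ 1 *\<^sub>R ?Q v (Suc i) j + ?Q w 0 0 $ 2 *\<^sub>R ?Q v i (Suc j)) else 0)"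
      by (rule jet_bracket_eq[OF iso(2) _ _ iso(2)]) (simp_all add: trunc_def)
    also have "\<dots> = 0"
    proof (intro ext)
      fix i j :: nat
      have "i + j < 2 \<Longrightarrow> (i = 0 \<and> j = 0) \<or> (i = 1 \<and> j = 0) \<or> (i = 0 \<and> j = 1)" by arith
      then show "(if i + j < 2 then
      ?Q v 0 0 $ 1 *\<^sub>R ?Q w (Suc i) j + ?Q v 0 0 $ 2 *\<^sub>R ?Q w i (Suc j)
      - (?Q w 0 0 $ 1 *\<^sub>R ?Q v (Suc i) j + ?Q w 0 0 $ 2 *\<^sub>R ?Q v i (Suc j)) else 0) = (0 :: vjet) i j"
        by (cases "i + j < 2")
          (auto simp: trunc_def second_defs numeral_2_eq_2[symmetric] algebra_simps)
    qed
    finally show ?thesis .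
  qed
  have t1: "trunc 1 (?Q w) i j = (if i + j = 0 then w else 0)" for w i j
  proof -
    consider "i = 0 \<and> j = 0" | "i = 1 \<and> j = 0" | "i = 0 \<and> j = 1" | "i + j > 1" by arith
    then show ?thesis by cases (auto simp: trunc_def)
  qed
  have const: "trunc 1 ` range ?Q = H_const p"
  proof (intro set_eqI iffI)
    fix a assume "a \<in> H_const p"
    then have "a i j = trunc 1 (?Q (a 0 0)) i j" for i j
      unfolding H_const_iff t1 by (cases "i + j = 0") (simp, auto)
    then have "a = trunc 1 (?Q (a 0 0))" by (intro ext)
    then show "a \<in> trunc 1 ` range ?Q" by blast
  next
    fix a assume "a \<in> trunc 1 ` range ?Q"
    then obtain v where "a = trunc 1 (?Q v)" by blast
    then show "a \<in> H_const p" unfolding H_const_iff by (simp only: t1) simp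
  qed
  show "horizontal 2 p (range ?Q) \<and> range ?Q \<subseteq> isotropy 0 (p, c) \<and> trunc 1 ` range ?Q = H_const p \<and>
      (\<forall>v w. jet_bracket 2 p (inv_into (range ?Q) rho v) (inv_into (range ?Q) rho w) = 0)"
    using horizontal_range[of ?Q, OF lin rho iso(2)] iso(1) const br inv by auto

  fix H assume H: "horizontal 2 p H \<and> H \<subseteq> isotropy 0 (p, c) \<and> trunc 1 ` H = H_const p \<and>
      (\<forall>v w. jet_bracket 2 p (inv_into H rho v) (inv_into H rho w) = 0)"
  then have hor: "horizontal 2 p H" by blast
  then have HW: "H \<subseteq> W 2 p" and sub: "subspace H" and onto: "rho ` H = UNIV" by (auto simp: horizontal_def)
  have H0: "a 1 0 = 0" "a 0 1 = 0" if "a \<in> H" for a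
  proof -
    have "trunc 1 a \<in> H_const p" using H that by blast
    then have "trunc 1 a 1 0 = 0" "trunc 1 a 0 1 = 0" unfolding H_const_iff by simp_all
    then show "a 1 0 = 0" "a 0 1 = 0" by (simp_all add: trunc_def)
  qed
  define x where "x = inv_into H rho (axis 1 1)"
  define y where "y = inv_into H rho (axis 2 1)"
  have xy: "x \<in> H" "y \<in> H" "x 0 0 = axis 1 1" "y 0 0 = axis 2 1"
    using onto inv_into_into f_inv_into_f unfolding x_def y_def rho_def[symmetric] by (metis UNIV_I)+
  have "jet_bracket 2 p x y = 0" using H by (simp add: x_def y_def)
  moreover have "jet_bracket 2 p x y = (\<lambda>i j. if i + j < 2 then y (Suc i) j - x i (Suc j) else 0)"
  proof -
    have "x \<in> W 2 p" "y \<in> W 2 p" using HW xy by auto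
    from jet_bracket_eq[OF this(1) H0[OF xy(1)] this(2) H0[OF xy(2)]]
    show ?thesis by (simp add: xy fun_eq_iff)
  qed
  ultimately have "(if i + j < 2 then y (Suc i) j - x i (Suc j) else 0) = 0" for i j
    by (metis zero_fun_def)
  from this[of 1 0] this[of 0 1] have sym: "y 2 0 = x 1 1" "y 1 1 = x 0 2"
    by (simp_all add: numeral_2_eq_2)
  have "iso_equations 0 c x" "iso_equations 0 c y"
    using isotropy_equations[OF \<theta>' zero_le_one _ H0[OF xy(1)]]
      isotropy_equations[OF \<theta>' zero_le_one _ H0[OF xy(2)]] H xy(1,2) by auto
  then have "thomas (x 2 0) (x 1 1) (x 0 2) = c 1 0 \<and> thomas (x 1 1) (x 0 2) (y 0 2) = c 0 1"
    using sym xy by (simp add: iso_equations_def)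
  then have sols: "x 2 0 = sol30 (c 1 0) (c 0 1)" "x 1 1 = sol21 (c 1 0) (c 0 1)"
    "x 0 2 = sol12 (c 1 0) (c 0 1)" "y 0 2 = sol03 (c 1 0) (c 0 1)"
    unfolding thomas_system by auto
  have ext: "a = ?Q v" if "a \<in> H" "a 0 0 = v" "a 2 0 = second20 c v" "a 1 1 = second11 c v" "a 0 2 = second02 c v" for a v
  proof (intro ext)
    fix i j :: nat
    have "i + j \<le> 2 \<Longrightarrow> (i = 0 \<and> j = 0) \<or> (i = 1 \<and> j = 0) \<or> (i = 0 \<and> j = 1) \<or> (i = 2 \<and> j = 0) \<or> (i = 1 \<and> j = 1) \<or> (i = 0 \<and> j = 2)"
      by arith
    then show "a i j = ?Q v i j"
      using that H0[OF that(1)] W_trunc[of a 2 p i j] HW by (cases "i + j \<le> 2") (auto simp: trunc_def)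
  qed
  have x: "x = ?Q (axis 1 1)" by (rule ext) (use xy sols in \<open>simp_all add: second_defs\<close>)
  have y: "y = ?Q (axis 2 1)" by (rule ext) (use xy sols sym in \<open>simp_all add: second_defs\<close>)
  have comb: "?Q v \<in> H" for v
  proof -
    have "?Q v = v $ 1 *\<^sub>R x + v $ 2 *\<^sub>R y"
      unfolding x y by (subst lin[symmetric]) (simp add: H_jet_axis[of c v] H_jet_linear)
    then show ?thesis using xy sub by (simp add: subspace_add subspace_scale)
  qed
  show "H = range ?Q"
  proof
    show "H \<subseteq> range ?Q"
    proof
      fix a assume a: "a \<in> H"
      have "a - ?Q (rho a) = 0"
        by (rule horizontal_inj[OF hor]) (use a comb sub rho[of "rho a"] in \<open>auto simp: subspace_diff rho_def\<close>)
      then have "a = ?Q (rho a)" by (metis eq_iff_diff_eq_0)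
      then show "a \<in> range ?Q" by blast
    qed
  qed (use comb in auto)
qed

text \<open>Here the isotropy equations alone leave no freedom once the two-jets are known.\<close>

lemma H2_eq:
  assumes \<theta>: "(p, c) \<in> jet_bundle 2"
  shows "H2 (p, c) = range (H_jet c)"
  unfolding H2_def fst_conv
proof (rule the_equality)
  have \<theta>': "(p, c) \<in> jet_bundle (Suc 1)" using \<theta> by (simp add: numeral_2_eq_2)
  have tr: "trunc 3 (H_jet c v) = H_jet c v" for v
    by (auto simp: trunc_def fun_eq_iff H_jet_trunc)
  have iso: "H_jet c v \<in> isotropy 1 (p, c)" "H_jet c v \<in> W 3 p" for v
  proof -
    have e: "(1::nat) + 2 = 3" by simp
    show "H_jet c v \<in> isotropy 1 (p, c)" "H_jet c v \<in> W 3 p"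
      using H_jet_isotropy[OF \<theta>' order_refl, of v] unfolding e tr by auto
  qed
  have rho: "rho (H_jet c v) = v" for v by (simp add: rho_def)
  have "trunc 2 (H_jet (trunc 1 c) v) = trunc 2 (H_jet c v)" for v
    by (auto simp: trunc_def fun_eq_iff H_jet_def second_defs)
  moreover have "jproj 1 (p, c) = (p, trunc 1 c)" by (simp add: jproj_def)
  moreover have "jproj 1 (p, c) \<in> jet_bundle 1" using jproj_section(1)[OF \<theta>'] .
  ultimately have H1: "H1 (jproj 1 (p, c)) = range (\<lambda>v. trunc 2 (H_jet c v))"
    using H1_eq[of p "trunc 1 c"] by simp
  show "horizontal 3 p (range (H_jet c)) \<and> range (H_jet c) \<subseteq> isotropy 1 (p, c) \<and>
      trunc 2 ` range (H_jet c) = H1 (jproj 1 (p, c))"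
    using horizontal_range[of "H_jet c", OF H_jet_linear rho iso(2)] iso(1) unfolding H1
    by (auto simp: image_image)
  fix H assume H: "horizontal 3 p H \<and> H \<subseteq> isotropy 1 (p, c) \<and> trunc 2 ` H = H1 (jproj 1 (p, c))"
  have a: "a = H_jet c (rho a)" if aH: "a \<in> H" for a
  proof -
    have "trunc 2 a \<in> range (\<lambda>v. trunc 2 (H_jet c v))" using H H1 aH by blast
    then obtain v where v: "trunc 2 a = trunc 2 (H_jet c v)" by blast
    have low: "a i j = H_jet c v i j" if "i + j \<le> 2" for i j
      using fun_cong[OF fun_cong[OF v, of i], of j] that by (simp add: trunc_def)
    have lows: "a 0 0 = v" "a 1 0 = 0" "a 0 1 = 0" "a 2 0 = second20 c v" "a 1 1 = second11 c v" "a 0 2 = second02 c v"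
      using low[of 0 0] low[of 1 0] low[of 0 1] low[of 2 0] low[of 1 1] low[of 0 2] by simp_all
    have "iso_equations 1 c a" by (rule isotropy_equations[OF \<theta>' order_refl _ lows(2,3)]) (use H aH in blast)
    note third = iso_equations_third_order[OF this lows(1,4,5,6)]
    have "a = H_jet c v"
    proof (intro ext)
      fix i j :: nat
      consider "i + j \<le> 2" | "i + j = 3" | "3 < i + j" by arith
      then show "a i j = H_jet c v i j"
      proof cases
        case 2
        then have "(i = 3 \<and> j = 0) \<or> (i = 2 \<and> j = 1) \<or> (i = 1 \<and> j = 2) \<or> (i = 0 \<and> j = 3)" by arith
        then show ?thesis using third by auto
      next
        case 3
        have "a \<in> W 3 p" using H aH by (auto simp: horizontal_def)
        then show ?thesis using 3 W_trunc H_jet_trunc by metis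
      qed (rule low)
    qed
    then show ?thesis using lows(1) by (simp add: rho_def)
  qed
  show "H = range (H_jet c)"
  proof
    show "H \<subseteq> range (H_jet c)" using a by blast
    show "range (H_jet c) \<subseteq> H"
    proof
      fix b assume "b \<in> range (H_jet c)"
      then obtain v where b: "b = H_jet c v" by blast
      have "v \<in> rho ` H" using H by (auto simp: horizontal_def)
      then obtain a' where "a' \<in> H" "v = rho a'" by blast
      then show "b \<in> H" using a[of a'] b by simp
    qed
  qed
qed

text \<open>The second derivatives of the bracket of the elements over the two basis vectors are the differences
  of their third derivatives that ought to agree by symmetry; the first derivatives of the bracket
  vanish, the second derivatives of the elements being symmetric by construction.\<close>

definition curvature_free :: "(nat \<Rightarrow> nat \<Rightarrow> real^4) \<Rightarrow> bool"
  where "curvature_free c \<longleftrightarrow>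
    sol30 (rhs1 c (axis 2 1)) (rhs2 c (axis 2 1)) = sol21 (rhs1 c (axis 1 1)) (rhs2 c (axis 1 1)) \<and>
    sol21 (rhs1 c (axis 2 1)) (rhs2 c (axis 2 1)) = sol12 (rhs1 c (axis 1 1)) (rhs2 c (axis 1 1)) \<and>
    sol12 (rhs1 c (axis 2 1)) (rhs2 c (axis 2 1)) = sol03 (rhs1 c (axis 1 1)) (rhs2 c (axis 1 1))"

lemma omega_eq_0_iff:
  assumes \<theta>: "(p, c) \<in> jet_bundle 2"
  shows "(\<forall>v w. omega (p, c) v w = 0) \<longleftrightarrow> curvature_free c"
proof -
  have rho: "rho (H_jet c v) = v" for v by (simp add: rho_def)
  have inv: "inv_into (H2 (p, c)) rho v = H_jet c v" for v
    unfolding H2_eq[OF \<theta>] by (rule inv_into_range_section) (rule rho)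
  have \<theta>': "(p, c) \<in> jet_bundle (Suc 1)" using \<theta> by (simp add: numeral_2_eq_2)
  have "trunc 3 (H_jet c v) = H_jet c v" for v
    by (auto simp: trunc_def fun_eq_iff H_jet_trunc)
  moreover have "(1::nat) + 2 = 3" by simp
  ultimately have HW: "H_jet c v \<in> W 3 p" for v
    using H_jet_isotropy(2)[OF \<theta>' order_refl, of v] by (simp only:)
  have br: "omega (p, c) v w = (\<lambda>i j. if i + j < 3 then
    v $ 1 *\<^sub>R H_jet c w (Suc i) j + v $ 2 *\<^sub>R H_jet c w i (Suc j)
    - (w $ 1 *\<^sub>R H_jet c v (Suc i) j + w $ 2 *\<^sub>R H_jet c v i (Suc j)) else 0)" for v w
    using jet_bracket_eq[OF HW H_jet_simps(2,3) HW H_jet_simps(2,3), of v w]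
    unfolding omega_def inv fst_conv H_jet_simps(1) by simp
  define e1 e2 :: point where "e1 = axis 1 1" and "e2 = axis 2 1"
  have om: "omega (p, c) v w i j = (if i + j < 3 then (v $ 1 * w $ 2 - v $ 2 * w $ 1) *\<^sub>R
      (H_jet c e2 (Suc i) j - H_jet c e1 i (Suc j)) else 0)" for v w i j
    unfolding br e1_def e2_def
    by (subst (1 2) H_jet_axis[of c w], subst (1 2) H_jet_axis[of c v]) (simp add: algebra_simps)
  have "(\<forall>v w. omega (p, c) v w = 0) \<longleftrightarrow> (\<forall>i j. i + j < 3 \<longrightarrow> H_jet c e2 (Suc i) j = H_jet c e1 i (Suc j))"
  proof
    assume "\<forall>v w. omega (p, c) v w = 0"
    then have "omega (p, c) e1 e2 i j = 0" for i j by simp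
    moreover have "e1 $ 1 * e2 $ 2 - e1 $ 2 * e2 $ 1 = 1" by (simp add: e1_def e2_def)
    ultimately have "(if i + j < 3 then H_jet c e2 (Suc i) j - H_jet c e1 i (Suc j) else 0) = 0" for i j
      unfolding om by (metis scaleR_one)
    then show "\<forall>i j. i + j < 3 \<longrightarrow> H_jet c e2 (Suc i) j = H_jet c e1 i (Suc j)"
      by (metis eq_iff_diff_eq_0)
  qed (auto simp: om fun_eq_iff)
  also have "\<dots> \<longleftrightarrow> curvature_free c"
  proof
    assume *: "\<forall>i j. i + j < 3 \<longrightarrow> H_jet c e2 (Suc i) j = H_jet c e1 i (Suc j)"
    from *[rule_format, of 2 0] *[rule_format, of 1 1] *[rule_format, of 0 2]
    show "curvature_free c"
      by (simp add: curvature_free_def e1_def e2_def numeral_2_eq_2[symmetric] numeral_3_eq_3[symmetric])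
  next
    assume cf: "curvature_free c"
    show "\<forall>i j. i + j < 3 \<longrightarrow> H_jet c e2 (Suc i) j = H_jet c e1 i (Suc j)"
    proof (intro allI impI)
      fix i j :: nat assume "i + j < 3"
      then have "(i = 0 \<and> j = 0) \<or> (i = 1 \<and> j = 0) \<or> (i = 0 \<and> j = 1) \<or> (i = 2 \<and> j = 0) \<or> (i = 1 \<and> j = 1) \<or> (i = 0 \<and> j = 2)"
        by arith
      then show "H_jet c e2 (Suc i) j = H_jet c e1 i (Suc j)"
        using cf by (elim disjE)
          (simp_all add: curvature_free_def e1_def e2_def second_defs numeral_2_eq_2[symmetric] numeral_3_eq_3[symmetric])
    qed
  qed
  finally show ?thesis .
qed

lemma M_eq: "M = {(p, c). (p, c) \<in> jet_bundle 2 \<and> curvature_free c}"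
proof -
  have "(\<forall>\<xi>\<in>tangent_space 2. \<forall>\<eta>\<in>tangent_space 2. omega2 \<theta> \<xi> \<eta> = 0) \<longleftrightarrow> (\<forall>v w. omega \<theta> v w = 0)" for \<theta>
  proof
    assume *: "\<forall>\<xi>\<in>tangent_space 2. \<forall>\<eta>\<in>tangent_space 2. omega2 \<theta> \<xi> \<eta> = 0"
    have "(v, 0) \<in> tangent_space 2" for v :: point by (simp add: tangent_space_def trunc_def fun_eq_iff)
    then show "\<forall>v w. omega \<theta> v w = 0" using * by (metis fst_conv omega2_def)
  qed (simp add: omega2_def)
  then have "M = {\<theta> \<in> jet_bundle 2. \<forall>v w. omega \<theta> v w = 0}" by (simp only: M_def)
  also have "\<dots> = {(p, c). (p, c) \<in> jet_bundle 2 \<and> curvature_free c}"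
  proof (rule set_eqI)
    fix \<theta> :: jet_point
    obtain p c where \<theta>: "\<theta> = (p, c)" by (rule prod.exhaust)
    show "\<theta> \<in> {\<theta> \<in> jet_bundle 2. \<forall>v w. omega \<theta> v w = 0} \<longleftrightarrow> \<theta> \<in> {(p, c). (p, c) \<in> jet_bundle 2 \<and> curvature_free c}"
      unfolding \<theta> mem_Collect_eq case_prod_conv using omega_eq_0_iff[of p c] by (rule conj_cong[OF refl])
  qed
  finally show ?thesis .
qed

section \<open>The orbit of the flat jet\<close>

definition wedge :: "point \<Rightarrow> point \<Rightarrow> real"
  where "wedge x y = x $ 1 * y $ 2 - x $ 2 * y $ 1"

text \<open>The numerator of the transform of the zero section, in terms of the first and second derivatives
  of the transformation; the denominator is the \<open>wedge\<close> of the first derivatives.\<close>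

definition numer :: "point \<times> point \<Rightarrow> point \<times> point \<times> point \<Rightarrow> real^4"
  where "numer f h = (case (f, h) of ((x, y), (P, Q, R)) \<Rightarrow> - vec4 (wedge x P)
    (wedge y P + 2 * wedge x Q) (wedge x R + 2 * wedge y Q) (wedge y R))"

definition numer1 :: "(nat \<Rightarrow> nat \<Rightarrow> point) \<Rightarrow> nat \<Rightarrow> nat \<Rightarrow> point \<times> point"
  where "numer1 G i j = (G (Suc i) j, G i (Suc j))"
definition numer2 :: "(nat \<Rightarrow> nat \<Rightarrow> point) \<Rightarrow> nat \<Rightarrow> nat \<Rightarrow> point \<times> point \<times> point"
  where "numer2 G i j = (G (Suc (Suc i)) j, G (Suc i) (Suc j), G i (Suc (Suc j)))"

text \<open>The right-hand sides of the equations for \<open>thomas\<close> of the third and fourth derivatives of a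
  transformation that takes the zero section to a section with jet \<open>c\<close> at a point with identical first
  derivative.\<close>

definition third1 :: "(nat \<Rightarrow> nat \<Rightarrow> point) \<Rightarrow> (nat \<Rightarrow> nat \<Rightarrow> real^4) \<Rightarrow> real^4"
  where "third1 G c = - (c 1 0 + (G 1 1 $ 2 + G 2 0 $ 1) *\<^sub>R c 0 0
   - numer (numer1 G 1 0) (numer2 G 0 0))"
definition third2 :: "(nat \<Rightarrow> nat \<Rightarrow> point) \<Rightarrow> (nat \<Rightarrow> nat \<Rightarrow> real^4) \<Rightarrow> real^4"
  where "third2 G c = - (c 0 1 + (G 0 2 $ 2 + G 1 1 $ 1) *\<^sub>R c 0 0
   - numer (numer1 G 0 1) (numer2 G 0 0))"
definition fourth20 :: "(nat \<Rightarrow> nat \<Rightarrow> point) \<Rightarrow> (nat \<Rightarrow> nat \<Rightarrow> real^4) \<Rightarrow> real^4"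
  where "fourth20 G c = - (c 2 0 + (2 * (G 1 1 $ 2 + G 2 0 $ 1)) *\<^sub>R c 1 0
   + (G 2 1 $ 2 + 2 * wedge (G 2 0) (G 1 1) + G 3 0 $ 1) *\<^sub>R c 0 0
   - (2 *\<^sub>R numer (numer1 G 1 0) (numer2 G 1 0) + numer (numer1 G 2 0) (numer2 G 0 0)))"
definition fourth11 :: "(nat \<Rightarrow> nat \<Rightarrow> point) \<Rightarrow> (nat \<Rightarrow> nat \<Rightarrow> real^4) \<Rightarrow> real^4"
  where "fourth11 G c = - (c 1 1 + (G 1 1 $ 2 + G 2 0 $ 1) *\<^sub>R c 0 1 + (G 0 2 $ 2 + G 1 1 $ 1) *\<^sub>R c 1 0
   + (G 1 2 $ 2 + wedge (G 2 0) (G 0 2) + G 2 1 $ 1) *\<^sub>R c 0 0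
   - (numer (numer1 G 1 0) (numer2 G 0 1) + numer (numer1 G 0 1) (numer2 G 1 0) + numer (numer1 G 1 1) (numer2 G 0 0)))"
definition fourth02 :: "(nat \<Rightarrow> nat \<Rightarrow> point) \<Rightarrow> (nat \<Rightarrow> nat \<Rightarrow> real^4) \<Rightarrow> real^4"
  where "fourth02 G c = - (c 0 2 + (2 * (G 0 2 $ 2 + G 1 1 $ 1)) *\<^sub>R c 0 1
   + (G 0 3 $ 2 + 2 * wedge (G 1 1) (G 0 2) + G 1 2 $ 1) *\<^sub>R c 0 0
   - (2 *\<^sub>R numer (numer1 G 0 1) (numer2 G 0 1) + numer (numer1 G 0 2) (numer2 G 0 0)))"

lemmas fourth_defs = fourth20_def fourth11_def fourth02_def

text \<open>Each side is a polynomial in the jet \<open>c\<close> and in the derivatives of the transformation. The latter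
  cancel: expressing \<open>c 0 0\<close> by the second derivatives and the third derivatives by the solution of
  their system turns the claim into polynomial identities.\<close>

lemma fourth_order_compatibility:
  assumes second: "thomas (G 2 0) (G 1 1) (G 0 2) = - c 0 0"
    and third: "thomas (G 3 0) (G 2 1) (G 1 2) = third1 G c" "thomas (G 2 1) (G 1 2) (G 0 3) = third2 G c"
  shows "sol21 (fourth20 G c) (fourth11 G c) - sol30 (fourth11 G c) (fourth02 G c) =
      sol30 (rhs1 c (axis 2 1)) (rhs2 c (axis 2 1)) - sol21 (rhs1 c (axis 1 1)) (rhs2 c (axis 1 1))"
    "sol12 (fourth20 G c) (fourth11 G c) - sol21 (fourth11 G c) (fourth02 G c) =
      sol21 (rhs1 c (axis 2 1)) (rhs2 c (axis 2 1)) - sol12 (rhs1 c (axis 1 1)) (rhs2 c (axis 1 1))"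
    "sol03 (fourth20 G c) (fourth11 G c) - sol12 (fourth11 G c) (fourth02 G c) =
      sol12 (rhs1 c (axis 2 1)) (rhs2 c (axis 2 1)) - sol03 (rhs1 c (axis 1 1)) (rhs2 c (axis 1 1))"
proof -
  have c0: "c 0 0 $ 0 = - G 2 0 $ 2" "c 0 0 $ 1 = G 2 0 $ 1 - 2 * G 1 1 $ 2"
    "c 0 0 $ 2 = 2 * G 1 1 $ 1 - G 0 2 $ 2" "c 0 0 $ 3 = G 0 2 $ 1"
    using second by (simp_all add: thomas_def vec4_eq_iff) 
  have sols: "G 3 0 = sol30 (third1 G c) (third2 G c)" "G 2 1 = sol21 (third1 G c) (third2 G c)"
    "G 1 2 = sol12 (third1 G c) (third2 G c)" "G 0 3 = sol03 (third1 G c) (third2 G c)"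
    using third thomas_system by blast+
  have t1: "third1 G c $ 0 = - (c 1 0 $ 0 + (G 1 1 $ 2 + G 2 0 $ 1) * c 0 0 $ 0 + wedge (G 2 0) (G 2 0))"
     "third1 G c $ 1 = - (c 1 0 $ 1 + (G 1 1 $ 2 + G 2 0 $ 1) * c 0 0 $ 1 + wedge (G 1 1) (G 2 0) + 2 * wedge (G 2 0) (G 1 1))"
     "third1 G c $ 2 = - (c 1 0 $ 2 + (G 1 1 $ 2 + G 2 0 $ 1) * c 0 0 $ 2 + wedge (G 2 0) (G 0 2) + 2 * wedge (G 1 1) (G 1 1))"
     "third1 G c $ 3 = - (c 1 0 $ 3 + (G 1 1 $ 2 + G 2 0 $ 1) * c 0 0 $ 3 + wedge (G 1 1) (G 0 2))"
    by (simp_all add: third1_def numer_def numer1_def numer2_def numeral_2_eq_2[symmetric])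
  have t2: "third2 G c $ 0 = - (c 0 1 $ 0 + (G 0 2 $ 2 + G 1 1 $ 1) * c 0 0 $ 0 + wedge (G 1 1) (G 2 0))"
     "third2 G c $ 1 = - (c 0 1 $ 1 + (G 0 2 $ 2 + G 1 1 $ 1) * c 0 0 $ 1 + wedge (G 0 2) (G 2 0) + 2 * wedge (G 1 1) (G 1 1))"
     "third2 G c $ 2 = - (c 0 1 $ 2 + (G 0 2 $ 2 + G 1 1 $ 1) * c 0 0 $ 2 + wedge (G 1 1) (G 0 2) + 2 * wedge (G 0 2) (G 1 1))"
     "third2 G c $ 3 = - (c 0 1 $ 3 + (G 0 2 $ 2 + G 1 1 $ 1) * c 0 0 $ 3 + wedge (G 0 2) (G 0 2))"
    by (simp_all add: third2_def numer_def numer1_def numer2_def numeral_2_eq_2[symmetric])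
  have num: "Suc (Suc 0) = 2" "Suc 2 = 3" by simp_all
  show "sol21 (fourth20 G c) (fourth11 G c) - sol30 (fourth11 G c) (fourth02 G c) =
      sol30 (rhs1 c (axis 2 1)) (rhs2 c (axis 2 1)) - sol21 (rhs1 c (axis 1 1)) (rhs2 c (axis 1 1))"
    by (simp add: fourth_defs numer_def numer1_def numer2_def num rhs1_def rhs2_def second_defs twist_def
        sols[unfolded One_nat_def] vec_eq_iff forall_2)
      (simp add: sol_defs t1[unfolded One_nat_def] t2[unfolded One_nat_def] wedge_def c0[unfolded One_nat_def] field_simps)
  show "sol12 (fourth20 G c) (fourth11 G c) - sol21 (fourth11 G c) (fourth02 G c) =
      sol21 (rhs1 c (axis 2 1)) (rhs2 c (axis 2 1)) - sol12 (rhs1 c (axis 1 1)) (rhs2 c (axis 1 1))"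
    by (simp add: fourth_defs numer_def numer1_def numer2_def num rhs1_def rhs2_def second_defs twist_def
        sols[unfolded One_nat_def] vec_eq_iff forall_2)
      (simp add: sol_defs t1[unfolded One_nat_def] t2[unfolded One_nat_def] wedge_def c0[unfolded One_nat_def] field_simps)
  show "sol03 (fourth20 G c) (fourth11 G c) - sol12 (fourth11 G c) (fourth02 G c) =
      sol12 (rhs1 c (axis 2 1)) (rhs2 c (axis 2 1)) - sol03 (rhs1 c (axis 1 1)) (rhs2 c (axis 1 1))"
    by (simp add: fourth_defs numer_def numer1_def numer2_def num rhs1_def rhs2_def second_defs twist_def
        sols[unfolded One_nat_def] vec_eq_iff forall_2)
      (simp add: sol_defs t1[unfolded One_nat_def] t2[unfolded One_nat_def] wedge_def c0[unfolded One_nat_def] field_simps)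
qed

lemma bounded_bilinear_wedge: "bounded_bilinear wedge"
  by (rule bilinear_conv_bounded_bilinear[THEN iffD1])
    (auto simp: bilinear_def wedge_def algebra_simps intro!: linearI)

lemma bounded_bilinear_numer: "bounded_bilinear numer"
  by (rule bilinear_conv_bounded_bilinear[THEN iffD1])
    (auto simp: bilinear_def numer_def wedge_def case_prod_beta vec4_eq_iff algebra_simps intro!: linearI)

lemma dird_bilinear:
  assumes bb: "bounded_bilinear pr" and f: "f differentiable (at x)" and h: "h differentiable (at x)"
  shows "dird v (\<lambda>x. pr (f x) (h x)) x = pr (f x) (dird v h x) + pr (dird v f x) (h x)"
    and "(\<lambda>x. pr (f x) (h x)) differentiable (at x)"
proof -
  note d = bounded_bilinear.FDERIV[OF bb has_dird[OF f] has_dird[OF h]]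
  show "dird v (\<lambda>x. pr (f x) (h x)) x = pr (f x) (dird v h x) + pr (dird v f x) (h x)"
    by (rule dird_eq[OF d])
  show "(\<lambda>x. pr (f x) (h x)) differentiable (at x)"
    using d unfolding differentiable_def by blast
qed

lemma dird_dird_bilinear:
  fixes f :: "point \<Rightarrow> 'a::real_normed_vector" and h :: "point \<Rightarrow> 'b::real_normed_vector"
  assumes bb: "bounded_bilinear pr" and f: "smooth_on V f" and h: "smooth_on V h" and p: "p \<in> V"
  shows "dird w (dird v (\<lambda>x. pr (f x) (h x))) p =
    pr (f p) (dird w (dird v h) p) + pr (dird w f p) (dird v h p) +
    (pr (dird v f p) (dird w h p) + pr (dird w (dird v f) p) (h p))"
proof -
  note d = smooth_on_differentiable
  have "dird w (dird v (\<lambda>x. pr (f x) (h x))) p =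
      dird w (\<lambda>x. pr (f x) (dird v h x) + pr (dird v f x) (h x)) p"
    by (rule dird_cong[OF smooth_on_open[OF f] p], rule dird_bilinear(1)[OF bb d[OF f] d[OF h]])
  also have "\<dots> = dird w (\<lambda>x. pr (f x) (dird v h x)) p + dird w (\<lambda>x. pr (dird v f x) (h x)) p"
    by (intro dird_add dird_bilinear(2)[OF bb] d[OF _ p] smooth_on_dird f h)
  also have "dird w (\<lambda>x. pr (f x) (dird v h x)) p = pr (f p) (dird w (dird v h) p) + pr (dird w f p) (dird v h p)"
    by (intro dird_bilinear(1)[OF bb] d[OF _ p] smooth_on_dird f h)
  also have "dird w (\<lambda>x. pr (dird v f x) (h x)) p = pr (dird v f p) (dird w h p) + pr (dird w (dird v f) p) (h p)"
    by (intro dird_bilinear(1)[OF bb] d[OF _ p] smooth_on_dird f h)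
  finally show ?thesis .
qed

lemma pd_low:
  "pd 1 0 h = partial 1 h" "pd 0 1 h = partial 2 h" "pd 2 0 h = partial 1 (partial 1 h)"
  "pd 1 1 h = partial 1 (partial 2 h)" "pd 0 2 h = partial 2 (partial 2 h)"
  by (simp_all add: pd_def numeral_2_eq_2)

lemma pd_bilinear:
  fixes f :: "point \<Rightarrow> 'a::real_normed_vector" and h :: "point \<Rightarrow> 'b::real_normed_vector"
  assumes bb: "bounded_bilinear pr" and f: "smooth_on V f" and h: "smooth_on V h" and p: "p \<in> V"
  defines "F \<equiv> \<lambda>x. pr (f x) (h x)"
  shows "pd 1 0 F p = pr (f p) (pd 1 0 h p) + pr (pd 1 0 f p) (h p)"
    "pd 0 1 F p = pr (f p) (pd 0 1 h p) + pr (pd 0 1 f p) (h p)"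
    "pd 2 0 F p = pr (f p) (pd 2 0 h p) + pr (pd 1 0 f p) (pd 1 0 h p) +
      (pr (pd 1 0 f p) (pd 1 0 h p) + pr (pd 2 0 f p) (h p))"
    "pd 1 1 F p = pr (f p) (pd 1 1 h p) + pr (pd 1 0 f p) (pd 0 1 h p) +
      (pr (pd 0 1 f p) (pd 1 0 h p) + pr (pd 1 1 f p) (h p))"
    "pd 0 2 F p = pr (f p) (pd 0 2 h p) + pr (pd 0 1 f p) (pd 0 1 h p) +
      (pr (pd 0 1 f p) (pd 0 1 h p) + pr (pd 0 2 f p) (h p))"
  unfolding pd_low F_def
  by (rule dird_bilinear(1)[OF bb smooth_on_differentiable[OF f p] smooth_on_differentiable[OF h p]]
      dird_dird_bilinear[OF bb f h p])+

lemma pd_Pair: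
  assumes "smooth_on V f" "smooth_on V h" "p \<in> V"
  shows "pd i j (\<lambda>x. (f x, h x)) p = (pd i j f p, pd i j h p)"
  using pd_linear_comp[OF bounded_linear_fst smooth_on_Pair[OF assms(1,2)] assms(3), of i j]
    pd_linear_comp[OF bounded_linear_snd smooth_on_Pair[OF assms(1,2)] assms(3), of i j]
  by (simp add: prod_eq_iff)

text \<open>The transform of the zero section in terms of \<open>wedge\<close> and \<open>numer\<close>.\<close>

lemma transformed_zero:
  assumes g: "smooth_on V g" and z: "z \<in> V"
  shows "transformed g z 0 = inverse (wedge (pd 1 0 g z) (pd 0 1 g z)) *\<^sub>R
      numer (pd 1 0 g z, pd 0 1 g z) (pd 2 0 g z, pd 1 1 g z, pd 0 2 g z)"
    and "jac g z = wedge (pd 1 0 g z) (pd 0 1 g z)"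
proof -
  have c: "partial i (\<lambda>x. g x $ k) z = partial i g z $ k" for i k
    by (rule dird_vec_nth[OF smooth_on_differentiable[OF g z]])
  have c2: "partial 1 (partial 1 (\<lambda>x. g x $ k)) z = pd 2 0 g z $ k"
      "partial 1 (partial 2 (\<lambda>x. g x $ k)) z = pd 1 1 g z $ k"
      "partial 2 (partial 2 (\<lambda>x. g x $ k)) z = pd 0 2 g z $ k" for k
    unfolding pd_low(3-5)[symmetric] by (rule pd_vec_nth[OF g z])+
  show "transformed g z 0 = inverse (wedge (pd 1 0 g z) (pd 0 1 g z)) *\<^sub>R
      numer (pd 1 0 g z, pd 0 1 g z) (pd 2 0 g z, pd 1 1 g z, pd 0 2 g z)"
    unfolding transformed_def law_def c c2 pd_low(1,2)
    by (simp add: numer_def wedge_def vec4_eq_iff algebra_simps)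
  show "jac g z = wedge (pd 1 0 g z) (pd 0 1 g z)"
    unfolding jac_def c pd_low by (simp add: wedge_def)
qed

lemma numer_identity: "numer (axis 1 1, axis 2 1) (P, Q, R) = - thomas P Q R"
  by (simp add: numer_def thomas_def wedge_def vec4_eq_iff)

lemma wedge_axis: "wedge (axis 1 1) y = y $ 2" "wedge y (axis 2 1) = y $ 1" "wedge y y = 0"
  by (simp_all add: wedge_def)

text \<open>The transform \<open>u\<close> of the zero section satisfies \<open>J u = N\<close> with bilinear expressions \<open>J\<close> and \<open>N\<close> in the
  derivatives of \<open>g\<close>; the equations are the Leibniz expansions of this identity up to order two, solved
  for the terms that contain the derivatives of \<open>g\<close> of highest order.\<close>

lemma transform_equations:
  assumes g: "smooth_on V g" and p: "p \<in> V" and j: "\<forall>z\<in>V. jac g z \<noteq> 0"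
    and id: "pd 1 0 g p = axis 1 1" "pd 0 1 g p = axis 2 1"
    and G: "G = (\<lambda>i j. pd i j g p)" and c: "c = (\<lambda>i j. pd i j (\<lambda>z. transformed g z 0) p)"
  shows "thomas (G 2 0) (G 1 1) (G 0 2) = - c 0 0"
    "thomas (G 3 0) (G 2 1) (G 1 2) = third1 G c" "thomas (G 2 1) (G 1 2) (G 0 3) = third2 G c"
    "thomas (G 4 0) (G 3 1) (G 2 2) = fourth20 G c" "thomas (G 3 1) (G 2 2) (G 1 3) = fourth11 G c"
    "thomas (G 2 2) (G 1 3) (G 0 4) = fourth02 G c"
proof -
  define u where "u = (\<lambda>z. transformed g z 0)"
  define J where "J = (\<lambda>z. wedge (partial 1 g z) (partial 2 g z))"
  define f1 where "f1 = (\<lambda>z. (partial 1 g z, partial 2 g z))"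
  define f2 where "f2 = (\<lambda>z. (partial 1 (partial 1 g) z, (partial 1 (partial 2 g) z, partial 2 (partial 2 g) z)))"
  have su: "smooth_on V u" unfolding u_def
    by (rule smooth_on_transformed[OF g smooth_on_const[OF smooth_on_open[OF g]] bspec[OF j]])
  have s: "smooth_on V (partial i g)" "smooth_on V (partial i (partial k g))" for i k
    by (intro smooth_on_dird g)+
  have sJ: "smooth_on V J" unfolding J_def wedge_def by (intro smooth_intros s)
  have sf: "smooth_on V f1" "smooth_on V f2" unfolding f1_def f2_def by (intro smooth_on_Pair s)+
  have eq: "J z *\<^sub>R u z = numer (f1 z) (f2 z)" if z: "z \<in> V" for z
    using bspec[OF j z] unfolding transformed_zero(2)[OF g z] u_def transformed_zero(1)[OF g z] J_def f1_def f2_def pd_low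
    by simp
  have pe: "pd i j (\<lambda>z. J z *\<^sub>R u z) p = pd i j (\<lambda>z. numer (f1 z) (f2 z)) p" for i j
    by (rule pd_cong[OF smooth_on_open[OF g] eq p])
  have pG: "pd i j (partial 1 g) p = G (Suc i) j" "pd i j (partial 2 g) p = G i (Suc j)" for i j
    unfolding G by (simp_all add: pd_partial1[OF g p] pd_partial2)
  have pf1: "pd i j f1 p = numer1 G i j" for i j
    unfolding f1_def numer1_def by (simp add: pd_Pair[OF s(1) s(1) p] pG)
  have pf2: "pd i j f2 p = numer2 G i j" for i j
    unfolding f2_def numer2_def
    by (simp add: pd_Pair[OF s(2) smooth_on_Pair[OF s(2) s(2)] p] pd_Pair[OF s(2) s(2) p]
        pd_partial1[OF s(1) p] pd_partial2 pG) (simp add: G pd_partial1[OF g p])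
  have d: "partial 1 g p = axis 1 1" "partial 2 g p = axis 2 1" using id unfolding pd_low by simp_all
  have f0: "f1 p = (axis 1 1, axis 2 1)" "f2 p = numer2 G 0 0"
    using d pf2[of 0 0] by (simp_all add: f1_def)
  have J0: "J p = 1" by (simp add: J_def d wedge_def)
  have c': "pd i j u p = c i j" for i j by (simp add: c u_def)
  have u0: "u p = c 0 0" using c'[of 0 0] by simp
  note Jp = pd_bilinear[OF bounded_bilinear_wedge s(1)[of 1] s(1)[of 2] p, folded J_def, unfolded pG d wedge_axis]
  note up = pd_bilinear[OF bounded_bilinear_scaleR sJ su p, unfolded c' J0 u0]
  note Np = pd_bilinear[OF bounded_bilinear_numer sf p, unfolded pf1 pf2 f0]
  have num: "Suc 0 = 1" "Suc 1 = 2" "Suc 2 = 3" "Suc 3 = 4" by simp_all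
  have n2: "numer (axis 1 1, axis 2 1) (numer2 G i j) = - thomas (G (Suc (Suc i)) j) (G (Suc i) (Suc j)) (G i (Suc (Suc j)))" for i j
    by (simp add: numer2_def numer_identity)
  show "thomas (G 2 0) (G 1 1) (G 0 2) = - c 0 0"
    using eq[OF p] unfolding J0 u0 f0 n2 num by simp
  show "thomas (G 3 0) (G 2 1) (G 1 2) = third1 G c"
    using pe[of 1 0] unfolding up(1) Np(1) n2 Jp(1) third1_def num
    by (simp add: algebra_simps eq_neg_iff_add_eq_0)
  show "thomas (G 2 1) (G 1 2) (G 0 3) = third2 G c"
    using pe[of 0 1] unfolding up(2) Np(2) n2 Jp(2) third2_def num
    by (simp add: algebra_simps eq_neg_iff_add_eq_0)
  show "thomas (G 4 0) (G 3 1) (G 2 2) = fourth20 G c"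
    using pe[of 2 0] unfolding up(3) Np(3) n2 Jp(1,3) fourth20_def num
    by (simp add: vec4_eq_iff algebra_simps)
  show "thomas (G 3 1) (G 2 2) (G 1 3) = fourth11 G c"
    using pe[of 1 1] unfolding up(4) Np(4) n2 Jp(1,2,4) fourth11_def num
    by (simp add: wedge_axis(3) algebra_simps eq_neg_iff_add_eq_0)
  show "thomas (G 2 2) (G 1 3) (G 0 4) = fourth02 G c"
    using pe[of 0 2] unfolding up(5) Np(5) n2 Jp(2,5) fourth02_def num
    by (simp add: vec4_eq_iff algebra_simps)
qed

text \<open>Composing \<open>g\<close> with a linear map multiplies numerator and denominator by its determinant. The map used
  here inverts the derivative of \<open>g\<close> at \<open>p\<close>.\<close>

lemma transformed_zero_normalize:
  assumes g: "smooth_on V g" and p: "p \<in> V" and j: "\<And>z. z \<in> V \<Longrightarrow> jac g z \<noteq> 0"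
  obtains h where "smooth_on V h" "\<And>z. z \<in> V \<Longrightarrow> jac h z \<noteq> 0" "pd 1 0 h p = axis 1 1" "pd 0 1 h p = axis 2 1"
    "\<And>z. z \<in> V \<Longrightarrow> transformed h z 0 = transformed g z 0"
proof -
  define x y where "x = pd 1 0 g p" and "y = pd 0 1 g p"
  define d where "d = wedge x y"
  have d0: "d \<noteq> 0" using j[OF p] transformed_zero(2)[OF g p] by (simp add: d_def x_def y_def)
  define L where "L = (\<lambda>w. vector [wedge w y / d, wedge x w / d] :: point)"
  have "linear L" by (rule linearI) (use d0 in \<open>simp_all add: L_def wedge_def vec_eq_iff forall_2 field_simps\<close>)
  then have L: "bounded_linear L" by (simp add: linear_conv_bounded_linear)
  have wL: "wedge (L a) (L b) = inverse d * wedge a b" for a b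
  proof -
    have "wedge (L a) (L b) = (wedge a y * wedge x b - wedge x a * wedge b y) / (d * d)"
      by (simp add: L_def wedge_def[of "vector _"] diff_divide_distrib)
    also have "wedge a y * wedge x b - wedge x a * wedge b y = d * wedge a b"
      unfolding d_def wedge_def by algebra
    finally show ?thesis using d0 by (simp add: field_simps)
  qed
  have nL: "numer (L a, L b) (L P, L Q, L R) = inverse d *\<^sub>R numer (a, b) (P, Q, R)" for a b P Q R
    by (simp add: numer_def wL vec4_eq_iff algebra_simps)
  define h where "h = (\<lambda>z. L (g z))"
  have h: "smooth_on V h" unfolding h_def by (rule smooth_on_linear_comp[OF g L])
  have pdh: "pd i k h z = L (pd i k g z)" if "z \<in> V" for i k z
    unfolding h_def by (rule pd_linear_comp[OF L g that])
  show thesis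
  proof (rule that[OF h])
    show "jac h z \<noteq> 0" if "z \<in> V" for z
      using j[OF that] d0 unfolding transformed_zero(2)[OF h that] transformed_zero(2)[OF g that] pdh[OF that] wL
      by simp
    show "pd 1 0 h p = axis 1 1" "pd 0 1 h p = axis 2 1"
      unfolding pdh[OF p] x_def[symmetric] y_def[symmetric] using d0
      by (simp_all add: L_def vec_eq_iff forall_2 wedge_axis d_def[symmetric])
    show "transformed h z 0 = transformed g z 0" if "z \<in> V" for z
      unfolding transformed_zero(1)[OF h that] transformed_zero(1)[OF g that] pdh[OF that] wL nL using d0 by simp
  qed
qed

lemma curvature_free_jet: "curvature_free c \<longleftrightarrow> curvature_free (\<lambda>i j. if i + j \<le> 2 then c i j else 0)"
  unfolding curvature_free_def rhs1_def rhs2_def second_defs by simp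

lemma curvature_free_iff_compatible:
  fixes G :: "nat \<Rightarrow> nat \<Rightarrow> point"
  assumes "thomas (G 2 0) (G 1 1) (G 0 2) = - c 0 0"
    "thomas (G 3 0) (G 2 1) (G 1 2) = third1 G c" "thomas (G 2 1) (G 1 2) (G 0 3) = third2 G c"
  shows "curvature_free c \<longleftrightarrow>
    sol21 (fourth20 G c) (fourth11 G c) = sol30 (fourth11 G c) (fourth02 G c) \<and>
    sol12 (fourth20 G c) (fourth11 G c) = sol21 (fourth11 G c) (fourth02 G c) \<and>
    sol03 (fourth20 G c) (fourth11 G c) = sol12 (fourth11 G c) (fourth02 G c)"
  using fourth_order_compatibility[OF assms] unfolding curvature_free_def by (metis eq_iff_diff_eq_0)

lemma curvature_free_transformed:
  assumes g: "smooth_on V g" and p: "p \<in> V" and j: "\<And>z. z \<in> V \<Longrightarrow> jac g z \<noteq> 0"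
  shows "curvature_free (jet 2 (\<lambda>z. transformed g z 0) p)"
proof -
  obtain h where h: "smooth_on V h" "\<And>z. z \<in> V \<Longrightarrow> jac h z \<noteq> 0" "pd 1 0 h p = axis 1 1" "pd 0 1 h p = axis 2 1"
    "\<And>z. z \<in> V \<Longrightarrow> transformed h z 0 = transformed g z 0"
    using transformed_zero_normalize[OF g p j] by metis
  define c where "c = (\<lambda>i j. pd i j (\<lambda>z. transformed h z 0) p)"
  define G where "G = (\<lambda>i j. pd i j h p)"
  have "\<forall>z\<in>V. jac h z \<noteq> 0" using h(2) by blast
  note eqs = transform_equations[OF h(1) p this h(3,4) G_def c_def]
  have "curvature_free c"
    unfolding curvature_free_iff_compatible[of G c, OF eqs(1-3)]
    using conjI[OF eqs(4,5)] conjI[OF eqs(5,6)] unfolding thomas_system by metis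
  moreover have "jet 2 (\<lambda>z. transformed g z 0) p = (\<lambda>i j. if i + j \<le> 2 then c i j else 0)"
    unfolding c_def jet_pd[symmetric] by (rule jet_cong[OF smooth_on_open[OF g] p]) (simp add: h(5))
  ultimately show ?thesis using curvature_free_jet[of c] by simp
qed

text \<open>Conversely, the derivatives of a transformation with identical first derivative can be solved for
  order by order: the second ones from \<open>c 0 0\<close> up to a choice, made here so that the mixed ones vanish, the
  third ones uniquely, and the fourth ones from an overdetermined system that is compatible iff the
  curvature vanishes.\<close>

lemma transformation_jet_exists:
  assumes "curvature_free c"
  obtains G :: "nat \<Rightarrow> nat \<Rightarrow> point" where "G 0 0 = 0" "G 1 0 = axis 1 1" "G 0 1 = axis 2 1"
    "thomas (G 2 0) (G 1 1) (G 0 2) = - c 0 0"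
    "thomas (G 3 0) (G 2 1) (G 1 2) = third1 G c" "thomas (G 2 1) (G 1 2) (G 0 3) = third2 G c"
    "thomas (G 4 0) (G 3 1) (G 2 2) = fourth20 G c" "thomas (G 3 1) (G 2 2) (G 1 3) = fourth11 G c"
    "thomas (G 2 2) (G 1 3) (G 0 4) = fourth02 G c"
proof -
  define A where "A = (\<lambda>(i::nat) (j::nat). if i = 1 \<and> j = 0 then axis 1 1 else if i = 0 \<and> j = 1 then axis 2 1
    else if i = 2 \<and> j = 0 then vector [c 0 0 $ 1, - c 0 0 $ 0]
    else if i = 0 \<and> j = 2 then vector [c 0 0 $ 3, - c 0 0 $ 2] else 0 :: point)"
  define B where "B = (\<lambda>(i::nat) (j::nat). if i = 3 \<and> j = 0 then sol30 (third1 A c) (third2 A c)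
    else if i = 2 \<and> j = 1 then sol21 (third1 A c) (third2 A c)
    else if i = 1 \<and> j = 2 then sol12 (third1 A c) (third2 A c)
    else if i = 0 \<and> j = 3 then sol03 (third1 A c) (third2 A c) else A i j)"
  define G where "G = (\<lambda>(i::nat) (j::nat). if i = 4 \<and> j = 0 then sol30 (fourth20 B c) (fourth11 B c)
    else if i = 3 \<and> j = 1 then sol21 (fourth20 B c) (fourth11 B c)
    else if i = 2 \<and> j = 2 then sol12 (fourth20 B c) (fourth11 B c)
    else if i = 1 \<and> j = 3 then sol03 (fourth20 B c) (fourth11 B c)
    else if i = 0 \<and> j = 4 then sol03 (fourth11 B c) (fourth02 B c) else B i j)"
  have low: "B i j = A i j" if "i + j \<le> 2" for i j using that by (auto simp: B_def)
  have low': "G i j = B i j" if "i + j \<le> 3" for i j using that by (auto simp: G_def)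
  have third: "third1 B c = third1 A c" "third2 B c = third2 A c" "third1 G c = third1 A c" "third2 G c = third2 A c"
    by (simp_all add: third1_def third2_def numer1_def numer2_def low low')
  have fourth: "fourth20 G c = fourth20 B c" "fourth11 G c = fourth11 B c" "fourth02 G c = fourth02 B c"
    by (simp_all add: fourth_defs numer1_def numer2_def low')
  have 2: "thomas (B 2 0) (B 1 1) (B 0 2) = - c 0 0"
    by (simp add: low) (simp add: A_def thomas_def vec4_eq_iff)
  have 3: "thomas (B 3 0) (B 2 1) (B 1 2) = third1 B c \<and> thomas (B 2 1) (B 1 2) (B 0 3) = third2 B c"
    unfolding thomas_system third by (simp add: B_def)
  have compat: "sol21 (fourth20 B c) (fourth11 B c) = sol30 (fourth11 B c) (fourth02 B c)"
    "sol12 (fourth20 B c) (fourth11 B c) = sol21 (fourth11 B c) (fourth02 B c)"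
    "sol03 (fourth20 B c) (fourth11 B c) = sol12 (fourth11 B c) (fourth02 B c)"
    using curvature_free_iff_compatible[of B c] 2 3 assms by blast+
  have 4: "thomas (G 4 0) (G 3 1) (G 2 2) = fourth20 B c \<and> thomas (G 3 1) (G 2 2) (G 1 3) = fourth11 B c"
    unfolding thomas_system by (simp add: G_def)
  have overlap: "thomas (G 3 1) (G 2 2) (G 1 3) = fourth11 B c \<and> thomas (G 2 2) (G 1 3) (G 0 4) = fourth02 B c"
    unfolding thomas_system by (simp add: G_def compat)
  show thesis
  proof (rule that[of G])
    show "G 0 0 = 0" "G 1 0 = axis 1 1" "G 0 1 = axis 2 1" by (simp_all add: low' low) (simp_all add: A_def)
    show "thomas (G 2 0) (G 1 1) (G 0 2) = - c 0 0" using 2 by (simp add: low')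
    show "thomas (G 3 0) (G 2 1) (G 1 2) = third1 G c" "thomas (G 2 1) (G 1 2) (G 0 3) = third2 G c"
      using 3 by (simp_all add: low' third)
    show "thomas (G 4 0) (G 3 1) (G 2 2) = fourth20 G c" "thomas (G 3 1) (G 2 2) (G 1 3) = fourth11 G c"
      "thomas (G 2 2) (G 1 3) (G 0 4) = fourth02 G c"
      using 4 overlap by (simp_all add: fourth)
  qed
qed

lemma transform_equations_unique:
  assumes "- c 0 0 = - c' 0 0" "third1 G c = third1 G c'" "third2 G c = third2 G c'"
    "fourth20 G c = fourth20 G c'" "fourth11 G c = fourth11 G c'" "fourth02 G c = fourth02 G c'" "i + j \<le> 2"
  shows "c i j = c' i j"
proof -
  have 0: "c 0 0 = c' 0 0" using assms(1) by simp
  have 1: "c 1 0 = c' 1 0" "c 0 1 = c' 0 1"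
    using assms(2,3) by (simp_all add: third1_def third2_def 0)
  have 2: "c 2 0 = c' 2 0" "c 1 1 = c' 1 1" "c 0 2 = c' 0 2"
    using assms(4-6) 1 by (simp_all add: fourth_defs 0)
  have "(i = 0 \<and> j = 0) \<or> (i = 1 \<and> j = 0) \<or> (i = 0 \<and> j = 1) \<or> (i = 2 \<and> j = 0) \<or> (i = 1 \<and> j = 1) \<or> (i = 0 \<and> j = 2)"
    using assms(7) by arith
  then show ?thesis using 0 1 2 by (elim disjE conjE) simp_all
qed

lemma curvature_free_in_orbit:
  assumes \<theta>: "(p, c) \<in> jet_bundle 2" and c: "curvature_free c"
  shows "(p, c) \<in> orbit 2 (sjet 2 zero_section 0)"
proof -
  obtain G :: "nat \<Rightarrow> nat \<Rightarrow> point" where G0: "G 0 0 = 0" "G 1 0 = axis 1 1" "G 0 1 = axis 2 1"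
    and eqG: "thomas (G 2 0) (G 1 1) (G 0 2) = - c 0 0"
    "thomas (G 3 0) (G 2 1) (G 1 2) = third1 G c" "thomas (G 2 1) (G 1 2) (G 0 3) = third2 G c"
    "thomas (G 4 0) (G 3 1) (G 2 2) = fourth20 G c" "thomas (G 3 1) (G 2 2) (G 1 3) = fourth11 G c"
    "thomas (G 2 2) (G 1 3) (G 0 4) = fourth02 G c"
    by (rule transformation_jet_exists[OF c])
  define g where "g = poly_jet 4 p G"
  have sg: "smooth_on UNIV g" unfolding g_def by (rule smooth_on_poly_jet) simp
  have pg: "pd i j g p = (if i + j \<le> 4 then G i j else 0)" for i j unfolding g_def by (rule pd_poly_jet)
  have "jac g p = 1"
    unfolding transformed_zero(2)[OF sg UNIV_I] using pg[of 1 0] pg[of 0 1] G0 by (simp add: wedge_def)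
  then obtain T where T: "open T" "p \<in> T" "point_transformation T g"
    using local_point_transformation[OF sg UNIV_I, of p] by auto
  note P = point_transformation_image[OF T(3)]
  define U where "U = g ` T"
  define f where "f = inv_into T g"
  have fg: "f (g x) = x" if "x \<in> T" for x using P(2) that by (simp add: f_def)
  have pt: "point_transformation U f"
  proof (rule point_transformation_left_inverse)
    show "smooth_on U f" using P(3) by (simp add: U_def f_def)
    show "smooth_on UNIV g" by (rule sg)
    show "g (f z) = z" if "z \<in> U" for z using that by (auto simp: U_def fg)
  qed simp
  have "g p = 0" using pg[of 0 0] G0 by simp
  then have U0: "0 \<in> U" "f 0 = p" using T(2) fg[OF T(2)] by (force simp: U_def)+
  define h where "h = inv_into U f"
  have fU: "f ` U = T" by (force simp: U_def fg)
  have hg: "h x = g x" if "x \<in> T" for x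
    unfolding h_def
    by (rule inv_into_f_eq) (use point_transformation_image(2)[OF pt] that fg in \<open>auto simp: U_def\<close>)
  have sh: "smooth_on T h" using point_transformation_image(3)[OF pt] by (simp add: h_def fU)
  have jh: "\<forall>z\<in>T. jac h z \<noteq> 0" using jac_nonzero(2)[OF pt] by (simp add: h_def fU)
  have ph: "pd i j h p = (if i + j \<le> 4 then G i j else 0)" for i j
    unfolding pg[symmetric] by (rule pd_cong[OF T(1) hg T(2)])
  define c' where "c' = (\<lambda>i j. pd i j (\<lambda>z. transformed h z 0) p)"
  define G' where "G' = (\<lambda>i j. pd i j h p)"
  have id: "pd 1 0 h p = axis 1 1" "pd 0 1 h p = axis 2 1" using ph[of 1 0] ph[of 0 1] G0 by simp_all
  note eqs = transform_equations[OF sh T(2) jh id G'_def c'_def]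
  have G': "G' i j = G i j" if "i + j \<le> 4" for i j using that by (simp add: G'_def ph)
  have same: "third1 G' c' = third1 G c'" "third2 G' c' = third2 G c'" "fourth20 G' c' = fourth20 G c'"
    "fourth11 G' c' = fourth11 G c'" "fourth02 G' c' = fourth02 G c'"
    by (simp_all add: third1_def third2_def fourth_defs numer1_def numer2_def G')
  have G'4: "G' 2 0 = G 2 0" "G' 1 1 = G 1 1" "G' 0 2 = G 0 2" "G' 3 0 = G 3 0" "G' 2 1 = G 2 1" "G' 1 2 = G 1 2" "G' 0 3 = G 0 3"
    "G' 4 0 = G 4 0" "G' 3 1 = G 3 1" "G' 2 2 = G 2 2" "G' 1 3 = G 1 3" "G' 0 4 = G 0 4"
    by (rule G'; simp)+
  have cc: "c i j = c' i j" if "i + j \<le> 2" for i j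
    by (rule transform_equations_unique[OF _ _ _ _ _ _ that])
      (use eqs eqG in \<open>simp_all only: G'4 same\<close>)
  have "c = jet 2 (\<lambda>z. transformed h z 0) p"
  proof (intro ext)
    fix i j
    obtain S :: "point \<Rightarrow> total" where "c = jet 2 (snd \<circ> S) p" using \<theta> by (auto simp: jet_bundle_def sjet_def)
    then have "c i j = 0" if "\<not> i + j \<le> 2" using that by (simp add: jet_pd)
    then show "c i j = jet 2 (\<lambda>z. transformed h z 0) p i j"
      using cc[of i j] by (auto simp: jet_pd c'_def)
  qed
  then have "(p, c) = (f 0, jet 2 (\<lambda>z. transformed (inv_into U f) z 0) (f 0))" by (simp only: U0 h_def)
  then show ?thesis unfolding orbit_zero_section using pt U0(1) by blast
qed

theorem lemma4p4:
  shows "M = orbit 2 (sjet 2 zero_section 0)"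
proof
  show "M \<subseteq> orbit 2 (sjet 2 zero_section 0)"
    unfolding M_eq using curvature_free_in_orbit by auto
next
  show "orbit 2 (sjet 2 zero_section 0) \<subseteq> M"
    unfolding orbit_zero_section
  proof clarify
    fix U f assume f: "point_transformation U f" and U: "(0::point) \<in> U"
    let ?g = "inv_into U f"
    note P = point_transformation_image[OF f]
    have z: "f 0 \<in> f ` U" using U by simp
    have "(f 0, jet 2 (\<lambda>z. transformed ?g z 0) (f 0)) \<in> jet_bundle 2"
      by (rule jet_bundleI[OF z smooth_on_transformed[OF P(3) smooth_on_const[OF P(5)] jac_nonzero(2)[OF f]]])
    moreover have "curvature_free (jet 2 (\<lambda>z. transformed ?g z 0) (f 0))"
      by (rule curvature_free_transformed[OF P(3) z jac_nonzero(2)[OF f]])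
    ultimately show "(f 0, jet 2 (\<lambda>z. transformed ?g z 0) (f 0)) \<in> M" unfolding M_eq by simp
  qed
qed

end
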